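(* For $0\le k\le n$, the map $\widetilde{\psi}_{n,k}:\widetilde R^q_{n,k}\to\widetilde S^q_{n,k}$ descends to a well-defined map $\psi_{n,k}:R^q_{n,k}\to S^q_{n,k}$; that is, the composition of $\widetilde\psi_{n,k}$ with the quotient map $\widetilde S^q_{n,k}\to S^q_{n,k}$ vanishes on all quantum Type I and Type II Russell relations.
   Context: Quantum Russell space. A diagram is a crossingless matching of the points $1,\ldots,2n$ on a line (arcs below the line) with exactly $k$ of its arcs dotted (one dot each). Arc $(p,p')$ is nested in arc $(e,e')$ if $e<p<p'<e'$. $\widetilde R^q_{n,k}$ is the free $\mathbb{Z}[q,q^{-1}]$-module on diagrams, and $R^q_{n,k}$ is its quotient by the quantum Type I and II relations. In these, $a<b<c<d$; the diagrams are identical except as indicated; a bar marks a dotted arc; $x_1,\ldots,x_\alpha$ are all undotted arcs $(e,e')$ with $e<a$, $d<e'$, ordered from innermost to outermost, $x_i=(x_{i_1},x_{i_2})$; $n_i$ is the number of dotted arcs $(y_1,y_2)$ with $x_{i_1}<y_1<a$ and $d<y_2<x_{i_2}$. Type I: $[ad,\overline{bc}]=[\overline{ab},cd]+[ab,\overline{cd}]+q^{-1}[\overline{ad},bc]+(1-q^{-2})\sum_{i=1}^\alpha q^{\,i-n_i}[ab,cd,\overline{x_i}]$. Type II: $[\overline{ab},\overline{cd}]=[\overline{ad},\overline{bc}]+(1-q^{-2})\sum_{i=1}^\alpha q^{\,i-1-n_i}[\overline{ad},bc,\overline{x_i}]$. (Here $[\ldots,\overline{x_i}]$ means that $x_i$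 is dotted, the other $x_j$ staying undotted.) Kauffman--Lins space. Fix $2(n+k)$ points on a line; the leftmost $k$ and the rightmost $k$ form the left and right "projectors". $\widetilde S^q_{n,k}$ is the $\mathbb{Z}[q^{1/2},q^{-1/2}]$-module spanned by tangle diagrams below the line (up to regular isotopy) consisting of $n+k$ arcs with the given endpoints and finitely many circles, modulo: (i) a diagram having an arc with both endpoints in one projector is $0$; (ii) a circle equals $-q-q^{-1}$; (iii) a crossing whose over-strand runs from upper left to lower right equals $q^{1/2}$ times the smoothing joining the two upper ends and the two lower ends plus $q^{-1/2}$ times the smoothing joining the two left ends and the two right ends (the other crossing is the 90-degree rotation). The map $\varphi_{n,k-1}:\widetilde S^q_{n,k-1}\to\widetilde S^q_{n,k}$ adds one new endpoint at the far left (in the left projector) and one at the far right (in the right projector), joined by an arc below everything else. For $k\ge1$, $S^q_{n,k}=\operatorname{coker}\varphi_{n,k-1}$; $S^q_{n,0}=\widetilde S^q_{n,0}$. The map $\widetilde\psi_{n,k}$. For a diagram $x$, add $k$ points on each side of its $2n$ points, forming the projectors. Keep the undotted arcs. Replace each dotted arc $(p,r)$ by a strand from $p$ to the left projector and a strand from $r$ to the right projector, where the left endpoints $p_1<\cdots<p_k$ of dotted arcs are joined so that $p_j$ goes to the $j$-th point from the right in the left projector, and the right endpoints $r_1<\cdots<r_k$ so that $r_j$ goes to the $j$-th point from the right in the right projector. Crossings are minimal: if a dotted arc is nested in an undotted arc, its left strand passes under and its right strand passes over that undotted arc (once each); otherwise its strands do not meet that undotted arc; strands from nested dotted arcs are disjoint;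 for unnested dotted arcs the only crossing is that the right strand of the left dotted arc passes over the left strand of the right dotted arc. Finally multiply by $q^{-1/2}$ for each pair of nested dotted arcs. Extend linearly. *)

theory Defs
  imports Complex_Main "HOL-Library.Poly_Mapping" "HOL-Library.Set_Algebras" "HOL-Library.FuncSet"
begin

section \<open>Laurent polynomials and free modules\<close>

text \<open>
  The group ring of the integers. On the Russell side the exponent \<open>m\<close> stands for \<open>q\<^sup>m\<close>
  (\<open>qpow\<close>); on the Kauffman--Lins side it stands for \<open>q\<^sup>m\<^sup>/\<^sup>2\<close> (\<open>hpow\<close>). The inclusion
  of the first ring into the second doubles exponents (\<open>q_to_half\<close>).
\<close>

type_synonym laurent = "int \<Rightarrow>\<^sub>0 int"

definition qpow :: "int \<Rightarrow> laurent" where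
  "qpow m = Poly_Mapping.single m 1"

definition hpow :: "int \<Rightarrow> laurent" where
  "hpow m = Poly_Mapping.single m 1"

definition q_to_half :: "laurent \<Rightarrow> laurent" where
  "q_to_half c = (\<Sum>m\<in>Poly_Mapping.keys c. Poly_Mapping.single (2 * m) (Poly_Mapping.lookup c m))"

definition smult :: "laurent \<Rightarrow> ('b \<Rightarrow>\<^sub>0 laurent) \<Rightarrow> ('b \<Rightarrow>\<^sub>0 laurent)" where
  "smult c f = Poly_Mapping.map ((*) c) f"

definition basis :: "'b \<Rightarrow> ('b \<Rightarrow>\<^sub>0 laurent)" where
  "basis x = Poly_Mapping.single x 1"

lemma lookup_smult [simp]: "Poly_Mapping.lookup (smult c f) x = c * Poly_Mapping.lookup f x"
  by (simp add: smult_def map.rep_eq when_def)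

global_interpretation free: module smult
  defines free_span = free.span
  by unfold_locales
    (auto intro!: poly_mapping_eqI simp: lookup_add algebra_simps)

definition free_on :: "'b set \<Rightarrow> ('b \<Rightarrow>\<^sub>0 laurent) set" where
  "free_on B = {f. Poly_Mapping.keys f \<subseteq> B}"

text \<open>The extension of \<open>g\<close> from basis elements, linear along the ring homomorphism \<open>\<sigma>\<close>.\<close>

definition lin_ext ::
  "(laurent \<Rightarrow> laurent) \<Rightarrow> ('a \<Rightarrow> ('b \<Rightarrow>\<^sub>0 laurent)) \<Rightarrow> ('a \<Rightarrow>\<^sub>0 laurent) \<Rightarrow> ('b \<Rightarrow>\<^sub>0 laurent)" where
  "lin_ext \<sigma> g f = (\<Sum>x\<in>Poly_Mapping.keys f. smult (\<sigma> (Poly_Mapping.lookup f x)) (g x))"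


section \<open>The quantum Russell space\<close>

type_synonym arc = "nat \<times> nat"

text \<open>A dotted diagram: the set of undotted arcs and the set of dotted arcs.\<close>

type_synonym dotted = "arc set \<times> arc set"

definition crossingless_matching :: "nat \<Rightarrow> arc set \<Rightarrow> bool" where
  "crossingless_matching n M \<longleftrightarrow>
     (\<forall>(a, b)\<in>M. 1 \<le> a \<and> a < b \<and> b \<le> 2 * n) \<and>
     (\<forall>p\<in>{1..2 * n}. \<exists>!e. e \<in> M \<and> (p = fst e \<or> p = snd e)) \<and>
     (\<forall>(a, b)\<in>M. \<forall>(c, d)\<in>M. \<not> (a < c \<and> c < b \<and> b < d))"

definition dotted_diagrams :: "nat \<Rightarrow> nat \<Rightarrow> dotted set" where
  "dotted_diagrams n k =
     {(U, D). U \<inter> D = {} \<and> crossingless_matching n (U \<union> D) \<and> card D = k}"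

definition nested :: "arc \<Rightarrow> arc \<Rightarrow> bool" where
  "nested p e \<longleftrightarrow> fst e < fst p \<and> snd p < snd e"

definition russell_free :: "nat \<Rightarrow> nat \<Rightarrow> (dotted \<Rightarrow>\<^sub>0 laurent) set" where
  "russell_free n k = free_on (dotted_diagrams n k)"

text \<open>
  \<open>U\<close> and \<open>D\<close> are the undotted and dotted arcs common to all diagrams of a relation.
  The arcs \<open>x\<^sub>1, \<dots>, x\<^sub>\<alpha>\<close> form the set \<open>enclosing U a d\<close>; they are totally ordered by nesting,
  and \<open>depth U a d x\<close> is the index \<open>i\<close> with \<open>x = x\<^sub>i\<close>, counted from the innermost arc.
\<close>

definition enclosing :: "arc set \<Rightarrow> nat \<Rightarrow> nat \<Rightarrow> arc set" where
  "enclosing U a d = {x \<in> U. nested (a, d) x}"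

definition depth :: "arc set \<Rightarrow> nat \<Rightarrow> nat \<Rightarrow> arc \<Rightarrow> nat" where
  "depth U a d x = card {y \<in> enclosing U a d. y = x \<or> nested y x}"

definition dots_between :: "arc set \<Rightarrow> nat \<Rightarrow> nat \<Rightarrow> arc \<Rightarrow> nat" where
  "dots_between D a d x = card {y \<in> D. nested y x \<and> nested (a, d) y}"

text \<open>
  A relation is imposed whenever the configurations \<open>{ad, bc}\<close> and \<open>{ab, cd}\<close> both extend by
  the common arcs to crossingless matchings; all other diagrams occurring are then diagrams too.
\<close>

definition type_I :: "nat \<Rightarrow> nat \<Rightarrow> (dotted \<Rightarrow>\<^sub>0 laurent) set" where
  "type_I n k =
     {basis (insert (a, d) U, insert (b, c) D)
      - (basis (insert (c, d) U, insert (a, b) D)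
         + basis (insert (a, b) U, insert (c, d) D)
         + smult (qpow (-1)) (basis (insert (b, c) U, insert (a, d) D))
         + smult (1 - qpow (-2))
             (\<Sum>x\<in>enclosing U a d.
                smult (qpow (int (depth U a d x) - int (dots_between D a d x)))
                  (basis (insert (a, b) (insert (c, d) U) - {x}, insert x D))))
      | a b c d U D.
        a < b \<and> b < c \<and> c < d \<and>
        (insert (a, d) U, insert (b, c) D) \<in> dotted_diagrams n k \<and>
        (insert (c, d) U, insert (a, b) D) \<in> dotted_diagrams n k}"

definition type_II :: "nat \<Rightarrow> nat \<Rightarrow> (dotted \<Rightarrow>\<^sub>0 laurent) set" where
  "type_II n k =
     {basis (U, insert (a, b) (insert (c, d) D))
      - (basis (U, insert (a, d) (insert (b, c) D))
         + smult (1 - qpow (-2))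
             (\<Sum>x\<in>enclosing U a d.
                smult (qpow (int (depth U a d x) - 1 - int (dots_between D a d x)))
                  (basis (insert (b, c) U - {x}, insert x (insert (a, d) D)))))
      | a b c d U D.
        a < b \<and> b < c \<and> c < d \<and>
        (U, insert (a, b) (insert (c, d) D)) \<in> dotted_diagrams n k \<and>
        (U, insert (a, d) (insert (b, c) D)) \<in> dotted_diagrams n k}"

definition russell_relations :: "nat \<Rightarrow> nat \<Rightarrow> (dotted \<Rightarrow>\<^sub>0 laurent) set" where
  "russell_relations n k = free_span (type_I n k \<union> type_II n k)"

definition russell_class :: "nat \<Rightarrow> nat \<Rightarrow> (dotted \<Rightarrow>\<^sub>0 laurent) \<Rightarrow> (dotted \<Rightarrow>\<^sub>0 laurent) set" where
  "russell_class n k f = f +o russell_relations n k"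

definition russell_space :: "nat \<Rightarrow> nat \<Rightarrow> (dotted \<Rightarrow>\<^sub>0 laurent) set set" where
  "russell_space n k = russell_class n k ` russell_free n k"


section \<open>Tangle diagrams\<close>

text \<open>
  A tangle diagram below the line, put in general position with respect to the height function,
  is read from bottom to top as a list of elementary pieces; \<open>(g, i)\<close> is the piece \<open>g\<close> with
  \<open>i\<close> vertical strands to its left (strand positions are counted from \<open>0\<close>). \<open>Cup\<close> is a local
  minimum, \<open>Cap\<close> a local maximum. In \<open>OverNW\<close> the over-strand runs from upper left to lower
  right, in \<open>OverNE\<close> from upper right to lower left.
\<close>

datatype piece = Cup | Cap | OverNW | OverNE

type_synonym tangle = "(piece \<times> nat) list"

fun ins :: "piece \<Rightarrow> nat" where
  "ins Cup = 0" | "ins Cap = 2" | "ins OverNW = 2" | "ins OverNE = 2"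

fun outs :: "piece \<Rightarrow> nat" where
  "outs Cup = 2" | "outs Cap = 0" | "outs OverNW = 2" | "outs OverNE = 2"

fun opposite :: "piece \<Rightarrow> piece" where
  "opposite OverNW = OverNE" | "opposite OverNE = OverNW" | "opposite g = g"

abbreviation is_crossing :: "piece \<Rightarrow> bool" where
  "is_crossing g \<equiv> g = OverNW \<or> g = OverNE"

text \<open>\<open>from_to m w m'\<close>: the list \<open>w\<close> can be stacked on \<open>m\<close> strands and ends with \<open>m'\<close> strands.\<close>

fun from_to :: "nat \<Rightarrow> tangle \<Rightarrow> nat \<Rightarrow> bool" where
  "from_to m [] m' \<longleftrightarrow> m = m'"
| "from_to m ((g, i) # w) m' \<longleftrightarrow> i + ins g \<le> m \<and> from_to (m - ins g + outs g) w m'"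

text \<open>
  The \<open>2 (n + k)\<close> endpoints are \<open>0, \<dots>, 2 (n + k) - 1\<close> from left to right: the left projector is
  \<open>{..<k}\<close>, the right projector is \<open>{2 * n + k..<2 * n + 2 * k}\<close>.
\<close>

definition tangles :: "nat \<Rightarrow> nat \<Rightarrow> tangle set" where
  "tangles n k = {w. from_to 0 w (2 * (n + k))}"

text \<open>
  The moves generating regular isotopy of diagrams given as lists of pieces: planar isotopy
  (exchanging the heights of distant pieces, straightening a strand, passing a strand across a
  local extremum) and the second and third Reidemeister moves, but not the first.
\<close>

inductive move :: "tangle \<Rightarrow> tangle \<Rightarrow> bool" where
  exchange: "i + ins g \<le> j \<Longrightarrow> move [(g, i), (h, j - ins g + outs g)] [(h, j), (g, i)]"
| straighten_left: "move [(Cup, i), (Cap, i + 1)] []"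
| straighten_right: "move [(Cup, i + 1), (Cap, i)] []"
| slide_cup: "is_crossing g \<Longrightarrow> move [(Cup, i), (g, i + 1)] [(Cup, i + 1), (opposite g, i)]"
| slide_cap: "is_crossing g \<Longrightarrow> move [(g, i + 1), (Cap, i)] [(opposite g, i), (Cap, i + 1)]"
| reidemeister2: "is_crossing g \<Longrightarrow> move [(g, i), (opposite g, i)] []"
| reidemeister3: "is_crossing g \<Longrightarrow>
    move [(g, i), (g, i + 1), (g, i)] [(g, i + 1), (g, i), (g, i + 1)]"

text \<open>
  \<open>(t, p)\<close> is the \<open>p\<close>-th point of the diagram at the level above its first \<open>t\<close> pieces; \<open>linked\<close>
  relates points joined within one piece. (Points beyond the actual number of strands are only
  linked to one another.)
\<close>

inductive linked :: "tangle \<Rightarrow> nat \<times> nat \<Rightarrow> nat \<times> nat \<Rightarrow> bool" for w where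
  "t < length w \<Longrightarrow> w ! t = (g, i) \<Longrightarrow> p < i \<Longrightarrow> linked w (t, p) (Suc t, p)"
| "t < length w \<Longrightarrow> w ! t = (g, i) \<Longrightarrow> i + ins g \<le> p \<Longrightarrow>
     linked w (t, p) (Suc t, p - ins g + outs g)"
| "t < length w \<Longrightarrow> w ! t = (Cup, i) \<Longrightarrow> linked w (Suc t, i) (Suc t, i + 1)"
| "t < length w \<Longrightarrow> w ! t = (Cap, i) \<Longrightarrow> linked w (t, i) (t, i + 1)"
| "t < length w \<Longrightarrow> w ! t = (g, i) \<Longrightarrow> is_crossing g \<Longrightarrow> linked w (t, i) (Suc t, i + 1)"
| "t < length w \<Longrightarrow> w ! t = (g, i) \<Longrightarrow> is_crossing g \<Longrightarrow> linked w (t, i + 1) (Suc t, i)"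

definition joined :: "tangle \<Rightarrow> nat \<Rightarrow> nat \<Rightarrow> bool" where
  "joined w p p' \<longleftrightarrow> equivclp (linked w) (length w, p) (length w, p')"

definition has_turnback :: "nat \<Rightarrow> nat \<Rightarrow> tangle \<Rightarrow> bool" where
  "has_turnback n k w \<longleftrightarrow>
     (\<exists>P\<in>{{..<k}, {2 * n + k..<2 * n + 2 * k}}. \<exists>p\<in>P. \<exists>p'\<in>P. p \<noteq> p' \<and> joined w p p')"


section \<open>The Kauffman--Lins space\<close>

text \<open>
  Two conventions for the relation that a diagram having an arc with both endpoints in one
  projector is zero. \<open>Planar\<close> is the usual property of a projector: the diagrams are
  crossingless (equivalently, by the crossing relation, the arc in question has no crossings).
  \<open>Arbitrary\<close> drops this restriction; then for \<open>k \<ge> 2\<close> a turnback clasped with a neighbouring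
  strand gives the additional relation \<open>(1 - q\<^sup>2) x = 0\<close> for every diagram \<open>x\<close>. The construction
  is carried out for both.
\<close>

datatype convention = Planar | Arbitrary

definition turnbacks :: "convention \<Rightarrow> nat \<Rightarrow> nat \<Rightarrow> tangle set" where
  "turnbacks \<kappa> n k =
     {w \<in> tangles n k. has_turnback n k w \<and>
        (\<kappa> = Planar \<longrightarrow> (\<forall>(g, i)\<in>set w. \<not> is_crossing g))}"

definition isotopy_rels :: "nat \<Rightarrow> nat \<Rightarrow> (tangle \<Rightarrow>\<^sub>0 laurent) set" where
  "isotopy_rels n k =
     {basis (u @ l @ v) - basis (u @ r @ v) | u l r v.
        move l r \<and> u @ l @ v \<in> tangles n k \<and> u @ r @ v \<in> tangles n k}"

definition circle_rels :: "nat \<Rightarrow> nat \<Rightarrow> (tangle \<Rightarrow>\<^sub>0 laurent) set" where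
  "circle_rels n k =
     {basis (u @ [(Cup, i), (Cap, i)] @ v) - smult (- hpow 2 - hpow (-2)) (basis (u @ v)) | u i v.
        u @ [(Cup, i), (Cap, i)] @ v \<in> tangles n k}"

definition crossing_rels :: "nat \<Rightarrow> nat \<Rightarrow> (tangle \<Rightarrow>\<^sub>0 laurent) set" where
  "crossing_rels n k =
     {basis (u @ [(OverNW, i)] @ v)
      - (smult (hpow 1) (basis (u @ [(Cap, i), (Cup, i)] @ v))
         + smult (hpow (-1)) (basis (u @ v))) | u i v.
        u @ [(OverNW, i)] @ v \<in> tangles n k}
     \<union>
     {basis (u @ [(OverNE, i)] @ v)
      - (smult (hpow 1) (basis (u @ v))
         + smult (hpow (-1)) (basis (u @ [(Cap, i), (Cup, i)] @ v))) | u i v.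
        u @ [(OverNE, i)] @ v \<in> tangles n k}"

definition KL_relations :: "convention \<Rightarrow> nat \<Rightarrow> nat \<Rightarrow> (tangle \<Rightarrow>\<^sub>0 laurent) set" where
  "KL_relations \<kappa> n k =
     free_span (isotopy_rels n k \<union> basis ` turnbacks \<kappa> n k \<union> circle_rels n k \<union> crossing_rels n k)"

definition KL_class ::
  "convention \<Rightarrow> nat \<Rightarrow> nat \<Rightarrow> (tangle \<Rightarrow>\<^sub>0 laurent) \<Rightarrow> (tangle \<Rightarrow>\<^sub>0 laurent) set" where
  "KL_class \<kappa> n k f = f +o KL_relations \<kappa> n k"

definition KL_tilde :: "convention \<Rightarrow> nat \<Rightarrow> nat \<Rightarrow> (tangle \<Rightarrow>\<^sub>0 laurent) set set" where
  "KL_tilde \<kappa> n k = KL_class \<kappa> n k ` free_on (tangles n k)"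

text \<open>The map \<open>\<phi>\<close> from level \<open>k - 1\<close> to level \<open>k\<close>, on diagrams and on classes.\<close>

definition add_outer_arc :: "tangle \<Rightarrow> tangle" where
  "add_outer_arc w = (Cup, 0) # map (\<lambda>(g, i). (g, i + 1)) w"

definition phi ::
  "convention \<Rightarrow> nat \<Rightarrow> nat \<Rightarrow> (tangle \<Rightarrow>\<^sub>0 laurent) set \<Rightarrow> (tangle \<Rightarrow>\<^sub>0 laurent) set" where
  "phi \<kappa> n k X = lin_ext id (\<lambda>w. basis (add_outer_arc w)) ` X + KL_relations \<kappa> n k"

text \<open>
  The projection to the cokernel of \<open>\<phi>\<close>: the coset of the class \<open>X\<close> modulo the image of \<open>\<phi>\<close>,
  as a set of linear combinations of diagrams.
\<close>

definition KL_proj ::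
  "convention \<Rightarrow> nat \<Rightarrow> nat \<Rightarrow> (tangle \<Rightarrow>\<^sub>0 laurent) set \<Rightarrow> (tangle \<Rightarrow>\<^sub>0 laurent) set" where
  "KL_proj \<kappa> n k X = (if k = 0 then X else X + \<Union> (phi \<kappa> n k ` KL_tilde \<kappa> n (k - 1)))"

definition KL_space :: "convention \<Rightarrow> nat \<Rightarrow> nat \<Rightarrow> (tangle \<Rightarrow>\<^sub>0 laurent) set set" where
  "KL_space \<kappa> n k = KL_proj \<kappa> n k ` KL_tilde \<kappa> n k"

definition KL_zero :: "convention \<Rightarrow> nat \<Rightarrow> nat \<Rightarrow> (tangle \<Rightarrow>\<^sub>0 laurent) set" where
  "KL_zero \<kappa> n k = KL_proj \<kappa> n k (KL_class \<kappa> n k 0)"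


section \<open>The map from dotted diagrams to tangle diagrams\<close>

text \<open>
  A strand \<open>(e, e', h)\<close> joins the endpoints \<open>e < e'\<close>; where two strands cross, the one with the
  larger \<open>h\<close> is above. The strands replacing a dotted arc have \<open>h = 0\<close> (left) and \<open>h = 2\<close>
  (right), undotted arcs have \<open>h = 1\<close>.
\<close>

type_synonym strand = "nat \<times> nat \<times> nat"

text \<open>
  The point \<open>p \<in> {1..2 * n}\<close> becomes the endpoint \<open>k + p - 1\<close>. The \<open>j\<close>-th endpoint from the right
  in the left projector is \<open>k - j\<close>, and in the right projector it is \<open>2 * n + 2 * k - j\<close>.
\<close>

definition psi_strands :: "nat \<Rightarrow> nat \<Rightarrow> dotted \<Rightarrow> strand set" where
  "psi_strands n k = (\<lambda>(U, D).
     {(k + e - 1, k + e' - 1, 1) | e e'. (e, e') \<in> U}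
     \<union> {(k - card {p' \<in> fst ` D. p' \<le> p}, k + p - 1, 0) | p. p \<in> fst ` D}
     \<union> {(k + r - 1, 2 * n + 2 * k - card {r' \<in> snd ` D. r' \<le> r}, 2) | r. r \<in> snd ` D})"

text \<open>
  The strands are drawn one above the other in the order of their left endpoints. When
  \<open>(i, j, h)\<close> is drawn, the strands already present that end between \<open>i\<close> and \<open>j\<close> are
  those starting to the left of \<open>i\<close>. A minimum is created at position \<open>i\<close>, and its right leg
  moves to the right across these strands, in the order of their endpoints. As a strand nested
  in another one is drawn after it, two strands cross exactly once if their endpoints
  interleave, and not at all otherwise. The moving leg runs from lower left to upper right.
\<close>

definition crossed_strands :: "strand set \<Rightarrow> nat \<Rightarrow> nat \<Rightarrow> strand list" where
  "crossed_strands A i j =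
     sorted_key_list_of_set (\<lambda>(e, s, g). s) {(e, s, g) \<in> A. e < i \<and> i < s \<and> s < j}"

definition draw_strand :: "strand set \<Rightarrow> strand \<Rightarrow> tangle" where
  "draw_strand A = (\<lambda>(i, j, h).
     (Cup, i) # map (\<lambda>(t, (e, s, g)). (if g < h then OverNE else OverNW, t))
                  (enumerate (i + 1) (crossed_strands A i j)))"

definition draw :: "strand set \<Rightarrow> tangle" where
  "draw A = concat (map (draw_strand A) (sorted_key_list_of_set fst A))"

definition nested_dotted_pairs :: "dotted \<Rightarrow> nat" where
  "nested_dotted_pairs = (\<lambda>(U, D). card {(y, z) \<in> D \<times> D. nested y z})"

definition psi_diagram :: "nat \<Rightarrow> nat \<Rightarrow> dotted \<Rightarrow> (tangle \<Rightarrow>\<^sub>0 laurent)" where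
  "psi_diagram n k x =
     smult (hpow (- int (nested_dotted_pairs x))) (basis (draw (psi_strands n k x)))"

definition psi_tilde ::
  "convention \<Rightarrow> nat \<Rightarrow> nat \<Rightarrow> (dotted \<Rightarrow>\<^sub>0 laurent) \<Rightarrow> (tangle \<Rightarrow>\<^sub>0 laurent) set" where
  "psi_tilde \<kappa> n k f = KL_class \<kappa> n k (lin_ext q_to_half (psi_diagram n k) f)"

end

theory Submission
  imports "HOL-Computational_Algebra.Polynomial" Defs
begin

text \<open>
  Let every strand carry a spin and evaluate tangle diagrams by the spin-state sum of the Kauffman
  bracket, with all spins in both projectors down. Turnbacks and diagrams with an outer arc evaluate
  to \<open>0\<close>. Conversely, a combination of tangles all of whose values are \<open>0\<close> vanishes in the quotient:
  modulo the relations, which have value \<open>0\<close> themselves, every tangle reduces to a combination of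
  Dyck words with \<open>k\<close> arcs leaving each projector, and these have linearly independent values, by
  triangularity with respect to a leading spin configuration. So it suffices to compare values.

  In the value of a dotted diagram the left strand of a dotted arc acts on the spins of the undotted
  arcs it crosses by a power of \<open>K\<close>, and the right strand by \<open>K\<^sup>-\<^sup>1\<close> or by the raising operator \<open>E\<close>,
  according to the spin of its endpoint. Hence an interval of endpoints acts by a polynomial in \<open>E K\<close>,
  computed by recursion over nested arcs, and the value of the diagram is the constant coefficient
  of its polynomial. On the interval from \<open>a\<close> to \<open>d\<close> both relations hold without the sum up to a
  multiple of the variable. Moving the variable outwards through the enclosing undotted arcs \<open>x\<^sub>i\<close>
  produces the sum of the diagrams with \<open>x\<^sub>i\<close> dotted, and the variable that remains outside of all
  arcs does not contribute to the constant coefficient.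
\<close>


section \<open>Polynomials of dotted and undotted arcs\<close>

text \<open>The relations are not local on tangles: the strands of a dotted arc run to the
  projectors across every undotted arc around it, and dotting some x_i changes crossings far from a,
  b, c, d. Polynomials make the relations local. All that a block of matched endpoints does to the
  outside is one polynomial in a single operator, so blocks side by side commute. Enclosing a block
  by an undotted arc peels one tensor factor off that operator. As E squared vanishes on a single
  spin, the part in which this spin is raised is a q-derivative of the polynomial; its twisted
  Leibniz rule for a product with the variable has one correction term, which is the arc with a dot.
  The coefficient 1 - q^(-2) comes, up to a power of q, from the entry by which a crossing exchanges
  two unlike spins. The factor q^(-1/2) for each nested pair of dotted arcs balances the crossing of
  each unnested pair, so that all diagrams with k dots carry the same scalar. Only the passage from
  zero values to zero classes is used, and it relies on crossingless turnbacks, which vanish under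
  both conventions.\<close>

lemma hpow_mult [simp]: "hpow a * hpow b = hpow (a + b)"
  by (simp add: hpow_def mult_single)

lemma hpow_mult_left [simp]: "hpow a * (hpow b * c) = hpow (a + b) * c"
  by (simp add: mult.assoc [symmetric])

lemma hpow_0 [simp]: "hpow 0 = 1"
  by (simp add: hpow_def)

lemma lookup_hpow: "Poly_Mapping.lookup (hpow a) m = (1 when a = m)"
  by (simp add: hpow_def lookup_single)

lemma hpow_neq_0 [simp]: "hpow a \<noteq> 0"
  by (metis hpow_0 hpow_mult add.right_inverse mult_zero_left zero_neq_one)

text \<open>The factor with which a right strand raises a spin: the entry
  \<open>hpow 1 - hpow (-3)\<close> of a crossing (see \<open>act_over\<close>) times the modulus
  \<open>hpow 2\<close> of a cup weight. In terms of q it is q^(1/2) (q - q^(-1)).\<close>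

definition gap :: laurent where
  "gap = hpow 3 - hpow (-1)"

lemma gap_neq_0: "gap \<noteq> 0"
proof
  assume "gap = 0"
  then have "Poly_Mapping.lookup gap 3 = 0" by simp
  then show False by (simp add: gap_def lookup_minus lookup_hpow)
qed

section \<open>Dilations and the symmetric q-derivative\<close>

abbreviation hconst :: "int \<Rightarrow> laurent poly" where
  "hconst a \<equiv> [:hpow a:]"

abbreviation var :: "laurent poly" where
  "var \<equiv> [:0, 1:]"

definition dilate :: "int \<Rightarrow> laurent poly \<Rightarrow> laurent poly" where
  "dilate a p = pcompose p [:0, hpow a:]"

lemma dilate_mult [simp]: "dilate a (p * r) = dilate a p * dilate a r"
  and dilate_add [simp]: "dilate a (p + r) = dilate a p + dilate a r"
  and dilate_diff [simp]: "dilate a (p - r) = dilate a p - dilate a r"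
  and dilate_uminus [simp]: "dilate a (- p) = - dilate a p"
  and dilate_0 [simp]: "dilate a 0 = 0"
  and dilate_const [simp]: "dilate a [:c:] = [:c:]"
  and dilate_var [simp]: "dilate a var = hconst a * var"
  by (simp_all add: dilate_def pcompose_mult pcompose_add pcompose_diff pcompose_uminus
      pcompose_const pcompose_pCons)

lemma dilate_pCons: "dilate a (pCons c p) = [:c:] + hconst a * var * dilate a p"
  by (simp add: dilate_def pcompose_pCons)

lemma dilate_dilate [simp]: "dilate a (dilate b p) = dilate (a + b) p"
  by (simp add: dilate_def pcompose_pCons add.commute flip: pcompose_assoc)

lemma dilate_by_0 [simp]: "dilate 0 p = p"
  by (simp add: dilate_def pcompose_idR)

text \<open>The symmetric q-derivative (p(q X) - p(X / q)) / (q - q^(-1)) X, up to the factor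
  q^(-1/2) contained in \<open>gap\<close>. As \<open>gap\<close> is not a unit, divisibility has to
  be proved before the choice means anything.\<close>

definition divdiff :: "laurent poly \<Rightarrow> laurent poly" where
  "divdiff p = (SOME d. [:gap:] * var * d = dilate 2 p - dilate (-2) p)"

lemma divdiff: "[:gap:] * var * divdiff p = dilate 2 p - dilate (-2) p"
proof -
  have "\<exists>d. [:gap:] * var * d = dilate 2 p - dilate (-2) p"
  proof (induction p)
    case 0
    then show ?case by (metis dilate_0 diff_self mult_zero_right)
  next
    case (pCons c p)
    then obtain d where d: "[:gap:] * var * d = dilate 2 p - dilate (-2) p" by blast
    have g: "[:gap:] * hconst (-1) = hconst 2 - hconst (-2)"
      by (simp add: gap_def algebra_simps)
    \<comment> \<open>The quotient for c + X p is read off from the twisted Leibniz rule: q^(-1/2)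
      p(X / q) + q X d, where d is the quotient for p.\<close>
    have "[:gap:] * var * (hconst (-1) * dilate (-2) p + hconst 2 * var * d)
      = ([:gap:] * hconst (-1)) * var * dilate (-2) p + hconst 2 * var * ([:gap:] * var * d)"
      by algebra
    also have "\<dots> = dilate 2 (pCons c p) - dilate (-2) (pCons c p)"
      unfolding g d dilate_pCons by algebra
    finally show ?case by blast
  qed
  then show ?thesis unfolding divdiff_def by (rule someI_ex)
qed

lemma gap_var_cancel: "[:gap:] * var * p = [:gap:] * var * r \<Longrightarrow> p = r"
  using gap_neq_0 by (metis mult_cancel_left mult_eq_0_iff pCons_eq_0_iff one_neq_zero)

lemma divdiff_unique: "[:gap:] * var * d = dilate 2 p - dilate (-2) p \<Longrightarrow> divdiff p = d"
  by (rule gap_var_cancel) (simp only: divdiff)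

lemma divdiff_pCons:
  "divdiff (pCons c p) = hconst (-1) * dilate (-2) p + hconst 2 * var * divdiff p"
proof (rule divdiff_unique)
  have g: "[:gap:] * hconst (-1) = hconst 2 - hconst (-2)"
    by (simp add: gap_def algebra_simps)
  have "[:gap:] * var * (hconst (-1) * dilate (-2) p + hconst 2 * var * divdiff p)
      = ([:gap:] * hconst (-1)) * var * dilate (-2) p + hconst 2 * var * ([:gap:] * var * divdiff p)"
    by algebra
  also have "\<dots> = dilate 2 (pCons c p) - dilate (-2) (pCons c p)"
    unfolding g divdiff dilate_pCons by algebra
  finally show "[:gap:] * var * (hconst (-1) * dilate (-2) p + hconst 2 * var * divdiff p)
    = dilate 2 (pCons c p) - dilate (-2) (pCons c p)" .
qed

text \<open>
  The polynomial \<open>p\<close> of an interval of endpoints stands for the operator by which that interval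
  acts on the spins of the undotted arcs around it, the variable being \<open>E K\<close> for the raising
  operator \<open>E\<close>. Putting an arc with end spins \<open>x\<close>, \<open>y\<close> (dotted if \<open>\<delta>\<close>) around the interval
  changes \<open>p\<close> into \<open>node \<delta> x y p\<close>.
\<close>

definition node :: "bool \<Rightarrow> bool \<Rightarrow> bool \<Rightarrow> laurent poly \<Rightarrow> laurent poly" where
  "node \<delta> x y p =
    (if \<delta> then (if x then (if y then dilate (-2) p else - [:gap:] * var * dilate (-2) p) else 0)
     else if x then (if y then divdiff p else dilate (-2) p)
     else (if y then - hconst 2 * dilate 2 p else 0))"

lemma divdiff_add [simp]: "divdiff (p + r) = divdiff p + divdiff r"
proof (rule divdiff_unique)
  show "[:gap:] * var * (divdiff p + divdiff r) = dilate 2 (p + r) - dilate (-2) (p + r)"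
    unfolding distrib_left divdiff by simp
qed

lemma divdiff_const_mult [simp]: "divdiff ([:c:] * p) = [:c:] * divdiff p"
proof (rule divdiff_unique)
  have "[:gap:] * var * ([:c:] * divdiff p) = [:c:] * ([:gap:] * var * divdiff p)" by algebra
  then show "[:gap:] * var * ([:c:] * divdiff p) = dilate 2 ([:c:] * p) - dilate (-2) ([:c:] * p)"
    unfolding divdiff dilate_mult dilate_const right_diff_distrib .
qed

lemma node_add: "node \<delta> x y (p + r) = node \<delta> x y p + node \<delta> x y r"
  by (simp add: node_def algebra_simps)

lemma node_const_mult: "node \<delta> x y ([:c:] * p) = [:c:] * node \<delta> x y p"
proof -
  have *: "- [:gap:] * var * ([:c:] * P) = [:c:] * (- [:gap:] * var * P)"
    "- hconst 2 * ([:c:] * P) = [:c:] * (- hconst 2 * P)" for P by algebra+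
  show ?thesis
    unfolding node_def dilate_mult dilate_const divdiff_const_mult *
    by (auto simp del: mult_pCons_left)
qed

lemma node_0 [simp]: "node \<delta> x y 0 = 0"
  using node_const_mult[of \<delta> x y 0 0] by simp

section \<open>Moving the variable through one arc\<close>

lemma node_dotted_var: "node True x y (var * p) = hconst (-2) * var * node True x y p"
  by (cases x; cases y)
     (simp_all only: node_def dilate_mult dilate_var if_True if_False mult_zero_right, algebra+)

text \<open>The source of the sums in the Russell relations. With both spins up it is the twisted
  Leibniz rule, whose correction term is the dotted arc. With spins up and down, the dotted term
  lowers the coefficient from q to q^(-1), because q^(-1/2) \<open>gap\<close> = q - q^(-1).\<close>

lemma node_undotted_var:
  "node False x y (var * p) = hconst (-1) * node True x y p + hconst 2 * var * node False x y p"
proof -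
  have d: "divdiff (var * p) = hconst (-1) * dilate (-2) p + hconst 2 * var * divdiff p"
    using divdiff_pCons[of 0 p] by simp
  have g: "hconst (-1) * (- [:gap:] * var * P) + hconst 2 * var * P = hconst (-2) * var * P" for P
  proof -
    have "hconst (-1) * [:gap:] = hconst 2 - hconst (-2)" by (simp add: gap_def algebra_simps)
    then show ?thesis by algebra
  qed
  show ?thesis
    by (cases x; cases y) (simp_all only: node_def if_True if_False d g dilate_mult dilate_var, algebra+)
qed

section \<open>The two relations inside the interval from a to d\<close>

lemma gap_var_dilate_divdiff: "[:gap:] * var * dilate (-2) (divdiff p) = hconst 2 * (p - dilate (-4) p)"
proof -
  have "dilate (-2) ([:gap:] * var * divdiff p) = dilate (-2) (dilate 2 p - dilate (-2) p)"
    by (simp only: divdiff)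
  then have "[:gap:] * (hconst (-2) * var) * dilate (-2) (divdiff p) = p - dilate (-4) p"
    by (simp only: dilate_mult dilate_const dilate_var dilate_diff dilate_dilate) simp
  moreover have "hconst 2 * hconst (-2) = 1" by simp
  ultimately show ?thesis by algebra
qed

text \<open>With all spins up, the two diagrams with two dots differ by having \<open>q\<close> or
  \<open>dilate (-4) q\<close> as middle factor. By \<open>gap_var_dilate_divdiff\<close> this
  difference is a multiple of the variable times a dilated q-derivative of \<open>q\<close>, which
  is what an undotted inner arc produces.\<close>

lemma node_type_II:
  "node True xa xb p * q * node True xc xd r
   = node True xa xd (p * node True xb xc q * r)
     + hconst (-2) * [:gap:] * var * node True xa xd (p * node False xb xc q * r)"
proof -
  note 1 = gap_var_dilate_divdiff[of q]
  have 2: "hconst 2 * hconst (-2) = 1" by simp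
  have 5: "hconst (-2) * [:gap:] * var * dilate (-2) (divdiff q) = q - dilate (-4) q"
    using 1 2 by algebra
  have 3: "dilate (-2) (dilate (-2) q) = dilate (-4) q" "dilate (-2) (dilate 2 q) = q" by simp_all
  show ?thesis
    unfolding node_def
    apply (cases xa; cases xb; cases xc; cases xd)
    apply (simp_all only: if_True if_False dilate_mult dilate_const dilate_var dilate_uminus dilate_0 3
      mult_zero_left mult_zero_right add_0_left add_0_right minus_zero)
    subgoal using 5 by algebra
    subgoal using 5 by algebra
    subgoal by (simp add: algebra_simps)
    subgoal by (simp add: algebra_simps)
    subgoal using 2 by algebra
    subgoal using 2 by algebra
    done
qed

text \<open>With all spins up this is a q-Leibniz rule for three factors; the last term is the
  product of the differences of \<open>p\<close> and \<open>r\<close>, which leaves one factor of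
  the variable over. Multiplication by \<open>[:gap:] * var\<close> turns the q-derivatives into
  differences of dilations, so that each of the sixteen spin patterns becomes an identity between
  polynomials.\<close>

lemma node_type_I:
  "node False xa xd (p * node True xb xc q * r)
   = node True xa xb p * q * node False xc xd r
     + node False xa xb p * q * node True xc xd r
     + hconst (-2) * node True xa xd (p * node False xb xc q * r)
     + [:gap:] * var * (node False xa xb p * q * node False xc xd r)"
proof (rule gap_var_cancel, rule gap_var_cancel)
  have 2: "hconst 2 * hconst (-2) = 1" by simp
  have 3: "dilate (-2) (dilate (-2) s) = dilate (-4) s" "dilate (-2) (dilate 2 s) = s"
    "dilate 2 (dilate (-2) s) = s" "dilate 2 (dilate 2 s) = dilate 4 s" for s by simp_all
  have 4: "[:gap:] * hconst (-1) = hconst 2 - hconst (-2)"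
      by (simp add: gap_def algebra_simps)
  note d = divdiff[of p] divdiff[of q] divdiff[of r]
  let ?X = "p * node True xb xc q * r"
  have 5: "[:gap:] * var * divdiff ?X = dilate 2 ?X - dilate (-2) ?X" by (rule divdiff)
  \<comment> \<open>The q-derivative of the whole product \<open>?X\<close> is resolved while
    \<open>?X\<close> is still a single term, before \<open>node\<close> is unfolded inside
    it.\<close>
  have 5: "[:gap:] * var * ([:gap:] * var * node False xa xd ?X) =
     [:gap:] * var * (if xa then (if xd then dilate 2 ?X - dilate (-2) ?X else [:gap:] * var * dilate (-2) ?X)
     else (if xd then - [:gap:] * var * hconst 2 * dilate 2 ?X else 0))"
    unfolding node_def[of False xa xd ?X] if_False
    apply (cases xa; cases xd)
    apply (simp_all only: if_True if_False 5)
    by algebra+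
  show "[:gap:] * var * ([:gap:] * var * node False xa xd ?X) =
    [:gap:] * var * ([:gap:] * var * (node True xa xb p * q * node False xc xd r
     + node False xa xb p * q * node True xc xd r
     + hconst (-2) * node True xa xd (p * node False xb xc q * r)
     + [:gap:] * var * (node False xa xb p * q * node False xc xd r)))"
    unfolding 5 unfolding node_def
    apply (cases xa; cases xb; cases xc; cases xd)
    apply (simp_all only: if_True if_False dilate_mult dilate_const dilate_var dilate_uminus dilate_0 3
      mult_zero_left mult_zero_right add_0_left add_0_right minus_zero)
    by (algebra | (simp add: algebra_simps; fail) | (insert gap_var_dilate_divdiff[of q] 2 4 d, algebra))+
qed


section \<open>The spin-state sum\<close>

text \<open>
  A configuration gives the spins of the strands at one height, \<open>True\<close> being spin up; only finitely
  many positions are occupied, and the spins at the others are irrelevant. The weights are those of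
  the Kauffman bracket with loop value \<open>- q - q\<^sup>-\<^sup>1\<close>.
\<close>

type_synonym config = "nat \<Rightarrow> bool"

definition cup_weight :: "bool \<Rightarrow> bool \<Rightarrow> laurent" where
  "cup_weight x y = (if x = y then 0 else if x then 1 else - hpow 2)"

definition remove_two :: "nat \<Rightarrow> config \<Rightarrow> config" where
  "remove_two i s = (\<lambda>j. if j < i then s j else s (j + 2))"

definition insert_two :: "nat \<Rightarrow> bool \<Rightarrow> bool \<Rightarrow> config \<Rightarrow> config" where
  "insert_two i x y s = (\<lambda>j. if j < i then s j else if j = i then x else if j = i + 1 then y else s (j - 2))"

definition cup_op :: "nat \<Rightarrow> (config \<Rightarrow> laurent) \<Rightarrow> config \<Rightarrow> laurent" where
  "cup_op i f s = cup_weight (s i) (s (i + 1)) * f (remove_two i s)"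

definition cap_op :: "nat \<Rightarrow> (config \<Rightarrow> laurent) \<Rightarrow> config \<Rightarrow> laurent" where
  "cap_op i f s = f (insert_two i False True s) - hpow (-2) * f (insert_two i True False s)"

text \<open>Here \<open>f\<close> is an amplitude as a function of the spins below the piece, and
  the result is a function of the spins above it. Crossings are defined through their smoothings, so
  the crossing relation holds for values by definition.\<close>

fun act :: "piece \<times> nat \<Rightarrow> (config \<Rightarrow> laurent) \<Rightarrow> config \<Rightarrow> laurent" where
  "act (Cup, i) f = cup_op i f"
| "act (Cap, i) f = cap_op i f"
| "act (OverNW, i) f = (\<lambda>s. hpow 1 * cup_op i (cap_op i f) s + hpow (-1) * f s)"
| "act (OverNE, i) f = (\<lambda>s. hpow 1 * f s + hpow (-1) * cup_op i (cap_op i f) s)"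

definition act_all :: "tangle \<Rightarrow> (config \<Rightarrow> laurent) \<Rightarrow> config \<Rightarrow> laurent" where
  "act_all w f = foldl (\<lambda>f p. act p f) f w"

lemma act_all_simps [simp]:
  "act_all [] f = f" "act_all (p # w) f = act_all w (act p f)"
  "act_all (u @ v) f = act_all v (act_all u f)"
  by (simp_all add: act_all_def)

abbreviation spin_sum :: "tangle \<Rightarrow> config \<Rightarrow> laurent" where
  "spin_sum w \<equiv> act_all w (\<lambda>_. 1)"

lemma act_add: "act p (\<lambda>s. f s + g s) = (\<lambda>s. act p f s + act p g s)"
  by (cases p; cases "fst p") (auto simp: cup_op_def cap_op_def fun_eq_iff algebra_simps)

lemma act_scale: "act p (\<lambda>s. c * f s) = (\<lambda>s. c * act p f s)"
  by (cases p; cases "fst p") (auto simp: cup_op_def cap_op_def fun_eq_iff algebra_simps)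

lemma act_all_add: "act_all w (\<lambda>s. f s + g s) = (\<lambda>s. act_all w f s + act_all w g s)"
  by (induction w arbitrary: f g) (simp_all add: act_add)

lemma act_all_scale: "act_all w (\<lambda>s. c * f s) = (\<lambda>s. c * act_all w f s)"
  by (induction w arbitrary: f) (simp_all add: act_scale)

section \<open>Invariance of values under planar isotopy, and the value of a circle\<close>

lemma Suc_Suc_diff_2: "2 \<le> x \<Longrightarrow> Suc (Suc (x - 2)) = x"
  by simp

lemma act_cup_cup: "i \<le> j \<Longrightarrow> act (Cup, j + 2) (act (Cup, i) f) = act (Cup, i) (act (Cup, j) f)"
proof (intro ext)
  fix s assume "i \<le> j"
  then have "remove_two i (remove_two (j + 2) s) = remove_two j (remove_two i s)"
    by (auto simp: remove_two_def fun_eq_iff)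
  moreover have "remove_two (j + 2) s i = s i" "remove_two (j + 2) s (i + 1) = s (i + 1)"
     "remove_two i s j = s (j + 2)" "remove_two i s (j + 1) = s (j + 2 + 1)"
    using \<open>i \<le> j\<close> by (auto simp: remove_two_def)
  ultimately show "act (Cup, j + 2) (act (Cup, i) f) s = act (Cup, i) (act (Cup, j) f) s"
    by (simp add: cup_op_def)
qed

lemma act_cup_cap: "i \<le> j \<Longrightarrow> act (Cap, j + 2) (act (Cup, i) f) = act (Cup, i) (act (Cap, j) f)"
proof (intro ext)
  fix s assume "i \<le> j"
  then have "remove_two i (insert_two (j + 2) x y s) = insert_two j x y (remove_two i s)" for x y
    by (auto simp: remove_two_def insert_two_def fun_eq_iff Suc_diff_le Suc_Suc_diff_2)
  moreover have "insert_two (j + 2) x y s i = s i" "insert_two (j + 2) x y s (i + 1) = s (i + 1)" for x y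
    using \<open>i \<le> j\<close> by (auto simp: insert_two_def)
  ultimately show "act (Cap, j + 2) (act (Cup, i) f) s = act (Cup, i) (act (Cap, j) f) s"
    by (simp add: cup_op_def cap_op_def algebra_simps)
qed

lemma act_cap_cup: "i \<le> j \<Longrightarrow> act (Cap, i) (act (Cup, j + 2) f) = act (Cup, j) (act (Cap, i) f)"
proof (intro ext)
  fix s assume "i \<le> j"
  then have "remove_two (j + 2) (insert_two i x y s) = insert_two i x y (remove_two j s)" for x y
    by (auto simp: remove_two_def insert_two_def fun_eq_iff Suc_diff_le Suc_Suc_diff_2)
  moreover have "insert_two i x y s (j + 2) = s j" "insert_two i x y s (j + 2 + 1) = s (j + 1)" for x y
    using \<open>i \<le> j\<close> by (auto simp: insert_two_def)
  ultimately show "act (Cap, i) (act (Cup, j + 2) f) s = act (Cup, j) (act (Cap, i) f) s"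
    by (simp add: cup_op_def cap_op_def algebra_simps)
qed

text \<open>The coefficients of the cap are the inverse matrix of the cup weights: the spin
  \<open>s i\<close> selects one of the two terms of the cap, and there the weights multiply to
  1.\<close>

lemma act_straighten_left: "act (Cap, i + 1) (act (Cup, i) f) = f"
proof (intro ext)
  fix s
  have "remove_two i (insert_two (i + 1) x (s i) s) = s" for x
  proof
    fix j
    consider "j < i" | "j = i" | "j > i" by linarith
    then show "remove_two i (insert_two (i + 1) x (s i) s) j = s j"
      by cases (auto simp: remove_two_def insert_two_def)
  qed
  moreover have "insert_two (i + 1) x y s i = s i" "insert_two (i + 1) x y s (i + 1) = x" for x y
    by (auto simp: insert_two_def)
  ultimately show "act (Cap, i + 1) (act (Cup, i) f) s = f s"
    by (cases "s i") (simp_all add: cup_op_def cap_op_def cup_weight_def)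
qed

lemma act_straighten_right: "act (Cap, i) (act (Cup, i + 1) f) = f"
proof (intro ext)
  fix s
  have "remove_two (i + 1) (insert_two i (s i) y s) = s" for y
  proof
    fix j
    consider "j < i" | "j = i" | "j > i" by linarith
    then show "remove_two (i + 1) (insert_two i (s i) y s) j = s j"
      by cases (auto simp: remove_two_def insert_two_def)
  qed
  moreover have "insert_two i x y s (i + 2) = s i" "insert_two i x y s (i + 1) = y" for x y
    by (auto simp: insert_two_def)
  ultimately show "act (Cap, i) (act (Cup, i + 1) f) s = f s"
    by (cases "s i") (simp_all add: cup_op_def cap_op_def cup_weight_def)
qed

lemma act_circle: "act (Cap, i) (act (Cup, i) f) = (\<lambda>s. (- hpow 2 - hpow (-2)) * f s)"
proof (intro ext)
  fix s
  have "remove_two i (insert_two i x y s) = s" for x y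
    by (auto simp: remove_two_def insert_two_def fun_eq_iff)
  moreover have "insert_two i x y s i = x" "insert_two i x y s (i + 1) = y" for x y
    by (auto simp: insert_two_def)
  ultimately show "act (Cap, i) (act (Cup, i) f) s = (- hpow 2 - hpow (-2)) * f s"
    by (simp add: cup_op_def cap_op_def cup_weight_def algebra_simps)
qed

section \<open>Splitting off the spins of the leftmost strands\<close>

definition append_config :: "bool list \<Rightarrow> config \<Rightarrow> config" where
  "append_config xs s = (\<lambda>j. if j < length xs then xs ! j else s (j - length xs))"

lemma append_config_Nil [simp]: "append_config [] s = s"
  by (simp add: append_config_def)

lemma append_config_append: "append_config (xs @ ys) s = append_config xs (append_config ys s)"
  by (auto simp: append_config_def fun_eq_iff nth_append)

lemma append_config_take: "append_config (map s [0..<i]) (\<lambda>j. s (i + j)) = s"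
  by (auto simp: append_config_def fun_eq_iff)

lemma act_append_config:
  "act (g, length xs + i) f (append_config xs s) = act (g, i) (\<lambda>s. f (append_config xs s)) s"
proof -
  let ?n = "length xs"
  have a: "remove_two (?n + i) (append_config xs s) = append_config xs (remove_two i s)" for s
    by (auto simp: remove_two_def append_config_def fun_eq_iff Suc_diff_le)
  have b: "insert_two (?n + i) x y (append_config xs s) = append_config xs (insert_two i x y s)" for s x y
    by (auto simp: insert_two_def append_config_def fun_eq_iff Suc_diff_le intro!: arg_cong[where f=s])
  have c: "append_config xs s (?n + i) = s i" "append_config xs s (?n + i + 1) = s (i + 1)"
    "append_config xs s (Suc (?n + i)) = s (Suc i)" for s
    by (simp_all add: append_config_def)
  show ?thesis
    by (cases g) (simp_all add: cup_op_def cap_op_def a b c)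
qed

section \<open>Values of linear combinations\<close>

definition spin_eval :: "(tangle \<Rightarrow>\<^sub>0 laurent) \<Rightarrow> config \<Rightarrow> laurent" where
  "spin_eval E s = (\<Sum>w\<in>Poly_Mapping.keys E. Poly_Mapping.lookup E w * spin_sum w s)"

lemma spin_eval_superset:
  assumes "finite X" "Poly_Mapping.keys E \<subseteq> X"
  shows "spin_eval E s = (\<Sum>w\<in>X. Poly_Mapping.lookup E w * spin_sum w s)"
  unfolding spin_eval_def
  by (rule sum.mono_neutral_left) (use assms in \<open>auto simp: in_keys_iff\<close>)

lemma spin_eval_add: "spin_eval (E + F) s = spin_eval E s + spin_eval F s"
proof -
  let ?X = "Poly_Mapping.keys E \<union> Poly_Mapping.keys F"
  show ?thesis
    using spin_eval_superset[of ?X E] spin_eval_superset[of ?X F]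
      spin_eval_superset[of ?X "E + F"] Poly_Mapping.keys_add[of E F]
    by (simp add: lookup_add algebra_simps sum.distrib)
qed

lemma spin_eval_smult: "spin_eval (smult c E) s = c * spin_eval E s"
proof -
  let ?X = "Poly_Mapping.keys E"
  have "Poly_Mapping.keys (smult c E) \<subseteq> ?X" by (auto simp: in_keys_iff)
  then show ?thesis
    using spin_eval_superset[of ?X E] spin_eval_superset[of ?X "smult c E"]
    by (simp add: algebra_simps sum_distrib_left)
qed

lemma spin_eval_basis [simp]: "spin_eval (basis w) s = spin_sum w s"
  by (simp add: spin_eval_def basis_def)

lemma spin_eval_0 [simp]: "spin_eval 0 s = 0"
  by (simp add: spin_eval_def)

lemma spin_eval_uminus: "spin_eval (- E) s = - spin_eval E s"
  using spin_eval_add[of E "-E" s] by (simp add: eq_neg_iff_add_eq_0 add.commute)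

lemma spin_eval_diff: "spin_eval (E - F) s = spin_eval E s - spin_eval F s"
  using spin_eval_add[of E "-F" s] by (simp add: spin_eval_uminus)

lemma spin_eval_sum: "spin_eval (\<Sum>i\<in>I. E i) s = (\<Sum>i\<in>I. spin_eval (E i) s)"
  by (induction I rule: infinite_finite_induct) (simp_all add: spin_eval_add)


section \<open>Quotients of the free modules\<close>

lemma sum_single: "(\<Sum>x\<in>Poly_Mapping.keys f. Poly_Mapping.single x (Poly_Mapping.lookup f x)) = f"
  by (rule poly_mapping_eqI) (auto simp: lookup_sum lookup_single when_def in_keys_iff)

lemma smult_basis: "smult c (basis x) = Poly_Mapping.single x c"
  by (rule poly_mapping_eqI) (simp add: basis_def lookup_single when_def)

lemma sum_basis: "(\<Sum>x\<in>Poly_Mapping.keys f. smult (Poly_Mapping.lookup f x) (basis x)) = f"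
  by (simp only: smult_basis sum_single)

lemma q_to_half_superset:
  assumes "finite X" "Poly_Mapping.keys c \<subseteq> X"
  shows "q_to_half c = (\<Sum>m\<in>X. Poly_Mapping.single (2 * m) (Poly_Mapping.lookup c m))"
  unfolding q_to_half_def
  by (rule sum.mono_neutral_left) (use assms in \<open>auto simp: in_keys_iff\<close>)

lemma q_to_half_add: "q_to_half (a + b) = q_to_half a + q_to_half b"
proof -
  let ?X = "Poly_Mapping.keys a \<union> Poly_Mapping.keys b"
  show ?thesis
    using q_to_half_superset[of ?X a] q_to_half_superset[of ?X b]
      q_to_half_superset[of ?X "a + b"] Poly_Mapping.keys_add[of a b]
    by (simp add: lookup_add single_add sum.distrib)
qed

lemma q_to_half_0 [simp]: "q_to_half 0 = 0"
  by (simp add: q_to_half_def)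

lemma q_to_half_single [simp]: "q_to_half (Poly_Mapping.single m a) = Poly_Mapping.single (2 * m) a"
  by (simp add: q_to_half_def)

lemma q_to_half_qpow [simp]: "q_to_half (qpow m) = hpow (2 * m)"
  by (simp add: qpow_def hpow_def)

lemma q_to_half_1 [simp]: "q_to_half 1 = 1"
  using q_to_half_single[of 0 1] by (simp add: single_one)

lemma q_to_half_sum: "q_to_half (\<Sum>i\<in>I. f i) = (\<Sum>i\<in>I. q_to_half (f i))"
  by (induction I rule: infinite_finite_induct) (simp_all add: q_to_half_add)

lemma q_to_half_mult: "q_to_half (a * b) = q_to_half a * q_to_half b"
proof -
  have "q_to_half (a * b) = q_to_half ((\<Sum>x\<in>Poly_Mapping.keys a. Poly_Mapping.single x (Poly_Mapping.lookup a x))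
      * (\<Sum>x\<in>Poly_Mapping.keys b. Poly_Mapping.single x (Poly_Mapping.lookup b x)))"
    by (simp only: sum_single)
  also have "\<dots> = q_to_half a * q_to_half b"
    unfolding sum_product q_to_half_sum mult_single q_to_half_single
    by (simp add: q_to_half_def sum_product mult_single algebra_simps)
  finally show ?thesis .
qed

lemma q_to_half_diff: "q_to_half (a - b) = q_to_half a - q_to_half b"
  using q_to_half_add[of "a - b" b] by (simp add: eq_diff_eq)

text \<open>Allows one treatment of \<open>lin_ext\<close> for its two uses: along \<open>id\<close>
  for adding the outer arc, and along \<open>q_to_half\<close> for the map from dotted diagrams to
  tangles.\<close>

definition laurent_hom :: "(laurent \<Rightarrow> laurent) \<Rightarrow> bool" where
  "laurent_hom \<sigma> \<longleftrightarrow> (\<forall>a b. \<sigma> (a + b) = \<sigma> a + \<sigma> b) \<and> (\<forall>a b. \<sigma> (a * b) = \<sigma> a * \<sigma> b) \<and> \<sigma> 1 = 1 \<and> \<sigma> 0 = 0"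

lemma laurent_hom_id: "laurent_hom id"
  by (simp add: laurent_hom_def)

lemma laurent_hom_q_to_half: "laurent_hom q_to_half"
  by (simp add: laurent_hom_def q_to_half_add q_to_half_mult)

lemma lin_ext_superset:
  assumes "laurent_hom \<sigma>" "finite X" "Poly_Mapping.keys f \<subseteq> X"
  shows "lin_ext \<sigma> g f = (\<Sum>x\<in>X. smult (\<sigma> (Poly_Mapping.lookup f x)) (g x))"
  unfolding lin_ext_def
  by (rule sum.mono_neutral_left) (use assms in \<open>auto simp: in_keys_iff laurent_hom_def\<close>)

lemma lin_ext_add:
  assumes "laurent_hom \<sigma>"
  shows "lin_ext \<sigma> g (f + f') = lin_ext \<sigma> g f + lin_ext \<sigma> g f'"
proof -
  let ?X = "Poly_Mapping.keys f \<union> Poly_Mapping.keys f'"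
  have *: "\<sigma> (a + b) = \<sigma> a + \<sigma> b" for a b using assms by (simp add: laurent_hom_def)
  show ?thesis
    using lin_ext_superset[OF assms, of ?X f g] lin_ext_superset[OF assms, of ?X f' g]
      lin_ext_superset[OF assms, of ?X "f + f'" g] Poly_Mapping.keys_add[of f f']
    by (simp add: lookup_add * free.scale_left_distrib sum.distrib)
qed

lemma lin_ext_smult:
  assumes "laurent_hom \<sigma>"
  shows "lin_ext \<sigma> g (smult c f) = smult (\<sigma> c) (lin_ext \<sigma> g f)"
proof -
  let ?X = "Poly_Mapping.keys f"
  have "Poly_Mapping.keys (smult c f) \<subseteq> ?X" by (auto simp: in_keys_iff)
  moreover have *: "\<sigma> (a * b) = \<sigma> a * \<sigma> b" for a b using assms by (simp add: laurent_hom_def)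
  ultimately show ?thesis
    using lin_ext_superset[OF assms, of ?X f g] lin_ext_superset[OF assms, of ?X "smult c f" g]
    by (simp add: * free.scale_sum_right)
qed

lemma lin_ext_basis: "laurent_hom \<sigma> \<Longrightarrow> lin_ext \<sigma> g (basis x) = g x"
  by (simp add: lin_ext_def basis_def laurent_hom_def)

lemma lin_ext_0 [simp]: "lin_ext \<sigma> g 0 = 0"
  by (simp add: lin_ext_def)

lemma lin_ext_uminus: "laurent_hom \<sigma> \<Longrightarrow> lin_ext \<sigma> g (- f) = - lin_ext \<sigma> g f"
  using lin_ext_add[of \<sigma> g f "- f"] by (simp add: eq_neg_iff_add_eq_0 add.commute)

lemma lin_ext_diff: "laurent_hom \<sigma> \<Longrightarrow> lin_ext \<sigma> g (f - f') = lin_ext \<sigma> g f - lin_ext \<sigma> g f'"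
  using lin_ext_add[of \<sigma> g f "- f'"] lin_ext_uminus[of \<sigma> g f'] by simp

lemma lin_ext_sum: "laurent_hom \<sigma> \<Longrightarrow> lin_ext \<sigma> g (\<Sum>i\<in>I. f i) = (\<Sum>i\<in>I. lin_ext \<sigma> g (f i))"
  by (induction I rule: infinite_finite_induct) (simp_all add: lin_ext_add)

lemma subspace_free_on: "free.subspace (free_on B)"
proof (rule free.subspaceI)
  show "0 \<in> free_on B" by (simp add: free_on_def)
  show "x + y \<in> free_on B" if "x \<in> free_on B" "y \<in> free_on B" for x y
    using that Poly_Mapping.keys_add[of x y] by (auto simp: free_on_def)
  show "smult c x \<in> free_on B" if "x \<in> free_on B" for c x
    using that by (auto simp: free_on_def in_keys_iff)
qed

lemma basis_free_on: "x \<in> B \<Longrightarrow> basis x \<in> free_on B"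
  by (simp add: free_on_def basis_def)

lemma lin_ext_mem:
  assumes V: "free.subspace V" and g: "\<And>x. x \<in> Poly_Mapping.keys f \<Longrightarrow> g x \<in> V"
  shows "lin_ext \<sigma> g f \<in> V"
  unfolding lin_ext_def
  by (rule free.subspace_sum[OF V]) (use g free.subspace_scale[OF V] in auto)

lemma subspace_lin_ext_vimage:
  assumes "laurent_hom \<sigma>" "free.subspace V"
  shows "free.subspace {f. lin_ext \<sigma> g f \<in> V}"
  by (rule free.subspaceI)
     (use assms in \<open>auto simp: lin_ext_add lin_ext_smult free.subspace_0 free.subspace_add free.subspace_scale\<close>)

section \<open>Cosets in the cokernel\<close>

definition outer_map :: "(tangle \<Rightarrow>\<^sub>0 laurent) \<Rightarrow> (tangle \<Rightarrow>\<^sub>0 laurent)" where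
  "outer_map = lin_ext id (\<lambda>w. basis (add_outer_arc w))"

text \<open>The elements of the free module on tangles which vanish in \<open>S\<^sup>q\<^sub>n\<^sub>,\<^sub>k\<close>.\<close>

definition null_space :: "convention \<Rightarrow> nat \<Rightarrow> nat \<Rightarrow> (tangle \<Rightarrow>\<^sub>0 laurent) set" where
  "null_space \<kappa> n k = (if k = 0 then KL_relations \<kappa> n k
    else {outer_map (f + r) + r' | f r r'. f \<in> free_on (tangles n (k - 1)) \<and>
            r \<in> KL_relations \<kappa> n (k - 1) \<and> r' \<in> KL_relations \<kappa> n k})"

lemma subspace_KL_relations: "free.subspace (KL_relations \<kappa> n k)"
  unfolding KL_relations_def by (rule free.subspace_span)

lemma KL_relations_0 [simp]: "0 \<in> KL_relations \<kappa> n k"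
  by (rule free.subspace_0[OF subspace_KL_relations])

lemma outer_map_add: "outer_map (f + g) = outer_map f + outer_map g"
  and outer_map_smult: "outer_map (smult c f) = smult c (outer_map f)"
  and outer_map_0: "outer_map 0 = 0"
  and outer_map_basis: "outer_map (basis w) = basis (add_outer_arc w)"
  by (simp_all add: outer_map_def lin_ext_add lin_ext_smult lin_ext_basis laurent_hom_id)

lemma null_spaceI:
  assumes "k \<noteq> 0" "f \<in> free_on (tangles n (k - 1))" "r \<in> KL_relations \<kappa> n (k - 1)" "r' \<in> KL_relations \<kappa> n k"
  shows "outer_map (f + r) + r' \<in> null_space \<kappa> n k"
  using assms unfolding null_space_def by auto

lemma null_spaceE:
  assumes "x \<in> null_space \<kappa> n k" "k \<noteq> 0"
  obtains f r r' where "x = outer_map (f + r) + r'" "f \<in> free_on (tangles n (k - 1))"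
    "r \<in> KL_relations \<kappa> n (k - 1)" "r' \<in> KL_relations \<kappa> n k"
  using assms(1) that unfolding null_space_def if_not_P[OF assms(2)] by blast

lemma KL_relations_subset_null_space: "KL_relations \<kappa> n k \<subseteq> null_space \<kappa> n k"
proof
  fix x assume x: "x \<in> KL_relations \<kappa> n k"
  show "x \<in> null_space \<kappa> n k"
  proof (cases "k = 0")
    case True
    then show ?thesis using x by (simp add: null_space_def)
  next
    case False
    have "outer_map (0 + 0) + x \<in> null_space \<kappa> n k"
      by (rule null_spaceI[OF False free.subspace_0[OF subspace_free_on] KL_relations_0 x])
    then show ?thesis by (simp add: outer_map_0)
  qed
qed

lemma subspace_null_space: "free.subspace (null_space \<kappa> n k)"
proof (cases "k = 0")
  case True
  then show ?thesis by (simp add: null_space_def subspace_KL_relations)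
next
  case False
  note S = subspace_free_on[of "tangles n (k - 1)"] subspace_KL_relations[of \<kappa> n "k - 1"]
    subspace_KL_relations[of \<kappa> n k]
  show ?thesis
  proof (rule free.subspaceI)
    show "0 \<in> null_space \<kappa> n k"
      using KL_relations_subset_null_space KL_relations_0 by blast
    show "x + y \<in> null_space \<kappa> n k" if mx: "x \<in> null_space \<kappa> n k" and my: "y \<in> null_space \<kappa> n k" for x y
    proof -
      obtain f r r' where x: "x = outer_map (f + r) + r'" "f \<in> free_on (tangles n (k - 1))"
        "r \<in> KL_relations \<kappa> n (k - 1)" "r' \<in> KL_relations \<kappa> n k"
        using mx False by (rule null_spaceE)
      obtain g s s' where y: "y = outer_map (g + s) + s'" "g \<in> free_on (tangles n (k - 1))"
        "s \<in> KL_relations \<kappa> n (k - 1)" "s' \<in> KL_relations \<kappa> n k"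
        using my False by (rule null_spaceE)
      have "x + y = outer_map ((f + g) + (r + s)) + (r' + s')"
        by (simp add: x y outer_map_add algebra_simps)
      also have "\<dots> \<in> null_space \<kappa> n k"
        by (intro null_spaceI False S[THEN free.subspace_add] x y)
      finally show ?thesis .
    qed
    show "smult c x \<in> null_space \<kappa> n k" if mx: "x \<in> null_space \<kappa> n k" for c x
    proof -
      obtain f r r' where x: "x = outer_map (f + r) + r'" "f \<in> free_on (tangles n (k - 1))"
        "r \<in> KL_relations \<kappa> n (k - 1)" "r' \<in> KL_relations \<kappa> n k"
        using mx False by (rule null_spaceE)
      have "smult c x = outer_map (smult c f + smult c r) + smult c r'"
        by (simp add: x outer_map_add outer_map_smult free.scale_right_distrib)
      also have "\<dots> \<in> null_space \<kappa> n k"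
        by (intro null_spaceI False S[THEN free.subspace_scale] x)
      finally show ?thesis .
    qed
  qed
qed

lemma add_outer_arc_null_space:
  assumes "k \<noteq> 0" "w \<in> tangles n (k - 1)"
  shows "basis (add_outer_arc w) \<in> null_space \<kappa> n k"
proof -
  have "outer_map (basis w + 0) + 0 \<in> null_space \<kappa> n k"
    by (rule null_spaceI[OF assms(1) basis_free_on[OF assms(2)] KL_relations_0 KL_relations_0])
  then show ?thesis by (simp add: outer_map_basis)
qed

text \<open>Elements of \<open>KL_tilde\<close> are cosets f + r, so the union of their images under
  \<open>phi\<close> is exactly \<open>null_space\<close>. Adding \<open>KL_relations\<close> to it
  changes nothing, since they are contained in this submodule.\<close>

lemma KL_proj_class: "KL_proj \<kappa> n k (KL_class \<kappa> n k f) = f +o null_space \<kappa> n k"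
proof (cases "k = 0")
  case True
  then show ?thesis by (simp add: KL_proj_def null_space_def KL_class_def)
next
  case False
  have add: "r + s \<in> KL_relations \<kappa> n k" if "r \<in> KL_relations \<kappa> n k" "s \<in> KL_relations \<kappa> n k" for r s
    using that free.subspace_add[OF subspace_KL_relations] by blast
  have "\<Union> (phi \<kappa> n k ` KL_tilde \<kappa> n (k - 1)) = null_space \<kappa> n k"
    unfolding phi_def KL_tilde_def KL_class_def null_space_def outer_map_def[symmetric] if_not_P[OF False]
      elt_set_plus_def set_plus_def by blast
  moreover have "(f +o KL_relations \<kappa> n k) + null_space \<kappa> n k = f +o null_space \<kappa> n k"
  proof (intro subset_antisym subsetI)
    fix x assume "x \<in> (f +o KL_relations \<kappa> n k) + null_space \<kappa> n k"
    then obtain r s where "x = f + (r + s)" "r \<in> KL_relations \<kappa> n k" "s \<in> null_space \<kappa> n k"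
      by (auto simp: elt_set_plus_def set_plus_def add.assoc)
    then show "x \<in> f +o null_space \<kappa> n k"
      using KL_relations_subset_null_space[of \<kappa> n k] free.subspace_add[OF subspace_null_space[of \<kappa> n k], of r s]
      by (auto simp: elt_set_plus_def)
  next
    fix x assume "x \<in> f +o null_space \<kappa> n k"
    then obtain s where "x = (f + 0) + s" "s \<in> null_space \<kappa> n k"
      by (auto simp: elt_set_plus_def)
    then show "x \<in> (f +o KL_relations \<kappa> n k) + null_space \<kappa> n k"
      unfolding elt_set_plus_def set_plus_def using KL_relations_0 by blast
  qed
  ultimately show ?thesis using False by (simp add: KL_proj_def KL_class_def)
qed

lemma coset_eq:
  assumes "free.subspace V" "f - g \<in> V"
  shows "f +o V = g +o V"
proof -
  have "f +o V \<subseteq> g +o V" if "f - g \<in> V" for f g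
  proof
    fix x assume "x \<in> f +o V"
    then obtain v where v: "x = f + v" "v \<in> V" by (auto simp: elt_set_plus_def)
    then have "x = g + ((f - g) + v)" by simp
    moreover have "(f - g) + v \<in> V" using that v free.subspace_add[OF assms(1)] by blast
    ultimately show "x \<in> g +o V" unfolding elt_set_plus_def by blast
  qed
  moreover have "g - f \<in> V" using free.subspace_neg[OF assms(1) assms(2)] by simp
  ultimately show ?thesis using assms(2) by blast
qed

text \<open>Factorization through a quotient, reduced to two facts about the generators. Uniqueness
  holds because every class of \<open>russell_space\<close> has a representative in
  \<open>russell_free\<close> and the map is \<open>undefined\<close> elsewhere.\<close>

lemma descends_to_quotients:
  fixes n k :: nat and \<kappa> :: convention
  assumes tangles: "\<And>x. x \<in> dotted_diagrams n k \<Longrightarrow> psi_diagram n k x \<in> free_on (tangles n k)"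
    and rels: "\<And>r. r \<in> type_I n k \<union> type_II n k \<Longrightarrow> lin_ext q_to_half (psi_diagram n k) r \<in> null_space \<kappa> n k"
  shows "(\<exists>!\<psi>. \<psi> \<in> russell_space n k \<rightarrow>\<^sub>E KL_space \<kappa> n k \<and>
             (\<forall>f\<in>russell_free n k.
                \<psi> (russell_class n k f) = KL_proj \<kappa> n k (psi_tilde \<kappa> n k f)))
       \<and> (\<forall>r\<in>type_I n k \<union> type_II n k.
             KL_proj \<kappa> n k (psi_tilde \<kappa> n k r) = KL_zero \<kappa> n k)"
proof
  let ?L = "lin_ext q_to_half (psi_diagram n k)"
  let ?N = "null_space \<kappa> n k"
  let ?g = "\<lambda>f. KL_proj \<kappa> n k (psi_tilde \<kappa> n k f)"
  have proj: "?g f = ?L f +o ?N" for f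
    by (simp add: psi_tilde_def KL_proj_class)
  have zero: "KL_zero \<kappa> n k = 0 +o ?N"
    by (simp add: KL_zero_def KL_proj_class)
  show "\<forall>r\<in>type_I n k \<union> type_II n k. ?g r = KL_zero \<kappa> n k"
    unfolding proj zero by (intro ballI coset_eq subspace_null_space) (simp add: rels)
  have rel: "?L r \<in> ?N" if "r \<in> russell_relations n k" for r
  proof -
    have "free.span (type_I n k \<union> type_II n k) \<subseteq> {f. ?L f \<in> ?N}"
      using rels by (intro free.span_minimal subspace_lin_ext_vimage laurent_hom_q_to_half subspace_null_space) auto
    then show ?thesis using that unfolding russell_relations_def by blast
  qed
  have wd: "?g f = ?g f'" if "russell_class n k f = russell_class n k f'" for f f'
  proof -
    have "f + 0 \<in> russell_class n k f"
      using free.subspace_0[OF free.subspace_span]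
      unfolding russell_class_def russell_relations_def elt_set_plus_def by blast
    then have "f \<in> russell_class n k f'" using that by simp
    then obtain r where r: "f = f' + r" "r \<in> russell_relations n k"
      by (auto simp: russell_class_def elt_set_plus_def)
    then have "?L f - ?L f' \<in> ?N" using rel by (simp add: lin_ext_add laurent_hom_q_to_half)
    then show ?thesis unfolding proj by (intro coset_eq subspace_null_space)
  qed
  have mem: "?g f \<in> KL_space \<kappa> n k" if "f \<in> russell_free n k" for f
  proof -
    have "?L f \<in> free_on (tangles n k)"
      using that tangles by (intro lin_ext_mem subspace_free_on) (auto simp: russell_free_def free_on_def)
    then show ?thesis by (auto simp: KL_space_def psi_tilde_def KL_tilde_def)
  qed
  define \<psi> where "\<psi> = (\<lambda>X. if X \<in> russell_space n k
    then ?g (SOME f. f \<in> russell_free n k \<and> russell_class n k f = X) else undefined)"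
  have choice: "(SOME f. f \<in> russell_free n k \<and> russell_class n k f = X) \<in> russell_free n k
      \<and> russell_class n k (SOME f. f \<in> russell_free n k \<and> russell_class n k f = X) = X"
    if "X \<in> russell_space n k" for X
    using that unfolding russell_space_def by (intro someI_ex[of "\<lambda>f. f \<in> russell_free n k \<and> russell_class n k f = X"]) auto
  show "\<exists>!\<psi>. \<psi> \<in> russell_space n k \<rightarrow>\<^sub>E KL_space \<kappa> n k \<and>
      (\<forall>f\<in>russell_free n k. \<psi> (russell_class n k f) = ?g f)"
  proof (rule ex1I[of _ \<psi>])
    have "\<psi> (russell_class n k f) = ?g f" if f: "f \<in> russell_free n k" for f
    proof -
      have X: "russell_class n k f \<in> russell_space n k" using f by (simp add: russell_space_def)
      show ?thesis unfolding \<psi>_def if_P[OF X] by (rule wd) (rule choice[OF X, THEN conjunct2])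
    qed
    moreover have "\<psi> \<in> russell_space n k \<rightarrow>\<^sub>E KL_space \<kappa> n k"
      by (intro PiE_I) (use choice mem in \<open>simp_all add: \<psi>_def\<close>)
    ultimately show "\<psi> \<in> russell_space n k \<rightarrow>\<^sub>E KL_space \<kappa> n k \<and>
      (\<forall>f\<in>russell_free n k. \<psi> (russell_class n k f) = ?g f)" by blast
  next
    fix \<psi>' assume \<psi>': "\<psi>' \<in> russell_space n k \<rightarrow>\<^sub>E KL_space \<kappa> n k \<and>
      (\<forall>f\<in>russell_free n k. \<psi>' (russell_class n k f) = ?g f)"
    show "\<psi>' = \<psi>"
    proof
      fix X show "\<psi>' X = \<psi> X"
      proof (cases "X \<in> russell_space n k")
        case True
        then show ?thesis
          unfolding \<psi>_def if_P[OF True] using choice[OF True] \<psi>' by (metis (no_types, lifting))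
      next
        case False
        then show ?thesis
          unfolding \<psi>_def if_not_P[OF False] using \<psi>' PiE_arb by fastforce
      qed
    qed
  qed
qed


section \<open>Tangles read from left to right\<close>

text \<open>
  A tangle read along its endpoints from left to right: \<open>Push c\<close> starts a new strand, whose other
  end then crosses the \<open>c\<close> leftmost pending strands; at \<open>Pop\<close> the leftmost pending strand ends.
\<close>

datatype event = Push nat | Pop

text \<open>The argument \<open>j\<close> counts the endpoints already reached; they occupy the
  positions below \<open>j\<close> and stay untouched. The moving leg always lies on top and runs
  from lower left to upper right, whence \<open>OverNE\<close>.\<close>

fun tangle_of :: "nat \<Rightarrow> event list \<Rightarrow> tangle" where
  "tangle_of j [] = []"
| "tangle_of j (Push c # es) = (Cup, j) # map (\<lambda>t. (OverNE, t)) [Suc j..<Suc j + c] @ tangle_of (Suc j) es"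
| "tangle_of j (Pop # es) = tangle_of (Suc j) es"

abbreviation cons_config :: "bool \<Rightarrow> config \<Rightarrow> config" where
  "cons_config x s \<equiv> append_config [x] s"

lemma cons_config_simps [simp]: "cons_config x s 0 = x" "cons_config x s (Suc j) = s j"
  by (simp_all add: append_config_def)

text \<open>The cup and the crossings of one \<open>Push\<close>, after the spin \<open>x\<close> of
  the finished left leg has been fixed and its position removed, so that position 0 is the leftmost
  pending strand.\<close>

definition push_op :: "nat \<Rightarrow> bool \<Rightarrow> (config \<Rightarrow> laurent) \<Rightarrow> config \<Rightarrow> laurent" where
  "push_op c x V = act_all (map (\<lambda>t. (OverNE, t)) [0..<c])
     (\<lambda>st. cup_weight x (st 0) * V (\<lambda>j. st (Suc j)))"

fun scan :: "event list \<Rightarrow> bool list \<Rightarrow> (config \<Rightarrow> laurent) \<Rightarrow> config \<Rightarrow> laurent" where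
  "scan (Push c # es) (x # xs) V = scan es xs (push_op c x V)"
| "scan (Pop # es) (x # xs) V = scan es xs (\<lambda>st. V (cons_config x st))"
| "scan _ _ V = V"

lemma act_all_map_append_config:
  "act_all (map (\<lambda>t. (g, length xs + t)) ts) f (append_config xs st)
   = act_all (map (\<lambda>t. (g, t)) ts) (\<lambda>st. f (append_config xs st)) st"
proof (induction ts arbitrary: f st)
  case (Cons t ts)
  show ?case
    by (simp add: Cons.IH) (simp only: act_append_config)
qed simp

lemma act_cup_cons: "act (Cup, 0) f (cons_config x st) = cup_weight x (st 0) * f (\<lambda>j. st (Suc j))"
  by (simp add: cup_op_def remove_two_def)

text \<open>No later piece touches a finished endpoint, so its spin can be fixed as soon as it is
  reached. This turns a state sum at the top of the tangle into a scan that consumes one spin per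
  event.\<close>

lemma act_all_tangle_of:
  "length ys = length es \<Longrightarrow>
   act_all (tangle_of (length xs) es) f (append_config (xs @ ys) st)
   = scan es ys (\<lambda>st. f (append_config xs st)) st"
proof (induction es arbitrary: xs ys f)
  case Nil
  then show ?case by simp
next
  case (Cons e es)
  then obtain y ys' where ys: "ys = y # ys'" "length ys' = length es"
    by (cases ys) auto
  show ?case
  proof (cases e)
    case Pop
    have "act_all (tangle_of (length (xs @ [y])) es) f (append_config ((xs @ [y]) @ ys') st)
      = scan es ys' (\<lambda>st. f (append_config (xs @ [y]) st)) st"
      using ys by (intro Cons.IH) simp
    then show ?thesis using Pop ys by (simp add: append_config_append)
  next
    case (Push c)
    let ?g = "act_all (map (\<lambda>t. (OverNE, t)) [Suc (length xs)..<Suc (length xs) + c]) (act (Cup, length xs) f)"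
    have m: "map (\<lambda>t. (OverNE, t)) [Suc (length xs)..<Suc (length xs) + c]
      = map (\<lambda>t. (OverNE, length (xs @ [y]) + t)) [0..<c]"
      by (rule nth_equalityI) (auto simp del: upt_Suc)
    have "act_all (tangle_of (length (xs @ [y])) es) ?g (append_config ((xs @ [y]) @ ys') st)
      = scan es ys' (\<lambda>st. ?g (append_config (xs @ [y]) st)) st"
      using ys by (intro Cons.IH) simp
    moreover have "?g (append_config (xs @ [y]) st) = push_op c y (\<lambda>st. f (append_config xs st)) st" for st
      unfolding m act_all_map_append_config push_op_def
      using act_append_config[of Cup xs 0 f] act_cup_cons
      by (simp add: append_config_append)
    ultimately show ?thesis using Push ys by simp
  qed
qed

lemma spin_sum_tangle_of:
  "spin_sum (tangle_of 0 es) s = scan es (map s [0..<length es]) (\<lambda>_. 1) (\<lambda>j. s (length es + j))"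
  using act_all_tangle_of[of "map s [0..<length es]" es "[]" "\<lambda>_. 1" "\<lambda>j. s (length es + j)"]
  by (simp add: append_config_take)

lemma scan_append:
  "length es = length xs \<Longrightarrow> scan (es @ es') (xs @ xs') V = scan es' xs' (scan es xs V)"
  by (induction es xs V rule: scan.induct) auto

lemma push_op_0 [simp]: "push_op 0 x V = (\<lambda>st. cup_weight x (st 0) * V (\<lambda>j. st (Suc j)))"
  by (simp add: push_op_def)


section \<open>Dyck words\<close>

fun dyck :: "nat \<Rightarrow> bool list \<Rightarrow> bool" where
  "dyck h [] \<longleftrightarrow> h = 0"
| "dyck h (True # d) \<longleftrightarrow> dyck (Suc h) d"
| "dyck (Suc h) (False # d) \<longleftrightarrow> dyck h d"
| "dyck 0 (False # d) \<longleftrightarrow> False"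

definition events_of :: "bool list \<Rightarrow> event list" where
  "events_of = map (\<lambda>b. if b then Push 0 else Pop)"

lemma events_of_simps [simp]:
  "events_of [] = []" "events_of (True # d) = Push 0 # events_of d"
  "events_of (False # d) = Pop # events_of d" "length (events_of d) = length d"
  by (simp_all add: events_of_def)

abbreviation word :: "nat \<Rightarrow> bool list \<Rightarrow> tangle" where
  "word j d \<equiv> tangle_of j (events_of d)"

lemma word_append: "word j (d @ e) = word j d @ word (j + length d) e"
proof (induction d arbitrary: j)
  case (Cons b d)
  then show ?case by (cases b) auto
qed simp

lemma word_Suc: "word (Suc j) d = map (\<lambda>(g, i). (g, i + 1)) (word j d)"
proof (induction d arbitrary: j)
  case (Cons b d)
  then show ?case by (cases b) auto
qed simp

lemma word_cups: "p \<in> set (word j d) \<Longrightarrow> fst p = Cup"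
proof (induction d arbitrary: j)
  case (Cons b d)
  then show ?case by (cases b) auto
qed simp

lemma from_to_word: "dyck h d \<Longrightarrow> from_to (j + h) (word j d) (j + length d)"
proof (induction h d arbitrary: j rule: dyck.induct)
  case (2 h d)
  then show ?case using "2.IH"[of "Suc j"] by simp
next
  case (3 h d)
  then show ?case using "3.IH"[of "Suc j"] by simp
qed auto

lemma word_inject:
  "length d = length d' \<Longrightarrow> word j d = word j d' \<Longrightarrow> d = d'"
proof (induction d arbitrary: d' j)
  case (Cons b d)
  then obtain b' e where d': "d' = b' # e" "length d = length e" by (cases d') auto
  have pos: "(g, i) \<in> set (word l x) \<Longrightarrow> l \<le> i" for g i l x
  proof (induction x arbitrary: l)
    case (Cons c x)
    then show ?case by (cases c) (auto dest!: Cons.IH)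
  qed simp
  show ?case
  proof (cases "b = b'")
    case True
    then show ?thesis using Cons.IH[of e "Suc j"] Cons.prems d' by (cases b) auto
  next
    case False
    then have "(Cup, j) \<in> set (word (Suc j) d) \<or> (Cup, j) \<in> set (word (Suc j) e)"
      using Cons.prems(2) d' by (cases b; cases b') (auto, metis list.set_intros(1))
    then show ?thesis using pos[of Cup j "Suc j"] by auto
  qed
qed simp

text \<open>The stack holds the spins that the closing positions of the open arcs must have.\<close>

fun follow :: "bool list \<Rightarrow> bool list \<Rightarrow> bool list \<Rightarrow> bool list option" where
  "follow [] [] stk = Some stk"
| "follow (True # d) (y # ys) stk = follow d ys ((\<not> y) # stk)"
| "follow (False # d) (y # ys) (x # stk) = (if x = y then follow d ys stk else None)"
| "follow _ _ _ = None"

text \<open>The amplitude when the spins of all pending strands are forced. Scanning a Dyck word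
  preserves this form or gives 0, because the spin of one leg of a cup determines that of the
  other.\<close>

definition starts_with :: "bool list \<Rightarrow> laurent \<Rightarrow> config \<Rightarrow> laurent" where
  "starts_with stk c st = (if map st [0..<length stk] = stk then c else 0)"

lemma map_upt_Suc: "map f [0..<Suc n] = f 0 # map (\<lambda>j. f (Suc j)) [0..<n]"
  by (simp add: upt_conv_Cons map_Suc_upt[symmetric] del: upt_Suc)

lemma scan_follow_Some:
  "follow d ys stk = Some stk' \<Longrightarrow> c \<noteq> 0 \<Longrightarrow>
   \<exists>c'. c' \<noteq> 0 \<and> scan (events_of d) ys (starts_with stk c) = starts_with stk' c'"
proof (induction d ys stk arbitrary: c rule: follow.induct)
  case (2 d y ys stk)
  have "push_op 0 y (starts_with stk c) = starts_with ((\<not> y) # stk) (cup_weight y (\<not> y) * c)"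
    by (auto simp: starts_with_def map_upt_Suc fun_eq_iff cup_weight_def simp del: upt_Suc)
  moreover have "cup_weight y (\<not> y) * c \<noteq> 0"
    using 2 by (simp add: cup_weight_def)
  ultimately show ?case using 2 by (simp del: push_op_0)
next
  case (3 d y ys x stk)
  then have "(\<lambda>st. starts_with (x # stk) c (cons_config y st)) = starts_with stk c"
    by (auto simp: starts_with_def map_upt_Suc fun_eq_iff simp del: upt_Suc split: if_splits)
  then show ?case using 3 by (simp split: if_splits)
qed auto

lemma scan_zero: "scan es ys (\<lambda>_. 0) = (\<lambda>_. 0)"
proof (induction es ys "\<lambda>_ :: config. 0 :: laurent" rule: scan.induct)
  case (1 c es x xs)
  have "push_op c x (\<lambda>_. 0) = (\<lambda>_. 0)"
    unfolding push_op_def using act_all_scale[of _ 0 "\<lambda>_. 0"] by simp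
  then show ?case using 1 by simp
qed auto

lemma scan_follow_None:
  "follow d ys stk = None \<Longrightarrow> length ys = length d \<Longrightarrow> dyck (length stk) (d @ e) \<Longrightarrow>
   scan (events_of d) ys (starts_with stk c) = (\<lambda>_. 0)"
proof (induction d ys stk arbitrary: c rule: follow.induct)
  case (2 d y ys stk)
  have "push_op 0 y (starts_with stk c) = starts_with ((\<not> y) # stk) (cup_weight y (\<not> y) * c)"
    by (auto simp: starts_with_def map_upt_Suc fun_eq_iff cup_weight_def simp del: upt_Suc)
  then show ?case using 2 by (simp del: push_op_0)
next
  case (3 d y ys x stk)
  have "(\<lambda>st. starts_with (x # stk) c (cons_config y st)) = (if x = y then starts_with stk c else (\<lambda>_. 0))"
    by (auto simp: starts_with_def map_upt_Suc fun_eq_iff simp del: upt_Suc split: if_splits)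
  then show ?case using 3 by (cases "x = y") (simp_all add: scan_zero)
qed auto

lemma follow_append:
  "length d = length ys \<Longrightarrow>
   follow (d @ e) (ys @ zs) stk = Option.bind (follow d ys stk) (follow e zs)"
  by (induction d ys stk rule: follow.induct) auto

lemma follow_dyck:
  "follow d ys stk = Some stk' \<Longrightarrow> dyck (length stk) (d @ e) \<longleftrightarrow> dyck (length stk') e"
  by (induction d ys stk rule: follow.induct) (auto split: if_splits)

lemma spin_sum_word_neq_0_iff:
  assumes "dyck 0 d"
  shows "spin_sum (word 0 d) s \<noteq> 0 \<longleftrightarrow> follow d (map s [0..<length d]) [] = Some []"
proof -
  let ?ys = "map s [0..<length d]"
  have 1: "starts_with [] 1 = (\<lambda>_. 1)" by (simp add: starts_with_def fun_eq_iff)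
  have eq: "spin_sum (word 0 d) s = scan (events_of d) ?ys (starts_with [] 1) (\<lambda>j. s (length d + j))"
    by (simp add: spin_sum_tangle_of 1)
  show ?thesis
  proof (cases "follow d ?ys []")
    case None
    then show ?thesis using scan_follow_None[OF None, of "[]" 1] assms unfolding eq by simp
  next
    case (Some stk)
    then have "stk = []" using follow_dyck[OF Some, of "[]"] assms by simp
    moreover obtain c where "c \<noteq> 0" "scan (events_of d) ?ys (starts_with [] 1) = starts_with stk c"
      using scan_follow_Some[OF Some, of 1] by auto
    ultimately show ?thesis using Some unfolding eq by (simp add: starts_with_def)
  qed
qed

section \<open>Unmatched letters and leading configurations\<close>

fun unmatched_closers :: "bool list \<Rightarrow> nat" where
  "unmatched_closers [] = 0"
| "unmatched_closers (False # m) = Suc (unmatched_closers m)"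
| "unmatched_closers (True # m) = unmatched_closers m - 1"

fun unmatched_openers :: "bool list \<Rightarrow> nat" where
  "unmatched_openers [] = 0"
| "unmatched_openers (False # m) = unmatched_openers m"
| "unmatched_openers (True # m) = (if unmatched_closers m = 0 then Suc (unmatched_openers m) else unmatched_openers m)"

lemma dyck_append:
  "dyck h (m @ e) \<longleftrightarrow> unmatched_closers m \<le> h \<and> dyck (h - unmatched_closers m + unmatched_openers m) e"
proof (induction h m rule: dyck.induct)
  case (2 h d)
  then show ?case by (cases "unmatched_closers d") (auto simp: Suc_diff_le)
qed auto

lemma dyck_replicate_False [simp]: "dyck h (replicate j False) \<longleftrightarrow> h = j"
proof (induction j arbitrary: h)
  case (Suc j)
  then show ?case by (cases h) auto
qed auto

lemma dyck_replicate_True [simp]: "dyck h (replicate j True @ d) \<longleftrightarrow> dyck (h + j) d"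
  by (induction j arbitrary: h) auto

text \<open>
  The configuration in which the matched arcs and those leading to the left are
  down-up, and those leading to the right are up-down.
\<close>

fun lead :: "bool list \<Rightarrow> bool list" where
  "lead [] = []"
| "lead (False # m) = True # lead m"
| "lead (True # m) = (unmatched_closers m = 0) # lead m"

text \<open>Recovers a word from its leading configuration: a down spin is always an opener, and an
  up spin is a closer as long as some closer is still expected. The argument counts the closers
  expected.\<close>

fun decode :: "nat \<Rightarrow> bool list \<Rightarrow> bool list" where
  "decode c [] = []"
| "decode c (False # xs) = True # decode (Suc c) xs"
| "decode (Suc c) (True # xs) = False # decode c xs"
| "decode 0 (True # xs) = True # decode 0 xs"

lemma decode_lead: "decode (unmatched_closers m) (lead m) = m"
proof (induction m rule: lead.induct)
  case (3 m)
  then show ?case by (cases "unmatched_closers m") auto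
qed auto

lemma length_lead [simp]: "length (lead m) = length m"
  by (induction m rule: lead.induct) auto

text \<open>The sum of the positions of the up spins, the first position being \<open>i\<close>;
  this is the quantity that orders the leading configurations.\<close>

fun moment :: "nat \<Rightarrow> bool list \<Rightarrow> nat" where
  "moment i [] = 0"
| "moment i (x # xs) = (if x then i else 0) + moment (Suc i) xs"

lemma follow_stack_length:
  "follow m xs stk = Some stk' \<Longrightarrow> unmatched_closers m \<le> length stk \<and>
     drop (unmatched_closers m) stk = drop (unmatched_openers m) stk'"
proof (induction m xs stk rule: follow.induct)
  case (2 d y ys stk)
  then have IH: "unmatched_closers d \<le> Suc (length stk)"
     "drop (unmatched_closers d) ((\<not> y) # stk) = drop (unmatched_openers d) stk'" by auto
  show ?case
  proof (cases "unmatched_closers d")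
    case 0
    then have "drop (Suc (unmatched_openers d)) stk' = stk"
      using IH by (metis drop0 drop_Suc list.sel(3) tl_drop)
    then show ?thesis using 0 by simp
  next
    case (Suc c)
    then show ?thesis using IH by simp
  qed
qed (auto split: if_splits)

text \<open>A matched arc contributes most when its up spin sits at its right end, as in
  \<open>lead\<close>; openers left on the stack are forced up. The product term pays for closers
  whose stack entry demands a down spin, where \<open>lead\<close> has an up spin at a position at
  least \<open>i\<close>.\<close>

lemma moment_le:
  assumes "follow m xs stk = Some stk'" "True \<notin> set stk'"
  shows "moment i xs + i * length (filter Not (take (unmatched_closers m) stk)) \<le> moment i (lead m)"
  using assms
proof (induction m xs stk arbitrary: i rule: follow.induct)
  case (2 d y ys stk)
  have IH: "moment (Suc i) ys + Suc i * length (filter Not (take (unmatched_closers d) ((\<not> y) # stk)))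
    \<le> moment (Suc i) (lead d)" using "2.IH"[of "Suc i"] "2.prems" by simp
  show ?case
  proof (cases "unmatched_closers d")
    case 0
    have "follow d ys ((\<not> y) # stk) = Some stk'" using 2 by simp
    from follow_stack_length[OF this] have "(\<not> y) \<in> set stk'"
      using 0 by (metis drop0 in_set_dropD list.set_intros(1))
    then have y using 2 by (cases y) auto
    then show ?thesis using IH 0 by simp
  next
    case (Suc c)
    then show ?thesis using IH by (cases y) (auto simp: algebra_simps)
  qed
next
  case (3 d y ys x stk)
  have IH: "moment (Suc i) ys + Suc i * length (filter Not (take (unmatched_closers d) stk))
    \<le> moment (Suc i) (lead d)" using "3.IH"[of "Suc i"] "3.prems" by (simp split: if_splits)
  then show ?case using 3 by (auto simp: algebra_simps split: if_splits)
qed auto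

text \<open>If an opener that is matched inside \<open>m\<close> is up, its closer must be down, and
  \<open>moment_le\<close> applied to the remaining word has a positive product term. Otherwise the
  configuration follows \<open>lead\<close> letter by letter.\<close>

lemma moment_less:
  assumes "follow m xs stk = Some stk'" "True \<notin> set stk'" "False \<notin> set (take (unmatched_closers m) stk)"
  shows "xs = lead m \<or> moment i xs < moment i (lead m)"
  using assms
proof (induction m xs stk arbitrary: i rule: follow.induct)
  case (2 d y ys stk)
  have f: "follow d ys ((\<not> y) # stk) = Some stk'" using 2 by simp
  show ?case
  proof (cases "unmatched_closers d")
    case 0
    from follow_stack_length[OF f] have "(\<not> y) \<in> set stk'"
      using 0 by (metis drop0 in_set_dropD list.set_intros(1))
    then have y using 2 by (cases y) auto
    then show ?thesis using 2 0 by auto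
  next
    case (Suc c)
    show ?thesis
    proof (cases y)
      case True
      have "moment (Suc i) ys + Suc i * length (filter Not (take (unmatched_closers d) ((\<not> y) # stk)))
        \<le> moment (Suc i) (lead d)" by (rule moment_le[OF f 2(3)])
      then show ?thesis using Suc True by simp
    next
      case False
      then show ?thesis using 2 Suc by auto
    qed
  qed
next
  case (3 d y ys x stk)
  then show ?case by (auto split: if_splits)
qed auto

lemma follow_lead:
  assumes "unmatched_closers m \<le> length stk" "False \<notin> set (take (unmatched_closers m) stk)"
    "True \<notin> set (drop (unmatched_closers m) stk)"
  shows "\<exists>stk'. follow m (lead m) stk = Some stk' \<and> True \<notin> set stk'"
  using assms
proof (induction m arbitrary: stk rule: lead.induct)
  case (2 m)
  then obtain x stk1 where "stk = x # stk1" by (cases stk) auto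
  then show ?case using 2 by auto
next
  case (3 m)
  then show ?case by (cases "unmatched_closers m") (auto)
qed auto


section \<open>A criterion for vanishing in the Kauffman--Lins space\<close>

definition projected :: "nat \<Rightarrow> nat \<Rightarrow> config \<Rightarrow> bool" where
  "projected n k s \<longleftrightarrow> (\<forall>j<k. \<not> s j) \<and> (\<forall>j\<in>{2 * n + k..<2 * n + 2 * k}. \<not> s j)"

text \<open>Elements that vanish both in the quotient and in value. Reduction modulo this submodule
  changes neither the class nor the values, which is how vanishing values are carried to the normal
  form.\<close>

definition null_kernel :: "convention \<Rightarrow> nat \<Rightarrow> nat \<Rightarrow> (tangle \<Rightarrow>\<^sub>0 laurent) set" where
  "null_kernel \<kappa> n k = {E \<in> null_space \<kappa> n k. \<forall>s. projected n k s \<longrightarrow> spin_eval E s = 0}"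

lemma subspace_null_kernel: "free.subspace (null_kernel \<kappa> n k)"
  by (rule free.subspaceI)
     (auto simp: null_kernel_def spin_eval_add spin_eval_smult
        intro: subspace_null_space[THEN free.subspace_0] subspace_null_space[THEN free.subspace_add]
          subspace_null_space[THEN free.subspace_scale])

lemma null_kernelI:
  assumes "E \<in> isotopy_rels n k \<union> basis ` turnbacks \<kappa> n k \<union> circle_rels n k \<union> crossing_rels n k"
    and "\<And>s. projected n k s \<Longrightarrow> spin_eval E s = 0"
  shows "E \<in> null_kernel \<kappa> n k"
  using free.span_base[OF assms(1)] KL_relations_subset_null_space assms(2)
  unfolding null_kernel_def KL_relations_def by blast

section \<open>Reduction of crossingless tangles to Dyck words\<close>

lemma from_to_append: "from_to a (u @ v) b \<longleftrightarrow> (\<exists>m. from_to a u m \<and> from_to m v b)"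
  by (induction a u "0::nat" rule: from_to.induct) auto

text \<open>The quantifier over \<open>v\<close> makes reductions of the lower part of a tangle
  compose, whatever is stacked on top; the claim about \<open>tangles\<close> keeps the chain
  going.\<close>

definition reduces :: "convention \<Rightarrow> nat \<Rightarrow> nat \<Rightarrow> laurent \<Rightarrow> tangle \<Rightarrow> tangle \<Rightarrow> bool" where
  "reduces \<kappa> n k c u u' \<longleftrightarrow> (\<forall>v. u @ v \<in> tangles n k \<longrightarrow>
     u' @ v \<in> tangles n k \<and> basis (u @ v) - smult c (basis (u' @ v)) \<in> null_kernel \<kappa> n k)"

lemma reduces_refl: "reduces \<kappa> n k 1 u u"
  by (simp add: reduces_def free.subspace_0[OF subspace_null_kernel])

lemma reduces_trans:
  assumes "reduces \<kappa> n k c u u'" "reduces \<kappa> n k c' u' u''"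
  shows "reduces \<kappa> n k (c * c') u u''"
  unfolding reduces_def
proof (intro allI impI)
  fix v assume v: "u @ v \<in> tangles n k"
  have 1: "u' @ v \<in> tangles n k" "basis (u @ v) - smult c (basis (u' @ v)) \<in> null_kernel \<kappa> n k"
    using v assms(1) by (auto simp: reduces_def)
  then have 2: "u'' @ v \<in> tangles n k" "basis (u' @ v) - smult c' (basis (u'' @ v)) \<in> null_kernel \<kappa> n k"
    using assms(2) by (auto simp: reduces_def)
  have "basis (u @ v) - smult (c * c') (basis (u'' @ v))
    = (basis (u @ v) - smult c (basis (u' @ v))) + smult c (basis (u' @ v) - smult c' (basis (u'' @ v)))"
    by (simp add: free.scale_right_diff_distrib)
  then show "u'' @ v \<in> tangles n k \<and> basis (u @ v) - smult (c * c') (basis (u'' @ v)) \<in> null_kernel \<kappa> n k"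
    using 1 2 free.subspace_add[OF subspace_null_kernel] free.subspace_scale[OF subspace_null_kernel] by metis
qed

lemma reduces_append: "reduces \<kappa> n k c u u' \<Longrightarrow> reduces \<kappa> n k c (u @ x) (u' @ x)"
  by (simp add: reduces_def)

lemma reduces_move:
  assumes "move l r \<or> move r l" "\<And>f. act_all l f = act_all r f"
    and "\<And>m m'. from_to m l m' \<Longrightarrow> from_to m r m'"
  shows "reduces \<kappa> n k 1 (u @ l) (u @ r)"
  unfolding reduces_def
proof (intro allI impI)
  fix v assume v: "(u @ l) @ v \<in> tangles n k"
  then have r: "u @ r @ v \<in> tangles n k"
    using assms(3) by (fastforce simp: tangles_def from_to_append)
  have s: "spin_eval (basis (u @ l @ v) - basis (u @ r @ v)) s = 0" for s
    by (simp add: spin_eval_diff assms(2))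
  have "basis (u @ l @ v) - basis (u @ r @ v) \<in> null_kernel \<kappa> n k"
    using assms(1)
  proof
    assume "move l r"
    then show ?thesis
      using v r s by (intro null_kernelI) (auto simp: isotopy_rels_def)
  next
    assume "move r l"
    then have "basis (u @ r @ v) - basis (u @ l @ v) \<in> null_kernel \<kappa> n k"
      using v r s
      by (intro null_kernelI) (auto simp: isotopy_rels_def spin_eval_diff assms(2))
    from free.subspace_neg[OF subspace_null_kernel this] show ?thesis by simp
  qed
  then show "(u @ r) @ v \<in> tangles n k \<and> basis ((u @ l) @ v) - smult 1 (basis ((u @ r) @ v)) \<in> null_kernel \<kappa> n k"
    using r by simp
qed

lemma reduces_cup_cup:
  assumes "i \<le> j"
  shows "reduces \<kappa> n k 1 (u @ [(Cup, j), (Cup, i)]) (u @ [(Cup, i), (Cup, j + 2)])"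
proof (rule reduces_move)
  show "move [(Cup, j), (Cup, i)] [(Cup, i), (Cup, j + 2)] \<or> move [(Cup, i), (Cup, j + 2)] [(Cup, j), (Cup, i)]"
    using move.exchange[of i Cup j Cup] assms by simp
  show "act_all [(Cup, j), (Cup, i)] f = act_all [(Cup, i), (Cup, j + 2)] f" for f
    using act_cup_cup[OF assms] by simp
qed (use assms in auto)

lemma reduces_cup_cap_low:
  assumes "i \<le> j"
  shows "reduces \<kappa> n k 1 (u @ [(Cup, i), (Cap, j + 2)]) (u @ [(Cap, j), (Cup, i)])"
proof (rule reduces_move)
  show "move [(Cup, i), (Cap, j + 2)] [(Cap, j), (Cup, i)] \<or> move [(Cap, j), (Cup, i)] [(Cup, i), (Cap, j + 2)]"
    using move.exchange[of i Cup j Cap] assms by simp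
  show "act_all [(Cup, i), (Cap, j + 2)] f = act_all [(Cap, j), (Cup, i)] f" for f
    using act_cup_cap[OF assms] by simp
qed (use assms in auto)

lemma reduces_cup_cap_high:
  assumes "i \<le> j"
  shows "reduces \<kappa> n k 1 (u @ [(Cup, j + 2), (Cap, i)]) (u @ [(Cap, i), (Cup, j)])"
proof (rule reduces_move)
  show "move [(Cup, j + 2), (Cap, i)] [(Cap, i), (Cup, j)] \<or> move [(Cap, i), (Cup, j)] [(Cup, j + 2), (Cap, i)]"
    using move.exchange[of i Cap "j + 2" Cup] assms by simp
  show "act_all [(Cup, j + 2), (Cap, i)] f = act_all [(Cap, i), (Cup, j)] f" for f
    using act_cap_cup[OF assms] by simp
qed (use assms in auto)

lemma reduces_straighten_left: "reduces \<kappa> n k 1 (u @ [(Cup, i), (Cap, i + 1)]) (u @ [])"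
proof (rule reduces_move)
  show "act_all [(Cup, i), (Cap, i + 1)] f = act_all [] f" for f
    using act_straighten_left by simp
qed (use move.straighten_left in auto)

lemma reduces_straighten_right: "reduces \<kappa> n k 1 (u @ [(Cup, i + 1), (Cap, i)]) (u @ [])"
proof (rule reduces_move)
  show "act_all [(Cup, i + 1), (Cap, i)] f = act_all [] f" for f
    using act_straighten_right by simp
qed (use move.straighten_right in auto)

lemma reduces_circle: "reduces \<kappa> n k (- hpow 2 - hpow (-2)) (u @ [(Cup, i), (Cap, i)]) u"
  unfolding reduces_def
proof (intro allI impI)
  fix v assume v: "(u @ [(Cup, i), (Cap, i)]) @ v \<in> tangles n k"
  then have t: "u @ v \<in> tangles n k" by (auto simp: tangles_def from_to_append)
  have act: "act_all [(Cup, i), (Cap, i)] f = (\<lambda>s. (- hpow 2 - hpow (-2)) * f s)" for f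
    using act_circle by simp
  have "basis (u @ [(Cup, i), (Cap, i)] @ v) - smult (- hpow 2 - hpow (-2)) (basis (u @ v)) \<in> null_kernel \<kappa> n k"
  proof (rule null_kernelI)
    show "spin_eval (basis (u @ [(Cup, i), (Cap, i)] @ v) - smult (- hpow 2 - hpow (-2)) (basis (u @ v))) s = 0" for s
      unfolding spin_eval_diff spin_eval_smult spin_eval_basis act_all_simps(3) act act_all_scale by simp
  qed (use v in \<open>unfold circle_rels_def, fastforce\<close>)
  with t show "u @ v \<in> tangles n k \<and>
    basis ((u @ [(Cup, i), (Cap, i)]) @ v) - smult (- hpow 2 - hpow (-2)) (basis (u @ v)) \<in> null_kernel \<kappa> n k"
    by simp
qed

lemma crossing_NW_null_kernel:
  assumes "u @ [(OverNW, i)] @ v \<in> tangles n k"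
  shows "basis (u @ [(OverNW, i)] @ v)
      - (smult (hpow 1) (basis (u @ [(Cap, i), (Cup, i)] @ v)) + smult (hpow (-1)) (basis (u @ v)))
    \<in> null_kernel \<kappa> n k" (is "?E \<in> _")
proof (rule null_kernelI)
  have "act_all [(OverNW, i)] f = (\<lambda>s. hpow 1 * act_all [(Cap, i), (Cup, i)] f s + hpow (-1) * f s)" for f
    by simp
  then show "spin_eval ?E s = 0" for s
    unfolding spin_eval_diff spin_eval_add spin_eval_smult spin_eval_basis act_all_simps(3)
    by (simp only: act_all_add act_all_scale diff_self)
qed (use assms in \<open>unfold crossing_rels_def, fastforce\<close>)

lemma crossing_NE_null_kernel:
  assumes "u @ [(OverNE, i)] @ v \<in> tangles n k"
  shows "basis (u @ [(OverNE, i)] @ v)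
      - (smult (hpow 1) (basis (u @ v)) + smult (hpow (-1)) (basis (u @ [(Cap, i), (Cup, i)] @ v)))
    \<in> null_kernel \<kappa> n k" (is "?E \<in> _")
proof (rule null_kernelI)
  have "act_all [(OverNE, i)] f = (\<lambda>s. hpow 1 * f s + hpow (-1) * act_all [(Cap, i), (Cup, i)] f s)" for f
    by simp
  then show "spin_eval ?E s = 0" for s
    unfolding spin_eval_diff spin_eval_add spin_eval_smult spin_eval_basis act_all_simps(3)
    by (simp only: act_all_add act_all_scale diff_self)
qed (use assms in \<open>unfold crossing_rels_def, fastforce\<close>)

definition cups_only :: "tangle \<Rightarrow> bool" where
  "cups_only w \<longleftrightarrow> (\<forall>p\<in>set w. fst p = Cup)"

lemma cups_only_simps [simp]:
  "cups_only []" "cups_only (u @ v) \<longleftrightarrow> cups_only u \<and> cups_only v"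
  "cups_only ((g, i) # w) \<longleftrightarrow> g = Cup \<and> cups_only w"
  by (auto simp: cups_only_def)

text \<open>The cap is pulled down past distant cups until it meets a cup with which it shares a
  strand; there it closes a circle or straightens a strand. This must happen, since nothing can be
  capped at the bottom.\<close>

lemma reduces_cap:
  "cups_only c \<Longrightarrow> \<exists>a c'. cups_only c' \<and> reduces \<kappa> n k a (c @ [(Cap, i)]) c'"
proof (induction c arbitrary: i rule: rev_induct)
  case Nil
  \<comment> \<open>Vacuous: with a cap on zero strands there is no tangle.\<close>
  have "reduces \<kappa> n k 1 ([] @ [(Cap, i)]) []"
    by (simp add: reduces_def tangles_def)
  then show ?case by (metis cups_only_simps(1))
next
  case (snoc p c)
  then obtain j where p: "p = (Cup, j)" and c: "cups_only c"
    by (cases p) (auto simp: cups_only_def)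
  have "i = j \<or> i = j + 1 \<or> j = i + 1 \<or> i = (i - 2) + 2 \<and> j \<le> i - 2 \<or> j = (j - 2) + 2 \<and> i \<le> j - 2"
    by linarith
  then consider "i = j" | "i = j + 1" | "j = i + 1" | i' where "i = i' + 2" "j \<le> i'" | j' where "j = j' + 2" "i \<le> j'"
    by metis
  then show ?case
  proof cases
    case 1
    then show ?thesis using reduces_circle[of \<kappa> n k c j] p c by auto
  next
    case 2
    then show ?thesis using reduces_straighten_left[of \<kappa> n k c j] p c by auto
  next
    case 3
    then show ?thesis using reduces_straighten_right[of \<kappa> n k c i] p c by auto
  next
    case 4
    obtain a c' where "cups_only c'" "reduces \<kappa> n k a (c @ [(Cap, i')]) c'"
      using snoc.IH[OF c] by blast
    then have "reduces \<kappa> n k (1 * a) (c @ [(Cup, j), (Cap, i)]) (c' @ [(Cup, j)])"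
      using reduces_trans[OF reduces_cup_cap_low[OF 4(2)]] reduces_append[of \<kappa> n k a _ c' "[(Cup, j)]"] 4(1)
      by fastforce
    then show ?thesis using p \<open>cups_only c'\<close> by (intro exI[of _ "1 * a"] exI[of _ "c' @ [(Cup, j)]"]) simp
  next
    case 5
    obtain a c' where "cups_only c'" "reduces \<kappa> n k a (c @ [(Cap, i)]) c'"
      using snoc.IH[OF c] by blast
    then have "reduces \<kappa> n k (1 * a) (c @ [(Cup, j), (Cap, i)]) (c' @ [(Cup, j')])"
      using reduces_trans[OF reduces_cup_cap_high[OF 5(2)]] reduces_append[of \<kappa> n k a _ c' "[(Cup, j')]"] 5(1)
      by fastforce
    then show ?thesis using p \<open>cups_only c'\<close> by (intro exI[of _ "1 * a"] exI[of _ "c' @ [(Cup, j')]"]) simp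
  qed
qed

lemma reduces_planar:
  assumes "\<forall>p\<in>set w. \<not> is_crossing (fst p)"
  shows "\<exists>a c. cups_only c \<and> reduces \<kappa> n k a w c"
  using assms
proof (induction w rule: rev_induct)
  case Nil
  then show ?case using reduces_refl[of \<kappa> n k "[]"] cups_only_simps(1) by blast
next
  case (snoc p w)
  then obtain a c where c: "cups_only c" "reduces \<kappa> n k a w c" by auto
  then have r: "reduces \<kappa> n k a (w @ [p]) (c @ [p])" by (intro reduces_append)
  obtain g i where p: "p = (g, i)" by (cases p)
  have "g = Cup \<or> g = Cap" using snoc.prems p by (cases g) auto
  then show ?case
  proof
    assume "g = Cup"
    then show ?thesis using r c p by (intro exI[of _ a] exI[of _ "c @ [p]"]) simp
  next
    assume "g = Cap"
    then show ?thesis using reduces_cap[OF c(1), of \<kappa> n k i] reduces_trans[OF r] p by metis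
  qed
qed

text \<open>All cups of \<open>word j e\<close> lie at positions at least \<open>j\<close>, so the
  new cup passes below them by height exchanges and shifts each of them by two.\<close>

lemma reduces_shift:
  "i \<le> j \<Longrightarrow> reduces \<kappa> n k 1 (u @ word j e @ [(Cup, i)]) (u @ (Cup, i) # word (j + 2) e)"
proof (induction e arbitrary: j u)
  case Nil
  then show ?case using reduces_refl by simp
next
  case (Cons b e)
  show ?case
  proof (cases b)
    case False
    then show ?thesis using Cons.IH[of "Suc j" u] Cons.prems by simp
  next
    case True
    have "reduces \<kappa> n k 1 ((u @ [(Cup, j)]) @ word (Suc j) e @ [(Cup, i)])
        ((u @ [(Cup, j)]) @ (Cup, i) # word (Suc j + 2) e)"
      using Cons.prems by (intro Cons.IH) simp
    moreover have "reduces \<kappa> n k 1 ((u @ [(Cup, j), (Cup, i)]) @ word (Suc j + 2) e)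
      ((u @ [(Cup, i), (Cup, j + 2)]) @ word (Suc j + 2) e)"
      by (intro reduces_append reduces_cup_cup Cons.prems)
    ultimately have "reduces \<kappa> n k (1 * 1) ((u @ [(Cup, j)]) @ word (Suc j) e @ [(Cup, i)])
      ((u @ [(Cup, i), (Cup, j + 2)]) @ word (Suc j + 2) e)"
      by (intro reduces_trans) simp_all
    then show ?thesis using True by simp
  qed
qed

lemma reduces_insert_cup:
  "reduces \<kappa> n k 1 (word 0 (d1 @ d2) @ [(Cup, length d1)]) (word 0 (d1 @ [True, False] @ d2))"
  using reduces_shift[of "length d1" "length d1" \<kappa> n k "word 0 d1" d2] by (simp add: word_append)

lemma dyck_insert: "dyck h (d1 @ [True, False] @ d2) \<longleftrightarrow> dyck h (d1 @ d2)"
  by (induction h d1 rule: dyck.induct) auto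

lemma reduces_cups:
  "cups_only c \<Longrightarrow> from_to 0 c m \<Longrightarrow> \<exists>d. dyck 0 d \<and> length d = m \<and> reduces \<kappa> n k 1 c (word 0 d)"
proof (induction c arbitrary: m rule: rev_induct)
  case Nil
  then show ?case using reduces_refl[of \<kappa> n k "[]"] by (intro exI[of _ "[]"]) simp
next
  case (snoc p c)
  then obtain i where p: "p = (Cup, i)" and c: "cups_only c"
    by (cases p) (auto simp: cups_only_def)
  then obtain m' where m': "from_to 0 c m'" "i \<le> m'" "m = m' + 2"
    using snoc.prems by (auto simp: from_to_append)
  obtain d where d: "dyck 0 d" "length d = m'" "reduces \<kappa> n k 1 c (word 0 d)"
    using snoc.IH[OF c m'(1)] by blast
  let ?d = "take i d @ [True, False] @ drop i d"
  have "dyck 0 ?d" using d dyck_insert[of 0 "take i d" "drop i d"] by simp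
  moreover have "length ?d = m" using d m' by simp
  moreover have "reduces \<kappa> n k (1 * 1) (c @ [p]) (word 0 ?d)"
    using reduces_trans[OF reduces_append[OF d(3), of "[p]"]] reduces_insert_cup[of \<kappa> n k "take i d" "drop i d"] m' d p
    by simp
  ultimately show ?case by (metis mult_1)
qed

lemma reduces_tangle:
  assumes "w \<in> tangles n k" "reduces \<kappa> n k c w w'"
  shows "w' \<in> tangles n k" "basis w - smult c (basis w') \<in> null_kernel \<kappa> n k"
  using assms unfolding reduces_def by (metis append_Nil2)+

lemma planar_to_word:
  assumes "w \<in> tangles n k" "\<forall>p\<in>set w. \<not> is_crossing (fst p)"
  shows "\<exists>a d. dyck 0 d \<and> length d = 2 * (n + k) \<and> basis w - smult a (basis (word 0 d)) \<in> null_kernel \<kappa> n k"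
proof -
  obtain a c where c: "cups_only c" "reduces \<kappa> n k a w c"
    using reduces_planar[OF assms(2)] by blast
  then have "c \<in> tangles n k" using reduces_tangle assms(1) by blast
  then obtain d where d: "dyck 0 d" "length d = 2 * (n + k)" "reduces \<kappa> n k 1 c (word 0 d)"
    using reduces_cups[OF c(1), of "2 * (n + k)" \<kappa> n k] by (auto simp: tangles_def)
  then show ?thesis using reduces_tangle[OF assms(1) reduces_trans[OF c(2) d(3)]] by auto
qed

section \<open>Dyck words that vanish in the quotient\<close>

lemma word_tangles: "dyck 0 d \<Longrightarrow> length d = 2 * (n + k) \<Longrightarrow> word 0 d \<in> tangles n k"
  using from_to_word[of 0 d 0] by (simp add: tangles_def)

text \<open>The cup of the two adjacent letters can be drawn last. The diagram is then visibly a
  crossingless turnback, a relation under either convention, and its value contains a cup weight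
  with both spins down.\<close>

lemma turnback_null_kernel:
  assumes d: "dyck 0 (d1 @ [True, False] @ d2)" "length (d1 @ [True, False] @ d2) = 2 * (n + k)"
    and proj: "length d1 + 1 < k \<or> 2 * n + k \<le> length d1"
  shows "basis (word 0 (d1 @ [True, False] @ d2)) \<in> null_kernel \<kappa> n k"
proof -
  let ?i = "length d1"
  let ?w = "word 0 (d1 @ d2) @ [(Cup, ?i)]"
  have d': "dyck 0 (d1 @ d2)" using d dyck_insert by simp
  have w: "?w \<in> tangles n k"
    using from_to_word[OF d', of 0] d(2) by (auto simp: tangles_def from_to_append)
  have planar: "\<forall>(g, i)\<in>set ?w. \<not> is_crossing g"
    using word_cups by fastforce
  have "linked ?w (Suc (length (word 0 (d1 @ d2))), ?i) (Suc (length (word 0 (d1 @ d2))), ?i + 1)"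
    by (rule linked.intros(3)) auto
  then have "joined ?w ?i (?i + 1)"
    unfolding joined_def by (auto intro: r_into_equivclp)
  then have "has_turnback n k ?w"
    using proj d(2) unfolding has_turnback_def
    by (intro bexI[of _ "if ?i + 1 < k then {..<k} else {2 * n + k..<2 * n + 2 * k}"]
         bexI[of _ ?i] bexI[of _ "?i + 1"]) auto
  then have "?w \<in> turnbacks \<kappa> n k"
    using w planar by (auto simp: turnbacks_def)
  moreover have "spin_eval (basis ?w) s = 0" if "projected n k s" for s
  proof -
    have "\<not> s ?i" "\<not> s (?i + 1)" using that proj d(2) by (auto simp: projected_def)
    then show ?thesis by (simp add: cup_op_def cup_weight_def)
  qed
  ultimately have *: "basis ?w \<in> null_kernel \<kappa> n k" by (intro null_kernelI) auto
  have "basis ?w - smult 1 (basis (word 0 (d1 @ [True, False] @ d2))) \<in> null_kernel \<kappa> n k"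
    by (rule reduces_tangle(2)[OF w reduces_insert_cup])
  from free.subspace_diff[OF subspace_null_kernel * this] show ?thesis by simp
qed

text \<open>The word is the image of \<open>d\<close> under adding the outer arc. Its value vanishes
  because the balanced word \<open>d\<close> returns the stack unchanged, so the outer arc needs
  opposite end spins, while both ends are down.\<close>

lemma outer_word_null_kernel:
  assumes d: "dyck 0 d" "length d = 2 * (n + (k - 1))" and "k \<noteq> 0"
  shows "basis (word 0 (True # d @ [False])) \<in> null_kernel \<kappa> n k"
proof -
  have eq: "word 0 (True # d @ [False]) = add_outer_arc (word 0 d)"
    using word_Suc[of 0 d] word_append[of "Suc 0" d "[False]"] by (simp add: add_outer_arc_def)
  have "spin_sum (word 0 (True # d @ [False])) s = 0" if "projected n k s" for s
  proof -
    let ?e = "True # d @ [False]"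
    let ?ys = "map (\<lambda>j. s (Suc j)) [0..<length d]"
    have len: "length ?e = 2 * (n + k)" using d(2) assms(3) by simp
    have "\<not> s 0" "\<not> s (Suc (length d))"
      using that len assms(3) by (auto simp: projected_def)
    moreover have "map s [0..<length ?e] = s 0 # ?ys @ [s (Suc (length d))]"
    proof -
      have "length ?e = Suc (Suc (length d))" by simp
      then show ?thesis by (simp only: map_upt_Suc[of s "Suc (length d)"]) simp
    qed
    moreover have "follow ?e (False # ?ys @ [False]) [] \<noteq> Some []"
    proof -
      have "follow d ?ys [True] = Some stk \<Longrightarrow> stk = [True]" for stk
        using follow_stack_length[of d ?ys "[True]" stk] dyck_append[of 0 d "[]"] d(1) by simp
      then show ?thesis
        by (cases "follow d ?ys [True]") (auto simp: follow_append)
    qed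
    moreover have "dyck 0 ?e" using d(1) dyck_append[of "Suc 0" d "[False]"] dyck_append[of 0 d "[]"] by simp
    ultimately show ?thesis by (metis (full_types) spin_sum_word_neq_0_iff)
  qed
  moreover have "word 0 d \<in> tangles n (k - 1)" using d by (intro word_tangles)
  ultimately show ?thesis
    using add_outer_arc_null_space[OF assms(3)] unfolding null_kernel_def eq by simp
qed

definition normal_words :: "nat \<Rightarrow> nat \<Rightarrow> tangle set" where
  "normal_words n k = {word 0 (replicate k True @ m @ replicate k False) | m.
     length m = 2 * n \<and> unmatched_closers m = k \<and> unmatched_openers m = k}"

text \<open>The letter before the first \<open>False\<close> can only be \<open>True\<close>, and
  there is one because a Dyck word does not begin with \<open>False\<close>. So an arc between
  neighbours lies inside the left projector.\<close>

lemma split_first_False: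
  assumes "dyck 0 d" "False \<in> set (take k d)"
  obtains d1 d2 where "d = d1 @ [True, False] @ d2" "length d1 + 1 < k"
proof -
  have "False \<in> set d" using assms(2) in_set_takeD by fast
  then obtain p q where d: "d = p @ False # q" "False \<notin> set p" by (meson split_list_first)
  have "length p < k"
  proof (rule ccontr)
    assume "\<not> length p < k"
    then have "take k d = take k p" using d(1) by simp
    then show False using assms(2) d(2) in_set_takeD by metis
  qed
  have "p \<noteq> []" using d assms(1) by auto
  then obtain p' x where p: "p = p' @ [x]" by (cases p rule: rev_cases) auto
  moreover have x using p d(2) by (cases x) auto
  ultimately show ?thesis using d \<open>length p < k\<close> that[of p' q] by simp
qed

lemma split_last_True:
  assumes "dyck 0 d" "True \<in> set (drop l d)"
  obtains d1 d2 where "d = d1 @ [True, False] @ d2" "l \<le> length d1"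
proof -
  have "True \<in> set d" using assms(2) in_set_dropD by fast
  then obtain p q where d: "d = p @ True # q" "True \<notin> set q" by (meson split_list_last)
  have "l \<le> length p"
  proof (rule ccontr)
    assume "\<not> l \<le> length p"
    then have "drop l d = drop (l - Suc (length p)) q" using d(1) by (simp add: drop_Cons')
    then show False using assms(2) d(2) in_set_dropD by metis
  qed
  have "q \<noteq> []" using d assms(1) dyck_append[of 0 p "[True]"] by auto
  then obtain y q' where q: "q = y # q'" by (cases q) auto
  moreover have "\<not> y" using q d(2) by (cases y) auto
  ultimately show ?thesis using d \<open>l \<le> length p\<close> that[of p q'] by simp
qed

lemma dyck_framed:
  "dyck 0 (replicate k True @ m @ replicate j False)
    \<longleftrightarrow> unmatched_closers m \<le> k \<and> k - unmatched_closers m + unmatched_openers m = j"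
  by (subst dyck_replicate_True) (simp add: dyck_append)

text \<open>A word that is not normal either has a \<open>False\<close> among the first k letters or
  a \<open>True\<close> among the last k, giving a turnback, or fewer than k arcs leave each
  projector towards the middle, and then the outermost endpoints are joined.\<close>

lemma word_normal_or_null:
  assumes d: "dyck 0 d" "length d = 2 * (n + k)" "word 0 d \<notin> normal_words n k"
  shows "basis (word 0 d) \<in> null_kernel \<kappa> n k"
proof (cases "False \<in> set (take k d)")
  case True
  then obtain d1 d2 where "d = d1 @ [True, False] @ d2" "length d1 + 1 < k"
    using split_first_False[OF d(1)] by blast
  then show ?thesis using turnback_null_kernel d(1,2) by blast
next
  case F: False
  show ?thesis
  proof (cases "True \<in> set (drop (2 * n + k) d)")
    case True
    then obtain d1 d2 where "d = d1 @ [True, False] @ d2" "2 * n + k \<le> length d1"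
      using split_last_True[OF d(1)] by blast
    then show ?thesis using turnback_null_kernel d(1,2) by blast
  next
    case T: False
    define m where "m = take (2 * n) (drop k d)"
    have l: "length m = 2 * n" using d(2) by (simp add: m_def)
    have "take k d = replicate k True"
      using F d(2) by (intro replicate_eqI) (simp, metis (full_types))
    moreover have "drop (2 * n + k) d = replicate k False"
      using T d(2) by (intro replicate_eqI) (simp, metis (full_types))
    moreover have "d = take k d @ m @ drop (2 * n + k) d"
      unfolding m_def by (metis append_take_drop_id drop_drop)
    ultimately have dm: "d = replicate k True @ m @ replicate k False" by simp
    have dy: "unmatched_closers m \<le> k" "k - unmatched_closers m + unmatched_openers m = k"
      using d(1) unfolding dm dyck_framed by simp_all
    have "unmatched_closers m \<noteq> k"
      using d(3) dy l unfolding normal_words_def dm by auto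
    then have lt: "unmatched_closers m < k" using dy by simp
    then have k: "k = Suc (k - 1)" by simp
    let ?e = "replicate (k - 1) True @ m @ replicate (k - 1) False"
    have "d = True # ?e @ [False]"
      unfolding dm by (subst (1 2) k) (simp add: replicate_append_same)
    \<comment> \<open>With fewer than k unmatched closers in \<open>m\<close>, the remaining k - 1
      openers on the left still suffice.\<close>
    moreover have "dyck 0 ?e" using dy lt unfolding dyck_framed by arith
    moreover have "length ?e = 2 * (n + (k - 1))" using l by simp
    ultimately show ?thesis using outer_word_null_kernel[of ?e n k] lt by simp
  qed
qed

lemma reduces_to_normal_words:
  assumes "w \<in> tangles n k"
  shows "\<exists>C \<in> free_on (normal_words n k). basis w - C \<in> null_kernel \<kappa> n k"
  using assms
proof (induction "length (filter (\<lambda>p. is_crossing (fst p)) w)" arbitrary: w)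
  case 0
  then have "\<forall>p\<in>set w. \<not> is_crossing (fst p)" by (simp add: filter_empty_conv)
  then obtain a d where d: "dyck 0 d" "length d = 2 * (n + k)"
      "basis w - smult a (basis (word 0 d)) \<in> null_kernel \<kappa> n k"
    using planar_to_word "0.prems" by blast
  show ?case
  proof (cases "word 0 d \<in> normal_words n k")
    case True
    then show ?thesis
      by (intro bexI[of _ "smult a (basis (word 0 d))"] d(3) free.subspace_scale[OF subspace_free_on] basis_free_on)
  next
    case False
    then have "basis (word 0 d) \<in> null_kernel \<kappa> n k" by (intro word_normal_or_null d)
    then have "smult a (basis (word 0 d)) \<in> null_kernel \<kappa> n k"
      by (rule free.subspace_scale[OF subspace_null_kernel])
    from free.subspace_add[OF subspace_null_kernel d(3) this] have "basis w - 0 \<in> null_kernel \<kappa> n k" by simp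
    then show ?thesis using free.subspace_0[OF subspace_free_on] by blast
  qed
next
  case (Suc c)
  then obtain p where "p \<in> set w" "is_crossing (fst p)"
    by (metis (mono_tags, lifting) filter_False length_0_conv nat.distinct(1))
  then obtain g i u v where w: "w = u @ [(g, i)] @ v" and g: "is_crossing g"
    by (metis append_Cons append_Nil fst_conv in_set_conv_decomp surj_pair)
  define w1 w2 where "w1 = u @ v" and "w2 = u @ [(Cap, i), (Cup, i)] @ v"
  have t: "w1 \<in> tangles n k" "w2 \<in> tangles n k"
    using Suc.prems g by (auto simp: w w1_def w2_def tangles_def from_to_append Suc_Suc_diff_2)
  have c: "c = length (filter (\<lambda>p. is_crossing (fst p)) w1)" "c = length (filter (\<lambda>p. is_crossing (fst p)) w2)"
    using Suc.hyps(2) g by (auto simp: w w1_def w2_def)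
  obtain C1 where C1: "C1 \<in> free_on (normal_words n k)" "basis w1 - C1 \<in> null_kernel \<kappa> n k"
    using Suc.hyps(1)[OF c(1) t(1)] by blast
  obtain C2 where C2: "C2 \<in> free_on (normal_words n k)" "basis w2 - C2 \<in> null_kernel \<kappa> n k"
    using Suc.hyps(1)[OF c(2) t(2)] by blast
  obtain a b where ab: "basis w - (smult a (basis w1) + smult b (basis w2)) \<in> null_kernel \<kappa> n k"
    using g crossing_NW_null_kernel[of u i v n k \<kappa>] crossing_NE_null_kernel[of u i v n k \<kappa>] Suc.prems
    unfolding w w1_def w2_def by (metis add.commute)
  have "basis w - (smult a C1 + smult b C2) = (basis w - (smult a (basis w1) + smult b (basis w2)))
     + (smult a (basis w1 - C1) + smult b (basis w2 - C2))"
    by (simp add: free.scale_right_diff_distrib algebra_simps)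
  also have "\<dots> \<in> null_kernel \<kappa> n k"
    by (intro subspace_null_kernel[THEN free.subspace_add] subspace_null_kernel[THEN free.subspace_scale] ab C1 C2)
  finally show ?case
    using subspace_free_on[THEN free.subspace_add] subspace_free_on[THEN free.subspace_scale] C1 C2 by blast
qed

text \<open>Triangularity: the test configuration comes from a word in the support whose
  \<open>lead\<close> has the largest moment. Any other word of the support that admits it would
  have a \<open>lead\<close> of larger moment, or the same \<open>lead\<close> and then the same
  middle part by \<open>decode_lead\<close>.\<close>

lemma normal_words_independent:
  assumes C: "C \<in> free_on (normal_words n k)" and zero: "\<And>s. projected n k s \<Longrightarrow> spin_eval C s = 0"
  shows "C = 0"
proof (rule ccontr)
  assume "C \<noteq> 0"
  let ?full = "\<lambda>m. replicate k True @ m @ replicate k False"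
  define M where "M = {m. word 0 (?full m) \<in> Poly_Mapping.keys C \<and>
     length m = 2 * n \<and> unmatched_closers m = k \<and> unmatched_openers m = k}"
  have keys: "Poly_Mapping.keys C = (\<lambda>m. word 0 (?full m)) ` M"
    using C unfolding free_on_def normal_words_def M_def by blast
  have inj: "inj_on (\<lambda>m. word 0 (?full m)) M"
  proof (rule inj_onI)
    fix m m' assume "m \<in> M" "m' \<in> M" "word 0 (?full m) = word 0 (?full m')"
    then have "?full m = ?full m'" by (intro word_inject) (auto simp: M_def)
    then show "m = m'" by simp
  qed
  have "finite M" using finite_imageD[OF _ inj] keys finite_keys by metis
  moreover have "M \<noteq> {}" using \<open>C \<noteq> 0\<close> keys by auto
  ultimately have "Max ((\<lambda>m. moment 0 (lead m)) ` M) \<in> (\<lambda>m. moment 0 (lead m)) ` M"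
    by (intro Max_in) auto
  then obtain m where m1: "m \<in> M" "moment 0 (lead m) = Max ((\<lambda>m. moment 0 (lead m)) ` M)" by auto
  have m: "m \<in> M" "\<And>m'. m' \<in> M \<Longrightarrow> moment 0 (lead m') \<le> moment 0 (lead m)"
    using \<open>finite M\<close> m1 by auto
  \<comment> \<open>Spins down in the projectors, the leading configuration of \<open>m\<close>
    between them.\<close>
  let ?ys = "replicate k False @ lead m @ replicate k False"
  define s where "s = append_config ?ys (\<lambda>_. False)"
  have len: "length ?ys = 2 * (n + k)" using m(1) by (simp add: M_def)
  have s: "map s [0..<length ?ys] = ?ys"
    unfolding s_def by (rule nth_equalityI) (auto simp: append_config_def simp del: upt_Suc)
  have "projected n k s"
    using m(1) unfolding s_def projected_def append_config_def M_def by (auto simp: nth_append)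
  have full: "follow (?full m') ?ys [] = Option.bind (follow m' (lead m) (replicate k True)) (follow (replicate k False) (replicate k False))"
    if "m' \<in> M" for m'
  proof -
    have "follow (replicate j True) (replicate j False) stk = Some (replicate j True @ stk)" for j stk
      by (induction j arbitrary: stk) (simp_all add: replicate_app_Cons_same)
    then show ?thesis using that m(1) by (simp add: follow_append M_def)
  qed
  have closing: "follow (replicate j False) (replicate j False) stk = Some [] \<longleftrightarrow> stk = replicate j False" for j stk
  proof (induction j arbitrary: stk)
    case (Suc j)
    then show ?case by (cases stk) auto
  qed auto
  have dy: "dyck 0 (?full m')" if "m' \<in> M" for m'
    using that unfolding dyck_framed by (auto simp: M_def)
  have iff: "spin_sum (word 0 (?full m')) s \<noteq> 0 \<longleftrightarrow> follow m' (lead m) (replicate k True) = Some (replicate k False)"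
    if "m' \<in> M" for m'
  proof -
    have "length (?full m') = length ?ys" using that m(1) by (simp add: M_def)
    then show ?thesis
      unfolding spin_sum_word_neq_0_iff[OF dy[OF that]] using s full[OF that] closing
      by (cases "follow m' (lead m) (replicate k True)") auto
  qed
  have others: "spin_sum (word 0 (?full m')) s = 0" if "m' \<in> M" "m' \<noteq> m" for m'
  proof (rule ccontr)
    assume "spin_sum (word 0 (?full m')) s \<noteq> 0"
    then have "follow m' (lead m) (replicate k True) = Some (replicate k False)" using iff that by blast
    from moment_less[OF this, of 0] have "lead m = lead m' \<or> moment 0 (lead m) < moment 0 (lead m')"
      by auto
    then have "lead m = lead m'" using m(2)[OF that(1)] by auto
    then have "m = m'" using decode_lead[of m] decode_lead[of m'] m(1) that(1) by (simp add: M_def)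
    then show False using that by simp
  qed
  have self: "spin_sum (word 0 (?full m)) s \<noteq> 0"
  proof -
    have k: "unmatched_closers m = k" "unmatched_openers m = k" using m(1) by (auto simp: M_def)
    obtain stk where stk: "follow m (lead m) (replicate k True) = Some stk" "True \<notin> set stk"
      using follow_lead[of m "replicate k True"] k by auto
    have "dyck (length stk) (replicate k False)"
      using follow_dyck[OF stk(1), of "replicate k False"] k by (simp add: dyck_append)
    then have "stk = replicate k False"
      using stk(2) by (intro replicate_eqI) (simp, metis (full_types))
    then show ?thesis using iff[OF m(1)] stk by simp
  qed
  have "spin_eval C s = (\<Sum>m'\<in>M. Poly_Mapping.lookup C (word 0 (?full m')) * spin_sum (word 0 (?full m')) s)"
    unfolding spin_eval_def keys by (subst sum.reindex[OF inj]) simp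
  also have "\<dots> = (\<Sum>m'\<in>{m}. Poly_Mapping.lookup C (word 0 (?full m')) * spin_sum (word 0 (?full m')) s)"
    using \<open>finite M\<close> m(1) others by (intro sum.mono_neutral_right) auto
  finally have "Poly_Mapping.lookup C (word 0 (?full m)) = 0"
    using zero[OF \<open>projected n k s\<close>] self by simp
  then show False using m(1) by (simp add: M_def in_keys_iff)
qed

theorem null_space_criterion:
  assumes E: "E \<in> free_on (tangles n k)" and zero: "\<And>s. projected n k s \<Longrightarrow> spin_eval E s = 0"
  shows "E \<in> null_space \<kappa> n k"
proof -
  let ?V = "{E. \<exists>C \<in> free_on (normal_words n k). E - C \<in> null_kernel \<kappa> n k}"
  have V: "free.subspace ?V"
  proof (rule free.subspaceI)
    show "0 \<in> ?V"
      using subspace_free_on[THEN free.subspace_0] subspace_null_kernel[THEN free.subspace_0]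
      by (auto intro!: bexI[of _ 0])
    show "x + y \<in> ?V" if xy: "x \<in> ?V" "y \<in> ?V" for x y
    proof -
      obtain C D where CD: "C \<in> free_on (normal_words n k)" "x - C \<in> null_kernel \<kappa> n k"
        "D \<in> free_on (normal_words n k)" "y - D \<in> null_kernel \<kappa> n k" using xy by blast
      have "x + y - (C + D) = (x - C) + (y - D)" by simp
      also have "\<dots> \<in> null_kernel \<kappa> n k" by (intro subspace_null_kernel[THEN free.subspace_add] CD)
      finally show ?thesis using CD subspace_free_on[THEN free.subspace_add] by blast
    qed
    show "smult c x \<in> ?V" if x: "x \<in> ?V" for c x
    proof -
      obtain C where C: "C \<in> free_on (normal_words n k)" "x - C \<in> null_kernel \<kappa> n k" using x by blast
      have "smult c x - smult c C = smult c (x - C)" by (simp add: free.scale_right_diff_distrib)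
      also have "\<dots> \<in> null_kernel \<kappa> n k" by (intro subspace_null_kernel[THEN free.subspace_scale] C)
      finally show ?thesis using C subspace_free_on[THEN free.subspace_scale] by blast
    qed
  qed
  have "(\<Sum>w\<in>Poly_Mapping.keys E. smult (Poly_Mapping.lookup E w) (basis w)) \<in> ?V"
  proof (intro free.subspace_sum[OF V] free.subspace_scale[OF V])
    fix w assume "w \<in> Poly_Mapping.keys E"
    then show "basis w \<in> ?V" using E reduces_to_normal_words[of w n k \<kappa>] by (auto simp: free_on_def)
  qed
  then obtain C where C: "C \<in> free_on (normal_words n k)" "E - C \<in> null_kernel \<kappa> n k"
    unfolding sum_basis by blast
  have "spin_eval C s = 0" if "projected n k s" for s
    using C(2) that zero[OF that] by (auto simp: null_kernel_def spin_eval_diff)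
  then have "C = 0" by (rule normal_words_independent[OF C(1)])
  then show ?thesis using C(2) by (simp add: null_kernel_def)
qed


section \<open>The polynomial of a dotted diagram\<close>

text \<open>The part of \<open>crossingless_matching\<close> that does not refer to the range of the
  endpoints. The range is supplied by \<open>covered\<close>, which can be stated for any half-open
  interval and so supports induction on intervals.\<close>

definition noncrossing :: "arc set \<Rightarrow> bool" where
  "noncrossing M \<longleftrightarrow> (\<forall>(a, b)\<in>M. a < b)
     \<and> (\<forall>e\<in>M. \<forall>e'\<in>M. e \<noteq> e' \<longrightarrow> fst e \<noteq> fst e' \<and> fst e \<noteq> snd e' \<and> snd e \<noteq> snd e')
     \<and> (\<forall>(a, b)\<in>M. \<forall>(c, d)\<in>M. \<not> (a < c \<and> c < b \<and> b < d))"

definition covered :: "arc set \<Rightarrow> nat \<Rightarrow> nat \<Rightarrow> bool" where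
  "covered M l r \<longleftrightarrow> (\<forall>p\<in>{l..<r}. \<exists>e\<in>M. (p = fst e \<or> p = snd e) \<and> l \<le> fst e \<and> snd e < r)"

lemma noncrossing_less: "noncrossing M \<Longrightarrow> (a, b) \<in> M \<Longrightarrow> a < b"
  by (auto simp: noncrossing_def)

lemma noncrossing_distinct:
  "noncrossing M \<Longrightarrow> (a, b) \<in> M \<Longrightarrow> (c, d) \<in> M \<Longrightarrow> (a, b) \<noteq> (c, d) \<Longrightarrow>
   a \<noteq> c \<and> a \<noteq> d \<and> b \<noteq> c \<and> b \<noteq> d"
  unfolding noncrossing_def by (metis fst_conv snd_conv)

lemma noncrossing_no_cross:
  "noncrossing M \<Longrightarrow> (a, b) \<in> M \<Longrightarrow> (c, d) \<in> M \<Longrightarrow> a < c \<Longrightarrow> c < b \<Longrightarrow> d < b"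
  using noncrossing_distinct[of M a b c d] unfolding noncrossing_def by fastforce

lemma coveredE:
  assumes "covered M l r" "l \<le> p" "p < r"
  obtains x y where "(x, y) \<in> M" "p = x \<or> p = y" "l \<le> x" "y < r"
  using assms unfolding covered_def by (metis atLeastLessThan_iff fst_conv prod.collapse snd_conv)

lemma coveredI:
  assumes "\<And>p. l \<le> p \<Longrightarrow> p < r \<Longrightarrow> \<exists>x y. (x, y) \<in> M \<and> (p = x \<or> p = y) \<and> l \<le> x \<and> y < r"
  shows "covered M l r"
  unfolding covered_def
proof
  fix p assume "p \<in> {l..<r}"
  then obtain x y where "(x, y) \<in> M" "p = x \<or> p = y" "l \<le> x" "y < r"
    using assms[of p] by auto
  then show "\<exists>e\<in>M. (p = fst e \<or> p = snd e) \<and> l \<le> fst e \<and> snd e < r"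
    by (intro bexI[of _ "(x, y)"]) auto
qed

lemma covered_mono: "covered M l r \<Longrightarrow> M \<subseteq> M' \<Longrightarrow> covered M' l r"
  unfolding covered_def by blast

lemma covered_inside:
  assumes "noncrossing M" "covered M L R" "(x, y) \<in> M" "L \<le> x" "y < R"
  shows "covered M (Suc x) y"
proof (rule coveredI)
  fix p assume p: "Suc x \<le> p" "p < y"
  then obtain u v where uv: "(u, v) \<in> M" "p = u \<or> p = v"
    using assms by (auto elim: coveredE[of M L R p])
  have ne: "(u, v) \<noteq> (x, y)" using uv p by auto
  note d = noncrossing_distinct[OF assms(1,3) uv(1) ne[symmetric]] and less = noncrossing_less[OF assms(1) uv(1)]
  have "x < u"
  proof (rule ccontr)
    assume "\<not> x < u"
    then have "u < x" using d by simp
    moreover have "x < v" using uv(2) p \<open>u < x\<close> by auto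
    ultimately have "y < v" by (rule noncrossing_no_cross[OF assms(1) uv(1) assms(3)])
    then show False using uv(2) p \<open>u < x\<close> by auto
  qed
  moreover have "v < y"
    using noncrossing_no_cross[OF assms(1,3) uv(1) calculation] uv(2) p less by auto
  ultimately show "\<exists>u v. (u, v) \<in> M \<and> (p = u \<or> p = v) \<and> Suc x \<le> u \<and> v < y"
    using uv(1,2) by (intro exI[of _ u] exI[of _ v]) simp
qed

lemma covered_first:
  assumes "noncrossing M" "covered M l r" "l < r"
  obtains m where "(l, m) \<in> M" "l < m" "m < r" "covered M (Suc l) m" "covered M (Suc m) r"
proof -
  obtain x m where xm: "(x, m) \<in> M" "l = x \<or> l = m" "l \<le> x" "m < r"
    using assms by (auto elim: coveredE[of M l r l])
  then have l: "x = l" "l < m" using noncrossing_less[OF assms(1) xm(1)] by auto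
  have "covered M (Suc m) r"
  proof (rule coveredI)
    fix p assume p: "Suc m \<le> p" "p < r"
    then obtain u v where uv: "(u, v) \<in> M" "p = u \<or> p = v" "l \<le> u" "v < r"
      using assms l by (auto elim: coveredE[of M l r p])
    have ne: "(u, v) \<noteq> (l, m)" using uv p l by auto
    note d = noncrossing_distinct[OF assms(1) xm(1)[unfolded l] uv(1) ne[symmetric]] and less = noncrossing_less[OF assms(1) uv(1)]
    have "m < u"
    proof (rule ccontr)
      assume "\<not> m < u"
      then have "l < u" "u < m" using d uv by auto
      from noncrossing_no_cross[OF assms(1) xm(1)[unfolded l] uv(1) this] show False using uv p \<open>u < m\<close> by auto
    qed
    then show "\<exists>u v. (u, v) \<in> M \<and> (p = u \<or> p = v) \<and> Suc m \<le> u \<and> v < r"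
      using uv by (intro exI[of _ u] exI[of _ v]) simp
  qed
  then show ?thesis using that[of m] xm l covered_inside[OF assms(1,2) xm(1)] by auto
qed

text \<open>First-return decomposition: the arc starting at \<open>l\<close> cuts the interval into
  its inside and what follows it, both again matched within themselves.\<close>

lemma interval_induct [consumes 2, case_names empty arc]:
  assumes "noncrossing M" "covered M l r"
    and empty: "\<And>l r. \<not> l < r \<Longrightarrow> P l r"
    and arc: "\<And>l m r. (l, m) \<in> M \<Longrightarrow> l < m \<Longrightarrow> m < r \<Longrightarrow> covered M (Suc l) m \<Longrightarrow> covered M (Suc m) r \<Longrightarrow>
       P (Suc l) m \<Longrightarrow> P (Suc m) r \<Longrightarrow> P l r"
  shows "P l r"
  using assms(2)
proof (induction "r - l" arbitrary: l r rule: less_induct)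
  case less
  show ?case
  proof (cases "l < r")
    case True
    obtain m where m: "(l, m) \<in> M" "l < m" "m < r" "covered M (Suc l) m" "covered M (Suc m) r"
      using covered_first[OF assms(1) less.prems True] by blast
    show ?thesis using m by (intro arc[OF m] less.hyps) auto
  qed (rule empty)
qed

text \<open>The guard on \<open>m\<close> makes the recursion terminate for arbitrary sets of arcs;
  the value 0 is a default for intervals in which no arc starting at \<open>l\<close> ends. Blocks
  side by side multiply, and an arc around a block acts by \<open>node\<close>.\<close>

function arc_poly :: "arc set \<Rightarrow> arc set \<Rightarrow> config \<Rightarrow> nat \<Rightarrow> nat \<Rightarrow> laurent poly" where
  "arc_poly U D s l r = (if l < r then
     (let m = THE m. (l, m) \<in> U \<union> D in
      if l < m \<and> m < r then
        node ((l, m) \<in> D) (s l) (s m) (arc_poly U D s (Suc l) m) * arc_poly U D s (Suc m) r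
      else 0) else 1)"
  by auto
termination
  by (relation "measure (\<lambda>(U, D, s, l, r). r - l)") auto

declare arc_poly.simps [simp del]

lemma arc_poly_empty [simp]: "\<not> l < r \<Longrightarrow> arc_poly U D s l r = 1"
  by (simp add: arc_poly.simps[of U D s l r])

lemma arc_poly_arc:
  assumes "noncrossing (U \<union> D)" "(l, m) \<in> U \<union> D" "m < r"
  shows "arc_poly U D s l r =
    node ((l, m) \<in> D) (s l) (s m) (arc_poly U D s (Suc l) m) * arc_poly U D s (Suc m) r"
proof -
  have "(THE m. (l, m) \<in> U \<union> D) = m"
    using assms(2) noncrossing_distinct[OF assms(1)] by (intro the_equality) blast+
  moreover have "l < m" using noncrossing_less assms by blast
  ultimately show ?thesis using assms(3) by (simp add: arc_poly.simps[of U D s l r] Let_def)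
qed

lemma arc_poly_arc_dot:
  assumes "noncrossing (U \<union> D)" "x \<in> U" "(l, m) \<in> U \<union> D" "m < r"
  shows "arc_poly (U - {x}) (insert x D) s l r = node ((l, m) \<in> insert x D) (s l) (s m)
    (arc_poly (U - {x}) (insert x D) s (Suc l) m) * arc_poly (U - {x}) (insert x D) s (Suc m) r"
proof -
  have "U - {x} \<union> insert x D = U \<union> D" using assms(2) by auto
  then show ?thesis using assms arc_poly_arc[of "U - {x}" "insert x D" l m r s] by simp
qed

lemma arc_poly_cong:
  assumes "\<And>a b. l \<le> a \<Longrightarrow> a < r \<Longrightarrow> ((a, b) \<in> U \<longleftrightarrow> (a, b) \<in> U') \<and> ((a, b) \<in> D \<longleftrightarrow> (a, b) \<in> D')"
  shows "arc_poly U D s l r = arc_poly U' D' s l r"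
  using assms
proof (induction U D s l r rule: arc_poly.induct)
  case (1 U D s l r)
  show ?case
  proof (cases "l < r")
    case True
    define m where "m = (THE m. (l, m) \<in> U \<union> D)"
    have "(\<lambda>m. (l, m) \<in> U' \<union> D') = (\<lambda>m. (l, m) \<in> U \<union> D)"
      using True "1.prems"[of l] by auto
    then have m': "(THE m. (l, m) \<in> U' \<union> D') = m" by (simp only: m_def)
    have m'': "(THE m. (l, m) \<in> U \<or> (l, m) \<in> D) = m" by (simp add: m_def)
    show ?thesis
    proof (cases "l < m \<and> m < r")
      case m: True
      have "arc_poly U D s (Suc l) m = arc_poly U' D' s (Suc l) m"
        by (rule "1.IH"(1)[OF True m_def m]) (use "1.prems" m in auto)
      moreover have "arc_poly U D s (Suc m) r = arc_poly U' D' s (Suc m) r"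
        by (rule "1.IH"(2)[OF True m_def m]) (use "1.prems" m in auto)
      moreover have "(l, m) \<in> D \<longleftrightarrow> (l, m) \<in> D'" using "1.prems"[of l] True by auto
      ultimately show ?thesis
        using True m m' by (simp add: arc_poly.simps[of _ _ _ l r] m'')
    next
      case False
      then show ?thesis using True m' by (auto simp add: arc_poly.simps[of _ _ _ l r] m'')
    qed
  qed simp
qed

lemma arc_poly_split:
  assumes "noncrossing (U \<union> D)" "covered (U \<union> D) l m" "l \<le> m" "m \<le> r"
  shows "arc_poly U D s l r = arc_poly U D s l m * arc_poly U D s m r"
proof -
  have "l \<le> m \<longrightarrow> m \<le> r \<longrightarrow> arc_poly U D s l r = arc_poly U D s l m * arc_poly U D s m r"
    using assms(1,2)
  proof (induction rule: interval_induct)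
    case (empty l m)
    then show ?case by auto
  next
    case (arc l x m)
    then show ?case by (simp add: arc_poly_arc[OF assms(1) arc(1)] mult.assoc)
  qed
  then show ?thesis using assms by blast
qed

text \<open>Outside the block from \<open>a\<close> to \<open>d\<close> the function
  \<open>L\<close> obeys the recursion of \<open>arc_poly U D s\<close>; inside it is unconstrained.
  The conditions are linear in \<open>L\<close>, so they hold for combinations of the polynomials of
  diagrams that differ only in the block.\<close>

definition compatible :: "arc set \<Rightarrow> arc set \<Rightarrow> config \<Rightarrow> nat \<Rightarrow> nat \<Rightarrow> (nat \<Rightarrow> nat \<Rightarrow> laurent poly) \<Rightarrow> bool" where
  "compatible U D s a d L \<longleftrightarrow>
     (\<forall>r>d. L a r = L a (Suc d) * arc_poly U D s (Suc d) r)
     \<and> (\<forall>l m r. (l, m) \<in> U \<union> D \<and> m < a \<and> m < r \<longrightarrow>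
          L l r = node ((l, m) \<in> D) (s l) (s m) (arc_poly U D s (Suc l) m) * L (Suc m) r)
     \<and> (\<forall>l m r. (l, m) \<in> U \<union> D \<and> l < a \<and> d < m \<and> m < r \<longrightarrow>
          L l r = node ((l, m) \<in> D) (s l) (s m) (L (Suc l) m) * arc_poly U D s (Suc m) r)"

lemma compatibleD:
  assumes "compatible U D s a d L"
  shows "d < r \<Longrightarrow> L a r = L a (Suc d) * arc_poly U D s (Suc d) r"
    and "(l, m) \<in> U \<union> D \<Longrightarrow> m < a \<Longrightarrow> m < r \<Longrightarrow>
          L l r = node ((l, m) \<in> D) (s l) (s m) (arc_poly U D s (Suc l) m) * L (Suc m) r"
    and "(l, m) \<in> U \<union> D \<Longrightarrow> l < a \<Longrightarrow> d < m \<Longrightarrow> m < r \<Longrightarrow>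
          L l r = node ((l, m) \<in> D) (s l) (s m) (L (Suc l) m) * arc_poly U D s (Suc m) r"
  using assms unfolding compatible_def by blast+

lemma compatible_add:
  assumes "compatible U D s a d L" "compatible U D s a d L'"
  shows "compatible U D s a d (\<lambda>l r. L l r + L' l r)"
  unfolding compatible_def
proof (intro conjI allI impI)
  fix r assume "d < r"
  then have "L a r = L a (Suc d) * arc_poly U D s (Suc d) r" "L' a r = L' a (Suc d) * arc_poly U D s (Suc d) r"
    by (rule assms[THEN compatibleD(1)])+
  then show "L a r + L' a r = (L a (Suc d) + L' a (Suc d)) * arc_poly U D s (Suc d) r"
    by (simp only: distrib_right)
next
  fix l m r assume "(l, m) \<in> U \<union> D \<and> m < a \<and> m < r"
  then have "L l r = node ((l, m) \<in> D) (s l) (s m) (arc_poly U D s (Suc l) m) * L (Suc m) r"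
    "L' l r = node ((l, m) \<in> D) (s l) (s m) (arc_poly U D s (Suc l) m) * L' (Suc m) r"
    by (auto intro!: assms[THEN compatibleD(2)])
  then show "L l r + L' l r = node ((l, m) \<in> D) (s l) (s m) (arc_poly U D s (Suc l) m) * (L (Suc m) r + L' (Suc m) r)"
    by (simp only: distrib_left)
next
  fix l m r assume "(l, m) \<in> U \<union> D \<and> l < a \<and> d < m \<and> m < r"
  then have "L l r = node ((l, m) \<in> D) (s l) (s m) (L (Suc l) m) * arc_poly U D s (Suc m) r"
    "L' l r = node ((l, m) \<in> D) (s l) (s m) (L' (Suc l) m) * arc_poly U D s (Suc m) r"
    by (auto intro!: assms[THEN compatibleD(3)])
  then show "L l r + L' l r = node ((l, m) \<in> D) (s l) (s m) (L (Suc l) m + L' (Suc l) m) * arc_poly U D s (Suc m) r"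
    by (simp only: distrib_right node_add)
qed

lemma compatible_const_mult:
  assumes "compatible U D s a d L"
  shows "compatible U D s a d (\<lambda>l r. [:c:] * L l r)"
  unfolding compatible_def
proof (intro conjI allI impI)
  fix r assume "d < r"
  then have "L a r = L a (Suc d) * arc_poly U D s (Suc d) r"
    by (rule assms[THEN compatibleD(1)])
  then show "[:c:] * L a r = [:c:] * L a (Suc d) * arc_poly U D s (Suc d) r"
    by (simp only: mult.assoc)
next
  fix l m r assume "(l, m) \<in> U \<union> D \<and> m < a \<and> m < r"
  then have "L l r = node ((l, m) \<in> D) (s l) (s m) (arc_poly U D s (Suc l) m) * L (Suc m) r"
    by (auto intro!: assms[THEN compatibleD(2)])
  then show "[:c:] * L l r = node ((l, m) \<in> D) (s l) (s m) (arc_poly U D s (Suc l) m) * ([:c:] * L (Suc m) r)"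
    by (simp only: mult.left_commute)
next
  fix l m r assume "(l, m) \<in> U \<union> D \<and> l < a \<and> d < m \<and> m < r"
  then have "L l r = node ((l, m) \<in> D) (s l) (s m) (L (Suc l) m) * arc_poly U D s (Suc m) r"
    by (auto intro!: assms[THEN compatibleD(3)])
  then show "[:c:] * L l r = node ((l, m) \<in> D) (s l) (s m) ([:c:] * L (Suc l) m) * arc_poly U D s (Suc m) r"
    by (simp only: mult.assoc node_const_mult)
qed

lemma compatible_arc_poly:
  assumes nc: "noncrossing (U \<union> D)" "noncrossing (U' \<union> D')"
    and cov: "covered (U' \<union> D') a (Suc d)" and "a \<le> d"
    and agree: "\<And>x y. x < a \<or> d < x \<Longrightarrow> ((x, y) \<in> U \<longleftrightarrow> (x, y) \<in> U') \<and> ((x, y) \<in> D \<longleftrightarrow> (x, y) \<in> D')"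
  shows "compatible U D s a d (arc_poly U' D' s)"
  unfolding compatible_def
proof (intro conjI allI impI)
  fix r assume "d < r"
  have "arc_poly U' D' s (Suc d) r = arc_poly U D s (Suc d) r"
    by (rule arc_poly_cong) (use agree in auto)
  then show "arc_poly U' D' s a r = arc_poly U' D' s a (Suc d) * arc_poly U D s (Suc d) r"
    using arc_poly_split[OF nc(2) cov, of r s] \<open>a \<le> d\<close> \<open>d < r\<close> by simp
next
  fix l m r assume lm: "(l, m) \<in> U \<union> D \<and> m < a \<and> m < r"
  then have "l < m" using noncrossing_less nc by blast
  then have "(l, m) \<in> U' \<union> D'" "(l, m) \<in> D \<longleftrightarrow> (l, m) \<in> D'" using lm agree[of l m] by auto
  moreover have "arc_poly U D s (Suc l) m = arc_poly U' D' s (Suc l) m"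
    by (rule arc_poly_cong) (use agree lm in auto)
  ultimately show "arc_poly U' D' s l r
      = node ((l, m) \<in> D) (s l) (s m) (arc_poly U D s (Suc l) m) * arc_poly U' D' s (Suc m) r"
    using arc_poly_arc[OF nc(2), of l m r s] lm by simp
next
  fix l m r assume lm: "(l, m) \<in> U \<union> D \<and> l < a \<and> d < m \<and> m < r"
  then have "(l, m) \<in> U' \<union> D'" "(l, m) \<in> D \<longleftrightarrow> (l, m) \<in> D'" using agree[of l m] by auto
  moreover have "arc_poly U D s (Suc m) r = arc_poly U' D' s (Suc m) r"
    by (rule arc_poly_cong) (use agree lm in auto)
  ultimately show "arc_poly U' D' s l r
      = node ((l, m) \<in> D) (s l) (s m) (arc_poly U' D' s (Suc l) m) * arc_poly U D s (Suc m) r"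
    using arc_poly_arc[OF nc(2), of l m r s] lm by simp
qed

text \<open>The cardinalities of these sets are the exponents collected on the way out. For the
  interval inside an enclosing arc x they become \<open>depth\<close> minus one and
  \<open>dots_between\<close>.\<close>

definition around :: "arc set \<Rightarrow> nat \<Rightarrow> nat \<Rightarrow> nat \<Rightarrow> nat \<Rightarrow> arc set" where
  "around U a d l r = {x \<in> U. nested (a, d) x \<and> l \<le> fst x \<and> snd x < r}"

lemma node_sum: "finite I \<Longrightarrow> node \<delta> x y (\<Sum>i\<in>I. f i) = (\<Sum>i\<in>I. node \<delta> x y (f i))"
  by (induction I rule: finite_induct) (simp_all add: node_add)

text \<open>
  Multiplication by the variable at the place \<open>[a, d]\<close> moves outwards through a dotted arc
  at the cost of a power of \<open>q\<close>, and through an undotted arc at the cost of an additional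
  term in which that arc is dotted.
\<close>

lemma var_moves_outwards:
  assumes nc: "noncrossing (U \<union> D)" and fin: "finite U" "finite D" and disj: "U \<inter> D = {}"
    and cov: "covered (U \<union> D) l r" and bl: "covered (U \<union> D) a (Suc d)" and "a \<le> d"
    and comp: "compatible U D s a d L"
    and base: "L a (Suc d) = [:\<gamma>:] * var * arc_poly U D s a (Suc d)"
    and "l \<le> a" "d < r"
  shows "L l r = (\<Sum>x\<in>around U a d l r.
        [:\<gamma> * hpow (2 * int (card (around U a d (Suc (fst x)) (snd x))) - 1
             - 2 * int (card (around D a d (Suc (fst x)) (snd x)))):]
          * arc_poly (U - {x}) (insert x D) s l r)
     + [:\<gamma> * hpow (2 * int (card (around U a d l r)) - 2 * int (card (around D a d l r))):]
          * var * arc_poly U D s l r"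
proof -
  \<comment> \<open>The variable gains q at each undotted arc and q^(-1) at each dotted arc that it
    has left. The coefficient \<open>?cx\<close> belongs to the term in which x is dotted: the
    powers collected strictly inside x, times the q^(-1/2) of
    \<open>node_undotted_var\<close>.\<close>
  let ?co = "\<lambda>l r. \<gamma> * hpow (2 * int (card (around U a d l r)) - 2 * int (card (around D a d l r)))"
  let ?cx = "\<lambda>x. \<gamma> * hpow (2 * int (card (around U a d (Suc (fst x)) (snd x))) - 1
             - 2 * int (card (around D a d (Suc (fst x)) (snd x))))"
  let ?X = "\<lambda>x. arc_poly (U - {x}) (insert x D) s"
  let ?R = "\<lambda>l r. (\<Sum>x\<in>around U a d l r. [:?cx x:] * ?X x l r) + [:?co l r:] * var * arc_poly U D s l r"
  have finA: "finite (around V a d l r)" if "finite V" for V l r using that by (simp add: around_def)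
  have "l \<le> a \<longrightarrow> d < r \<longrightarrow> L l r = ?R l r"
    using nc cov
  proof (induction rule: interval_induct)
    case (empty l r)
    then show ?case using \<open>a \<le> d\<close> by simp
  next
    case (arc l m r)
    show ?case
    proof (intro impI)
      assume l: "l \<le> a" and r: "d < r"
      show "L l r = ?R l r"
      proof (cases "l = a")
        case True
        have "around V a d a r = {}" for V by (auto simp: around_def nested_def)
        moreover have "L a r = L a (Suc d) * arc_poly U D s (Suc d) r"
          using compatibleD(1)[OF comp r] .
        moreover have "arc_poly U D s a r = arc_poly U D s a (Suc d) * arc_poly U D s (Suc d) r"
          using \<open>a \<le> d\<close> r by (intro arc_poly_split nc bl) auto
        ultimately show ?thesis using True base by (simp add: mult.assoc)
      next
        case False
        then have la: "l < a" using l by simp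
        \<comment> \<open>The block is matched within itself, so an arc starting before it cannot
          end in it.\<close>
        have "m < a \<or> d < m"
        proof (rule ccontr)
          assume "\<not> (m < a \<or> d < m)"
          then have "a \<le> m" "m < Suc d" by auto
          then obtain x y where xy: "(x, y) \<in> U \<union> D" "m = x \<or> m = y" "a \<le> x" "y < Suc d"
            by (rule coveredE[OF bl])
          then have "(l, m) \<noteq> (x, y)" using la by auto
          from noncrossing_distinct[OF nc arc(1) xy(1) this] show False using xy(2) by blast
        qed
        then show ?thesis
        proof
          \<comment> \<open>An arc beside the block is a common factor of all terms, and no
            enclosing arc starts before its end.\<close>
          assume ma: "m < a"
          have ar: "around V a d l r = around V a d (Suc m) r" if "V \<subseteq> U \<union> D" for V
          proof -
            have "Suc m \<le> fst x" if "x \<in> V" "nested (a, d) x" "l \<le> fst x" for x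
            proof -
              obtain u v where x: "x = (u, v)" by (cases x)
              have uv: "(u, v) \<in> U \<union> D" "u < a" "d < v" "l \<le> u"
                using that \<open>V \<subseteq> U \<union> D\<close> by (auto simp: x nested_def)
              have "(u, v) \<noteq> (l, m)" using uv ma \<open>a \<le> d\<close> by auto
              from noncrossing_distinct[OF nc arc(1) uv(1) this[symmetric]]
              have "l < u" "u \<noteq> m" using uv by auto
              have "\<not> u < m"
              proof
                assume "u < m"
                from noncrossing_no_cross[OF nc arc(1) uv(1) \<open>l < u\<close> this] show False
                  using uv ma \<open>a \<le> d\<close> by simp
              qed
              then show ?thesis using x \<open>u \<noteq> m\<close> by simp
            qed
            then show ?thesis using arc(2) by (auto simp: around_def)
          qed
          let ?N = "node ((l, m) \<in> D) (s l) (s m) (arc_poly U D s (Suc l) m)"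
          have "L l r = ?N * L (Suc m) r"
            using compatibleD(2)[OF comp arc(1) ma arc(3)] .
          also have "L (Suc m) r = ?R (Suc m) r" using arc ma r by simp
          also have "?N * ?R (Suc m) r = (\<Sum>x\<in>around U a d l r. [:?cx x:] * (?N * ?X x (Suc m) r))
              + [:?co l r:] * var * (?N * arc_poly U D s (Suc m) r)"
            using ar[of U] ar[of D] by (simp only: Un_upper1 Un_upper2 sum_distrib_left distrib_left mult.left_commute)
          also have "?N * arc_poly U D s (Suc m) r = arc_poly U D s l r"
            using arc_poly_arc[OF nc arc(1) arc(3)] by simp
          also have "(\<Sum>x\<in>around U a d l r. [:?cx x:] * (?N * ?X x (Suc m) r))
            = (\<Sum>x\<in>around U a d l r. [:?cx x:] * ?X x l r)"
          proof (rule sum.cong[OF refl])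
            fix x assume x: "x \<in> around U a d l r"
            then have xU: "x \<in> U" "Suc m \<le> fst x" using ar[of U] by (auto simp: around_def)
            have "?X x l r = node ((l, m) \<in> insert x D) (s l) (s m) (?X x (Suc l) m) * ?X x (Suc m) r"
              by (rule arc_poly_arc_dot[OF nc xU(1) arc(1) arc(3)])
            moreover have "?X x (Suc l) m = arc_poly U D s (Suc l) m"
              by (rule arc_poly_cong) (use xU in auto)
            moreover have "(l, m) \<in> insert x D \<longleftrightarrow> (l, m) \<in> D" using xU arc by auto
            ultimately show "[:?cx x:] * (?N * ?X x (Suc m) r) = [:?cx x:] * ?X x l r" by simp
          qed
          finally show ?thesis .
        next
          \<comment> \<open>The variable has to leave the arc (l, m). If the arc is undotted, the
            correction term is the new summand for x = (l, m); the earlier summands pass through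
            \<open>node\<close> by linearity.\<close>
          assume dm: "d < m"
          let ?\<delta> = "(l, m) \<in> D"
          let ?T = "arc_poly U D s (Suc m) r"
          have ar: "around V a d l r = (if (l, m) \<in> V then insert (l, m) (around V a d (Suc l) m) else around V a d (Suc l) m)"
            if "V \<subseteq> U \<union> D" for V
          proof -
            have key: "Suc l \<le> fst x \<and> snd x < m" if "x \<in> V" "nested (a, d) x" "l \<le> fst x" "x \<noteq> (l, m)" for x
            proof -
              obtain u v where x: "x = (u, v)" by (cases x)
              have uv: "(u, v) \<in> U \<union> D" "u < a" "d < v" "l \<le> u"
                using that \<open>V \<subseteq> U \<union> D\<close> by (auto simp: x nested_def)
              have "(l, m) \<noteq> (u, v)" using that x by auto
              from noncrossing_distinct[OF nc arc(1) uv(1) this]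
              have "l < u" using uv by simp
              moreover have "u < m" using uv dm \<open>a \<le> d\<close> by simp
              ultimately have "v < m" by (rule noncrossing_no_cross[OF nc arc(1) uv(1)])
              then show ?thesis using x \<open>l < u\<close> by simp
            qed
            show ?thesis
            proof (rule set_eqI)
              fix x
              show "x \<in> around V a d l r \<longleftrightarrow>
                x \<in> (if (l, m) \<in> V then insert (l, m) (around V a d (Suc l) m) else around V a d (Suc l) m)"
              proof (cases "x = (l, m)")
                case True
                then show ?thesis using arc(2,3) la dm by (auto simp: around_def nested_def)
              next
                case False
                then show ?thesis using key[of x] arc(2,3) by (auto simp: around_def)
              qed
            qed
          qed
          have new: "(l, m) \<notin> around V a d (Suc l) m" for V by (auto simp: around_def)
          have "L l r = node ?\<delta> (s l) (s m) (L (Suc l) m) * ?T"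
            using compatibleD(3)[OF comp arc(1) la dm arc(3)] .
          also have "L (Suc l) m = ?R (Suc l) m" using arc la dm by simp
          also have "node ?\<delta> (s l) (s m) (?R (Suc l) m) * ?T
              = (\<Sum>x\<in>around U a d (Suc l) m. [:?cx x:] * (node ?\<delta> (s l) (s m) (?X x (Suc l) m) * ?T))
              + [:?co (Suc l) m:] * (node ?\<delta> (s l) (s m) (var * arc_poly U D s (Suc l) m) * ?T)"
            using finA[OF fin(1)]
            by (simp only: mult.assoc node_add node_sum node_const_mult distrib_right sum_distrib_right)
          also have "(\<Sum>x\<in>around U a d (Suc l) m. [:?cx x:] * (node ?\<delta> (s l) (s m) (?X x (Suc l) m) * ?T))
            = (\<Sum>x\<in>around U a d (Suc l) m. [:?cx x:] * ?X x l r)"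
          proof (rule sum.cong[OF refl])
            fix x assume x: "x \<in> around U a d (Suc l) m"
            then have xU: "x \<in> U" "fst x < m" "Suc l \<le> fst x"
              using \<open>a \<le> d\<close> dm by (auto simp: around_def nested_def)
            have "?X x l r = node ((l, m) \<in> insert x D) (s l) (s m) (?X x (Suc l) m) * ?X x (Suc m) r"
              by (rule arc_poly_arc_dot[OF nc xU(1) arc(1) arc(3)])
            moreover have "?X x (Suc m) r = ?T"
              by (rule arc_poly_cong) (use xU in auto)
            moreover have "(l, m) \<in> insert x D \<longleftrightarrow> ?\<delta>" using xU by auto
            ultimately show "[:?cx x:] * (node ?\<delta> (s l) (s m) (?X x (Suc l) m) * ?T) = [:?cx x:] * ?X x l r" by simp
          qed
          also have "[:?co (Suc l) m:] * (node ?\<delta> (s l) (s m) (var * arc_poly U D s (Suc l) m) * ?T)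
            = (if ?\<delta> then 0 else [:?cx (l, m):] * ?X (l, m) l r) + [:?co l r:] * var * arc_poly U D s l r"
          proof (cases ?\<delta>)
            case True
            then have "(l, m) \<notin> U" using disj by auto
            then have cU: "around U a d l r = around U a d (Suc l) m" using ar[of U] by auto
            have cD: "card (around D a d l r) = Suc (card (around D a d (Suc l) m))"
              using ar[of D] True new finA[OF fin(2)] by simp
            have "?co l r = ?co (Suc l) m * hpow (-2)"
              unfolding cU cD mult.assoc hpow_mult by (rule arg_cong[of _ _ "\<lambda>z. \<gamma> * hpow z"]) simp
            then have co: "[:?co l r:] = [:?co (Suc l) m:] * hconst (-2)" by simp
            have "arc_poly U D s l r = node True (s l) (s m) (arc_poly U D s (Suc l) m) * ?T"
              using arc_poly_arc[OF nc arc(1) arc(3)] True by simp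
            then show ?thesis
              unfolding co if_P[OF True] using True
              by (simp only: node_dotted_var mult_ac add_0_left)
          next
            case False
            then have lmU: "(l, m) \<in> U" using arc by auto
            have cU: "card (around U a d l r) = Suc (card (around U a d (Suc l) m))"
              using ar[of U] lmU new finA[OF fin(1)] by simp
            have cD: "around D a d l r = around D a d (Suc l) m" using ar[of D] False by auto
            have "?co l r = ?co (Suc l) m * hpow 2"
              unfolding cU cD mult.assoc hpow_mult by (rule arg_cong[of _ _ "\<lambda>z. \<gamma> * hpow z"]) simp
            then have co: "[:?co l r:] = [:?co (Suc l) m:] * hconst 2"
              by (simp only: mult_pCons_left) (simp add: mult.assoc add.commute)
            have "?cx (l, m) = ?co (Suc l) m * hpow (-1)"
              by (simp add: mult.assoc algebra_simps)
            then have cx: "[:?cx (l, m):] = [:?co (Suc l) m:] * hconst (-1)" by simp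
            have 1: "arc_poly U D s l r = node False (s l) (s m) (arc_poly U D s (Suc l) m) * ?T"
              using arc_poly_arc[OF nc arc(1) arc(3)] False by simp
            have "?X (l, m) l r = node True (s l) (s m) (?X (l, m) (Suc l) m) * ?X (l, m) (Suc m) r"
              using arc_poly_arc_dot[OF nc lmU arc(1) arc(3), of s] by simp
            moreover have "?X (l, m) (Suc l) m = arc_poly U D s (Suc l) m" "?X (l, m) (Suc m) r = ?T"
              using arc by (auto intro!: arc_poly_cong)
            ultimately have 2: "?X (l, m) l r = node True (s l) (s m) (arc_poly U D s (Suc l) m) * ?T" by simp
            have f: "?\<delta> = False" using False by simp
            show ?thesis
              unfolding co cx 1 2 f if_False node_undotted_var by algebra
          qed
          also have "(\<Sum>x\<in>around U a d (Suc l) m. [:?cx x:] * ?X x l r)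
              + ((if ?\<delta> then 0 else [:?cx (l, m):] * ?X (l, m) l r) + [:?co l r:] * var * arc_poly U D s l r)
            = ?R l r"
          proof (cases ?\<delta>)
            case True
            then have "(l, m) \<notin> U" using disj by auto
            then have "around U a d l r = around U a d (Suc l) m" using ar[of U] by auto
            then show ?thesis using True by simp
          next
            case False
            then have "(l, m) \<in> U" using arc by auto
            then have "around U a d l r = insert (l, m) (around U a d (Suc l) m)" using ar[of U] by auto
            then show ?thesis using False new[of U] finA[OF fin(1)] by (simp add: add.assoc add.commute add.left_commute)
          qed
          finally show ?thesis .
        qed
      qed
    qed
  qed
  then show ?thesis using assms by blast
qed

section \<open>Matchings of all 2n endpoints and the two configurations on a, b, c, d\<close>

lemma crossingless_noncrossing:
  assumes "crossingless_matching n M"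
  shows "noncrossing M"
proof -
  have 1: "\<forall>(a, b)\<in>M. 1 \<le> a \<and> a < b \<and> b \<le> 2 * n"
    and 2: "\<forall>p\<in>{1..2 * n}. \<exists>!e. e \<in> M \<and> (p = fst e \<or> p = snd e)"
    and 3: "\<forall>(a, b)\<in>M. \<forall>(c, d)\<in>M. \<not> (a < c \<and> c < b \<and> b < d)"
    using assms by (auto simp: crossingless_matching_def)
  have "fst e \<noteq> fst e' \<and> fst e \<noteq> snd e' \<and> snd e \<noteq> snd e'" if "e \<in> M" "e' \<in> M" "e \<noteq> e'" for e e'
  proof -
    have "fst e \<in> {1..2 * n}" "snd e \<in> {1..2 * n}" using 1 that(1) by auto
    then show ?thesis using 2 that by metis
  qed
  then show ?thesis using 1 3 unfolding noncrossing_def by blast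
qed

lemma crossingless_covered:
  assumes "crossingless_matching n M"
  shows "covered M 1 (Suc (2 * n))"
proof (rule coveredI)
  fix p assume "1 \<le> p" "p < Suc (2 * n)"
  then have "p \<in> {1..2 * n}" by auto
  then obtain e where "e \<in> M" "p = fst e \<or> p = snd e"
    using assms unfolding crossingless_matching_def by blast
  moreover have "1 \<le> fst e" "snd e < Suc (2 * n)"
    using assms \<open>e \<in> M\<close> by (auto simp: crossingless_matching_def)
  ultimately show "\<exists>x y. (x, y) \<in> M \<and> (p = x \<or> p = y) \<and> 1 \<le> x \<and> y < Suc (2 * n)"
    by (metis prod.collapse)
qed

lemma crossingless_bounds: "crossingless_matching n M \<Longrightarrow> (a, b) \<in> M \<Longrightarrow> 1 \<le> a \<and> a < b \<and> b \<le> 2 * n"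
  by (auto simp: crossingless_matching_def)

lemma crossingless_finite: "crossingless_matching n M \<Longrightarrow> finite M"
  by (rule finite_subset[of _ "{1..2 * n} \<times> {1..2 * n}"])
     (fastforce simp: crossingless_matching_def)+

lemma arc_poly_nested:
  assumes nc: "noncrossing (U' \<union> D')" and arcs: "(a, d) \<in> U' \<union> D'" "(b, c) \<in> U' \<union> D'"
    and ord: "a < b" "b < c" "c < d" and cov: "covered (U' \<union> D') (Suc a) b"
    and agree: "\<And>x y. x \<notin> {a, b, c, d} \<Longrightarrow> ((x, y) \<in> U' \<longleftrightarrow> (x, y) \<in> U) \<and> ((x, y) \<in> D' \<longleftrightarrow> (x, y) \<in> D)"
  shows "arc_poly U' D' s a (Suc d) = node ((a, d) \<in> D') (s a) (s d)
    (arc_poly U D s (Suc a) b * node ((b, c) \<in> D') (s b) (s c) (arc_poly U D s (Suc b) c) * arc_poly U D s (Suc c) d)"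
proof -
  have q: "arc_poly U' D' s (Suc a) b = arc_poly U D s (Suc a) b"
    "arc_poly U' D' s (Suc b) c = arc_poly U D s (Suc b) c"
    "arc_poly U' D' s (Suc c) d = arc_poly U D s (Suc c) d"
    using ord agree by (auto intro!: arc_poly_cong)
  have "arc_poly U' D' s a (Suc d) = node ((a, d) \<in> D') (s a) (s d) (arc_poly U' D' s (Suc a) d)"
    using arc_poly_arc[OF nc arcs(1), of "Suc d" s] by simp
  also have "arc_poly U' D' s (Suc a) d = arc_poly U' D' s (Suc a) b * arc_poly U' D' s b d"
    using ord by (intro arc_poly_split nc cov) auto
  also have "arc_poly U' D' s b d = node ((b, c) \<in> D') (s b) (s c) (arc_poly U' D' s (Suc b) c) * arc_poly U' D' s (Suc c) d"
    using ord by (intro arc_poly_arc nc arcs)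
  finally show ?thesis by (simp only: q mult.assoc)
qed

lemma arc_poly_adjacent:
  assumes nc: "noncrossing (U' \<union> D')" and arcs: "(a, b) \<in> U' \<union> D'" "(c, d) \<in> U' \<union> D'"
    and ord: "a < b" "b < c" "c < d" and cov: "covered (U' \<union> D') (Suc b) c"
    and agree: "\<And>x y. x \<notin> {a, b, c, d} \<Longrightarrow> ((x, y) \<in> U' \<longleftrightarrow> (x, y) \<in> U) \<and> ((x, y) \<in> D' \<longleftrightarrow> (x, y) \<in> D)"
  shows "arc_poly U' D' s a (Suc d) = node ((a, b) \<in> D') (s a) (s b) (arc_poly U D s (Suc a) b)
    * arc_poly U D s (Suc b) c * node ((c, d) \<in> D') (s c) (s d) (arc_poly U D s (Suc c) d)"
proof -
  have q: "arc_poly U' D' s (Suc a) b = arc_poly U D s (Suc a) b"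
    "arc_poly U' D' s (Suc b) c = arc_poly U D s (Suc b) c"
    "arc_poly U' D' s (Suc c) d = arc_poly U D s (Suc c) d"
    using ord agree by (auto intro!: arc_poly_cong)
  have "arc_poly U' D' s a (Suc d) = node ((a, b) \<in> D') (s a) (s b) (arc_poly U' D' s (Suc a) b) * arc_poly U' D' s (Suc b) (Suc d)"
    using ord by (intro arc_poly_arc nc arcs) auto
  also have "arc_poly U' D' s (Suc b) (Suc d) = arc_poly U' D' s (Suc b) c * arc_poly U' D' s c (Suc d)"
    using ord by (intro arc_poly_split nc cov) auto
  also have "arc_poly U' D' s c (Suc d) = node ((c, d) \<in> D') (s c) (s d) (arc_poly U' D' s (Suc c) d)"
    using arc_poly_arc[OF nc arcs(2), of "Suc d" s] by simp
  finally show ?thesis by (simp only: q mult.assoc)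
qed

text \<open>Since (a, b) and (c, d) are arcs of one matching and (b, c) of the other, the common
  arcs match each of the three gaps within itself. This is what lets both configurations be written
  with the same three polynomials.\<close>

lemma two_completions:
  assumes 1: "crossingless_matching n (insert (a, d) (insert (b, c) W))"
    and 2: "crossingless_matching n (insert (a, b) (insert (c, d) W))"
    and ord: "a < b" "b < c" "c < d"
  shows "covered W (Suc a) b" "covered W (Suc b) c" "covered W (Suc c) d"
    "covered (insert (a, d) (insert (b, c) W)) a (Suc d)" "covered (insert (a, b) (insert (c, d) W)) a (Suc d)"
    "\<And>x y. (x, y) \<in> W \<Longrightarrow> x \<notin> {a, b, c, d} \<and> y \<notin> {a, b, c, d}"
proof -
  let ?M1 = "insert (a, d) (insert (b, c) W)" and ?M2 = "insert (a, b) (insert (c, d) W)"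
  note nc1 = crossingless_noncrossing[OF 1] and nc2 = crossingless_noncrossing[OF 2]
  show W: "x \<notin> {a, b, c, d} \<and> y \<notin> {a, b, c, d}" if "(x, y) \<in> W" for x y
  proof -
    have m: "(x, y) \<in> ?M1" "(x, y) \<in> ?M2" using that by auto
    have w2: "(a, d) \<notin> W" "(b, c) \<notin> W"
    proof -
      have "(a, d) \<in> W \<Longrightarrow> a \<noteq> a" using noncrossing_distinct[OF nc2, of a b a d] ord by simp
      moreover have "(b, c) \<in> W \<Longrightarrow> b \<noteq> b" using noncrossing_distinct[OF nc2, of a b b c] ord by simp
      ultimately show "(a, d) \<notin> W" "(b, c) \<notin> W" by blast+
    qed
    have "(a, d) \<noteq> (x, y)" "(b, c) \<noteq> (x, y)" using that w2 by metis+
    moreover have "(a, d) \<in> ?M1" "(b, c) \<in> ?M1" by simp_all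
    ultimately have "a \<noteq> x \<and> a \<noteq> y \<and> d \<noteq> x \<and> d \<noteq> y" "b \<noteq> x \<and> b \<noteq> y \<and> c \<noteq> x \<and> c \<noteq> y"
      using noncrossing_distinct[OF nc1 _ m(1)] by blast+
    then show ?thesis by auto
  qed
  have shrink: "covered W l r" if cov: "covered M l r" and M: "\<And>e. e \<in> M \<Longrightarrow> e \<in> W \<or> e \<in> {(a, b), (c, d), (a, d), (b, c)}"
     and out: "{a, b, c, d} \<inter> {l..<r} = {}" for M l r
  proof (rule coveredI)
    fix p assume p: "l \<le> p" "p < r"
    then obtain x y where xy: "(x, y) \<in> M" "p = x \<or> p = y" "l \<le> x" "y < r"
      by (rule coveredE[OF cov])
    moreover have "p \<notin> {a, b, c, d}" using p out by auto
    ultimately have "(x, y) \<in> W" using M[OF xy(1)] by auto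
    then show "\<exists>x y. (x, y) \<in> W \<and> (p = x \<or> p = y) \<and> l \<le> x \<and> y < r" using xy by blast
  qed
  have b: "1 \<le> a" "d < Suc (2 * n)" using crossingless_bounds[OF 1, of a d] by auto
  show c1: "covered W (Suc a) b"
    by (rule shrink[OF covered_inside[OF nc2 crossingless_covered[OF 2]]]) (use b ord in auto)
  show c2: "covered W (Suc b) c"
    by (rule shrink[OF covered_inside[OF nc1 crossingless_covered[OF 1]]]) (use b ord in auto)
  show c3: "covered W (Suc c) d"
    by (rule shrink[OF covered_inside[OF nc2 crossingless_covered[OF 2]]]) (use b ord in auto)
  have *: "\<exists>x y. (x, y) \<in> W \<and> (p = x \<or> p = y) \<and> a \<le> x \<and> y < Suc d" if "a \<le> p" "p < Suc d" "p \<notin> {a, b, c, d}" for p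
  proof -
    have "p \<noteq> a" "p \<noteq> b" "p \<noteq> c" "p \<noteq> d" using \<open>p \<notin> {a, b, c, d}\<close> by auto
    then have "Suc a \<le> p \<and> p < b \<or> Suc b \<le> p \<and> p < c \<or> Suc c \<le> p \<and> p < d"
      using \<open>a \<le> p\<close> \<open>p < Suc d\<close> by linarith
    then consider "Suc a \<le> p" "p < b" | "Suc b \<le> p" "p < c" | "Suc c \<le> p" "p < d" by blast
    then show ?thesis
    proof cases
      case 1 then obtain x y where "(x, y) \<in> W" "p = x \<or> p = y" "Suc a \<le> x" "y < b" by (rule coveredE[OF c1])
      then show ?thesis using ord by (intro exI[of _ x] exI[of _ y]) auto
    next
      case 2 then obtain x y where "(x, y) \<in> W" "p = x \<or> p = y" "Suc b \<le> x" "y < c" by (rule coveredE[OF c2])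
      then show ?thesis using ord by (intro exI[of _ x] exI[of _ y]) auto
    next
      case 3 then obtain x y where "(x, y) \<in> W" "p = x \<or> p = y" "Suc c \<le> x" "y < d" by (rule coveredE[OF c3])
      then show ?thesis using ord by (intro exI[of _ x] exI[of _ y]) auto
    qed
  qed
  show "covered ?M1 a (Suc d)"
  proof (rule coveredI)
    fix p assume p: "a \<le> p" "p < Suc d"
    show "\<exists>x y. (x, y) \<in> ?M1 \<and> (p = x \<or> p = y) \<and> a \<le> x \<and> y < Suc d"
    proof (cases "p \<in> {a, b, c, d}")
      case True
      then consider "p = a \<or> p = d" | "p = b \<or> p = c" by auto
      then show ?thesis
      proof cases
        case 1 then show ?thesis by (intro exI[of _ a] exI[of _ d]) auto
      next
        case 2 then show ?thesis using ord by (intro exI[of _ b] exI[of _ c]) auto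
      qed
    next
      case False then show ?thesis using *[OF p] by blast
    qed
  qed
  show "covered ?M2 a (Suc d)"
  proof (rule coveredI)
    fix p assume p: "a \<le> p" "p < Suc d"
    show "\<exists>x y. (x, y) \<in> ?M2 \<and> (p = x \<or> p = y) \<and> a \<le> x \<and> y < Suc d"
    proof (cases "p \<in> {a, b, c, d}")
      case True
      then consider "p = a \<or> p = b" | "p = c \<or> p = d" by auto
      then show ?thesis
      proof cases
        case 1 then show ?thesis using ord by (intro exI[of _ a] exI[of _ b]) auto
      next
        case 2 then show ?thesis using ord by (intro exI[of _ c] exI[of _ d]) auto
      qed
    next
      case False then show ?thesis using *[OF p] by blast
    qed
  qed
qed

definition arc_value :: "nat \<Rightarrow> config \<Rightarrow> dotted \<Rightarrow> laurent" where
  "arc_value n s = (\<lambda>(U, D). coeff (arc_poly U D s 1 (Suc (2 * n))) 0)"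

lemma depth_eq_card_around:
  assumes "finite U" "x \<in> enclosing U a d"
  shows "depth U a d x = Suc (card (around U a d (Suc (fst x)) (snd x)))"
proof -
  have "{y \<in> enclosing U a d. y = x \<or> nested y x} = insert x (around U a d (Suc (fst x)) (snd x))"
    using assms(2) by (auto simp: enclosing_def around_def nested_def)
  moreover have "x \<notin> around U a d (Suc (fst x)) (snd x)" by (auto simp: around_def)
  moreover have "finite (around U a d (Suc (fst x)) (snd x))" using assms(1) by (simp add: around_def)
  ultimately show ?thesis by (simp add: depth_def)
qed

lemma dots_between_eq_card_around:
  "dots_between D a d x = card (around D a d (Suc (fst x)) (snd x))"
  unfolding dots_between_def around_def by (rule arg_cong[of _ _ card]) (auto simp: nested_def)

text \<open>The term in which the variable got out of all arcs has no constant coefficient. The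
  offset -3 arises because \<open>depth\<close> counts x itself: twice the number of arcs inside x,
  minus 1, is twice the depth minus 3.\<close>

lemma coeff_0_enclosing_sum:
  assumes M: "crossingless_matching n (U \<union> D)" and disj: "U \<inter> D = {}"
    and bl: "covered (U \<union> D) a (Suc d)" and ad: "1 \<le> a" "a \<le> d" "d \<le> 2 * n"
    and comp: "compatible U D s a d L"
    and base: "L a (Suc d) = [:\<gamma>:] * var * arc_poly U D s a (Suc d)"
  shows "coeff (L 1 (Suc (2 * n))) 0 = (\<Sum>x\<in>enclosing U a d.
    \<gamma> * hpow (2 * (int (depth U a d x) - int (dots_between D a d x)) - 3) * arc_value n s (U - {x}, insert x D))"
proof -
  let ?N = "Suc (2 * n)"
  have fin: "finite U" "finite D" using crossingless_finite[OF M] by auto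
  have "1 \<le> x \<and> y < ?N" if "(x, y) \<in> U" for x y
    using crossingless_bounds[OF M, of x y] that by auto
  then have ar: "around U a d 1 ?N = enclosing U a d" by (auto simp: around_def enclosing_def)
  have "coeff (L 1 ?N) 0 = (\<Sum>x\<in>enclosing U a d.
        \<gamma> * hpow (2 * int (card (around U a d (Suc (fst x)) (snd x))) - 1
             - 2 * int (card (around D a d (Suc (fst x)) (snd x))))
          * arc_value n s (U - {x}, insert x D))"
    using var_moves_outwards[OF crossingless_noncrossing[OF M] fin disj crossingless_covered[OF M] bl ad(2) comp base ad(1)]
      ad(3) unfolding ar by (simp add: coeff_sum arc_value_def)
  also have "\<dots> = (\<Sum>x\<in>enclosing U a d.
    \<gamma> * hpow (2 * (int (depth U a d x) - int (dots_between D a d x)) - 3) * arc_value n s (U - {x}, insert x D))"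
    by (rule sum.cong[OF refl])
       (simp add: depth_eq_card_around[OF fin(1)] dots_between_eq_card_around algebra_simps)
  finally show ?thesis .
qed

text \<open>Let \<open>L\<close> be the difference of the two sides without the sum. By
  \<open>node_type_I\<close> it equals \<open>gap\<close> times the variable times the diagram with
  ab and cd undotted on the block, and \<open>gap * hpow (-3)\<close> is 1 - q^(-2).\<close>

lemma type_I_value:
  assumes disj: "U \<inter> D = {}" and 1: "crossingless_matching n (insert (a, d) (insert (b, c) (U \<union> D)))"
    and 2: "crossingless_matching n (insert (a, b) (insert (c, d) (U \<union> D)))"
    and ord: "a < b" "b < c" "c < d"
  shows "arc_value n s (insert (a, d) U, insert (b, c) D) =
    arc_value n s (insert (c, d) U, insert (a, b) D) + arc_value n s (insert (a, b) U, insert (c, d) D)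
    + hpow (-2) * arc_value n s (insert (b, c) U, insert (a, d) D)
    + (1 - hpow (-4)) * (\<Sum>x\<in>enclosing U a d. hpow (2 * (int (depth U a d x) - int (dots_between D a d x)))
        * arc_value n s (insert (a, b) (insert (c, d) U) - {x}, insert x D))"
proof -
  note tc = two_completions[OF 1 2 ord]
  note nc1 = crossingless_noncrossing[OF 1] and nc2 = crossingless_noncrossing[OF 2]
  have nc: "noncrossing (insert (b, c) (insert (a, d) (U \<union> D)))" "noncrossing (insert (c, d) (insert (a, b) (U \<union> D)))"
    by (subst insert_commute, rule nc1 nc2)+
  have cov1: "covered (insert (b, c) (insert (a, d) (U \<union> D))) (Suc a) b" "covered (insert (a, d) (insert (b, c) (U \<union> D))) (Suc a) b"
    by (rule covered_mono[OF tc(1)]; auto)+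
  have cov2: "covered (insert (c, d) (insert (a, b) (U \<union> D))) (Suc b) c" "covered (insert (a, b) (insert (c, d) (U \<union> D))) (Suc b) c"
    by (rule covered_mono[OF tc(2)]; auto)+
  let ?U = "insert (a, b) (insert (c, d) U)"
  have W: "(x, y) \<notin> U" "(x, y) \<notin> D" if "x \<in> {a, b, c, d} \<or> y \<in> {a, b, c, d}" for x y
    using tc(6)[of x y] that by auto
  have eq: "insert (a, d) U \<union> insert (b, c) D = insert (a, d) (insert (b, c) (U \<union> D))"
    "insert (b, c) U \<union> insert (a, d) D = insert (a, d) (insert (b, c) (U \<union> D))"
    "insert (c, d) U \<union> insert (a, b) D = insert (a, b) (insert (c, d) (U \<union> D))"
    "insert (a, b) U \<union> insert (c, d) D = insert (a, b) (insert (c, d) (U \<union> D))"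
    "?U \<union> D = insert (a, b) (insert (c, d) (U \<union> D))" by auto
  have ad: "a \<le> d" using ord by simp
  let ?P = "\<lambda>U D. arc_poly U D s"
  define L where "L = (\<lambda>l r. ?P (insert (a, d) U) (insert (b, c) D) l r
     + [:-1:] * (?P (insert (c, d) U) (insert (a, b) D) l r + (?P (insert (a, b) U) (insert (c, d) D) l r
     + hconst (-2) * ?P (insert (b, c) U) (insert (a, d) D) l r)))"
  have comp: "compatible ?U D s a d L"
    unfolding L_def
    by (intro compatible_add compatible_const_mult compatible_arc_poly ad; (unfold eq)?; (rule nc1 nc2 tc)?)
       (use ord in auto)
  have base: "L a (Suc d) = [:gap:] * var * ?P ?U D a (Suc d)"
  proof -
    have b: "?P (insert (a, d) U) (insert (b, c) D) a (Suc d)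
      = node False (s a) (s d) (?P U D (Suc a) b * node True (s b) (s c) (?P U D (Suc b) c) * ?P U D (Suc c) d)"
      "?P (insert (b, c) U) (insert (a, d) D) a (Suc d)
      = node True (s a) (s d) (?P U D (Suc a) b * node False (s b) (s c) (?P U D (Suc b) c) * ?P U D (Suc c) d)"
      using arc_poly_nested[of "insert (a, d) U" "insert (b, c) D" a d b c U D s] arc_poly_nested[of "insert (b, c) U" "insert (a, d) D" a d b c U D s]
        nc1 nc ord W cov1 by simp_all
    have c: "?P (insert (c, d) U) (insert (a, b) D) a (Suc d)
      = node True (s a) (s b) (?P U D (Suc a) b) * ?P U D (Suc b) c * node False (s c) (s d) (?P U D (Suc c) d)"
      "?P (insert (a, b) U) (insert (c, d) D) a (Suc d)
      = node False (s a) (s b) (?P U D (Suc a) b) * ?P U D (Suc b) c * node True (s c) (s d) (?P U D (Suc c) d)"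
      "?P ?U D a (Suc d)
      = node False (s a) (s b) (?P U D (Suc a) b) * ?P U D (Suc b) c * node False (s c) (s d) (?P U D (Suc c) d)"
      using arc_poly_adjacent[of "insert (c, d) U" "insert (a, b) D" a b c d U D s]
        arc_poly_adjacent[of "insert (a, b) U" "insert (c, d) D" a b c d U D s]
        arc_poly_adjacent[of ?U D a b c d U D s]
        nc2 nc ord W cov2 by simp_all
    have m1: "[:-1:] * p = - p" for p :: "laurent poly" by simp
    show ?thesis
      unfolding L_def b c m1 node_type_I[of "s a" "s d"] by algebra
  qed
  have bounds: "1 \<le> a" "d \<le> 2 * n" using crossingless_bounds[OF 1, of a d] by auto
  have enc: "enclosing ?U a d = enclosing U a d" using ord by (auto simp: enclosing_def nested_def)
  have "coeff (L 1 (Suc (2 * n))) 0 = (\<Sum>x\<in>enclosing ?U a d.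
      gap * hpow (2 * (int (depth ?U a d x) - int (dots_between D a d x)) - 3) * arc_value n s (?U - {x}, insert x D))"
    by (rule coeff_0_enclosing_sum[OF _ _ _ bounds(1) ad bounds(2) comp base]) (use 2 tc(5) disj W in \<open>auto simp: eq\<close>)
  also have "\<dots> = (1 - hpow (-4)) * (\<Sum>x\<in>enclosing U a d. hpow (2 * (int (depth U a d x) - int (dots_between D a d x)))
        * arc_value n s (?U - {x}, insert x D))"
    unfolding sum_distrib_left depth_def enc by (rule sum.cong[OF refl]) (simp add: gap_def algebra_simps)
  also have "coeff (L 1 (Suc (2 * n))) 0 = arc_value n s (insert (a, d) U, insert (b, c) D) -
    (arc_value n s (insert (c, d) U, insert (a, b) D) + arc_value n s (insert (a, b) U, insert (c, d) D)
    + hpow (-2) * arc_value n s (insert (b, c) U, insert (a, d) D))"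
    unfolding L_def by (simp add: arc_value_def algebra_simps)
  finally show ?thesis by (simp add: algebra_simps)
qed

text \<open>As for type I, but \<open>node_type_II\<close> supplies an extra q^(-1), which is the
  shift from i to i - 1 in the exponent. The dotted arc (a, d) itself does not enter
  \<open>dots_between\<close>, as nesting is strict.\<close>

lemma type_II_value:
  assumes disj: "U \<inter> D = {}" and 1: "crossingless_matching n (insert (a, d) (insert (b, c) (U \<union> D)))"
    and 2: "crossingless_matching n (insert (a, b) (insert (c, d) (U \<union> D)))"
    and ord: "a < b" "b < c" "c < d"
  shows "arc_value n s (U, insert (a, b) (insert (c, d) D)) =
    arc_value n s (U, insert (a, d) (insert (b, c) D))
    + (1 - hpow (-4)) * (\<Sum>x\<in>enclosing U a d. hpow (2 * (int (depth U a d x) - 1 - int (dots_between D a d x)))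
        * arc_value n s (insert (b, c) U - {x}, insert x (insert (a, d) D)))"
proof -
  note tc = two_completions[OF 1 2 ord]
  note nc1 = crossingless_noncrossing[OF 1] and nc2 = crossingless_noncrossing[OF 2]
  have nc: "noncrossing (insert (b, c) (insert (a, d) (U \<union> D)))" "noncrossing (insert (c, d) (insert (a, b) (U \<union> D)))"
    by (subst insert_commute, rule nc1 nc2)+
  have cov1: "covered (insert (b, c) (insert (a, d) (U \<union> D))) (Suc a) b" "covered (insert (a, d) (insert (b, c) (U \<union> D))) (Suc a) b"
    by (rule covered_mono[OF tc(1)]; auto)+
  have cov2: "covered (insert (c, d) (insert (a, b) (U \<union> D))) (Suc b) c" "covered (insert (a, b) (insert (c, d) (U \<union> D))) (Suc b) c"
    by (rule covered_mono[OF tc(2)]; auto)+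
  let ?U = "insert (b, c) U" and ?D = "insert (a, d) D"
  have W: "(x, y) \<notin> U" "(x, y) \<notin> D" if "x \<in> {a, b, c, d} \<or> y \<in> {a, b, c, d}" for x y
    using tc(6)[of x y] that by auto
  have eq: "U \<union> insert (a, b) (insert (c, d) D) = insert (a, b) (insert (c, d) (U \<union> D))"
    "U \<union> insert (a, d) (insert (b, c) D) = insert (a, d) (insert (b, c) (U \<union> D))"
    "?U \<union> ?D = insert (a, d) (insert (b, c) (U \<union> D))" by auto
  have ad: "a \<le> d" using ord by simp
  let ?P = "\<lambda>U D. arc_poly U D s"
  define L where "L = (\<lambda>l r. ?P U (insert (a, b) (insert (c, d) D)) l r
     + [:-1:] * ?P U (insert (a, d) (insert (b, c) D)) l r)"
  have comp: "compatible ?U ?D s a d L"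
    unfolding L_def
    by (intro compatible_add compatible_const_mult compatible_arc_poly ad; (unfold eq)?; (rule nc1 nc2 tc)?)
       (use ord in auto)
  have base: "L a (Suc d) = [:hpow (-2) * gap:] * var * ?P ?U ?D a (Suc d)"
  proof -
    have b: "?P U (insert (a, d) (insert (b, c) D)) a (Suc d)
      = node True (s a) (s d) (?P U D (Suc a) b * node True (s b) (s c) (?P U D (Suc b) c) * ?P U D (Suc c) d)"
      "?P ?U ?D a (Suc d)
      = node True (s a) (s d) (?P U D (Suc a) b * node False (s b) (s c) (?P U D (Suc b) c) * ?P U D (Suc c) d)"
      using arc_poly_nested[of U "insert (a, d) (insert (b, c) D)" a d b c U D s] arc_poly_nested[of ?U ?D a d b c U D s]
        nc1 nc ord W cov1 by simp_all
    have c: "?P U (insert (a, b) (insert (c, d) D)) a (Suc d)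
      = node True (s a) (s b) (?P U D (Suc a) b) * ?P U D (Suc b) c * node True (s c) (s d) (?P U D (Suc c) d)"
      using arc_poly_adjacent[of U "insert (a, b) (insert (c, d) D)" a b c d U D s]
        nc2 nc ord W cov2 by simp_all
    have m1: "[:-1:] * p = - p" "[:hpow (-2) * gap:] = hconst (-2) * [:gap:]" for p :: "laurent poly" by simp_all
    show ?thesis
      unfolding L_def b c m1 node_type_II by algebra
  qed
  have bounds: "1 \<le> a" "d \<le> 2 * n" using crossingless_bounds[OF 1, of a d] by auto
  have enc: "enclosing ?U a d = enclosing U a d" using ord by (auto simp: enclosing_def nested_def)
  have dots: "dots_between ?D a d x = dots_between D a d x" for x
    unfolding dots_between_def by (rule arg_cong[of _ _ card]) (auto simp: nested_def)
  have "coeff (L 1 (Suc (2 * n))) 0 = (\<Sum>x\<in>enclosing ?U a d. hpow (-2) * gap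
      * hpow (2 * (int (depth ?U a d x) - int (dots_between ?D a d x)) - 3) * arc_value n s (?U - {x}, insert x ?D))"
    by (rule coeff_0_enclosing_sum[OF _ _ _ bounds(1) ad bounds(2) comp base]) (use 1 tc(4) disj W ord in \<open>auto simp: eq\<close>)
  also have "\<dots> = (1 - hpow (-4)) * (\<Sum>x\<in>enclosing U a d. hpow (2 * (int (depth U a d x) - 1 - int (dots_between D a d x)))
        * arc_value n s (?U - {x}, insert x ?D))"
    unfolding sum_distrib_left depth_def enc dots by (rule sum.cong[OF refl]) (simp add: gap_def algebra_simps)
  also have "coeff (L 1 (Suc (2 * n))) 0 = arc_value n s (U, insert (a, b) (insert (c, d) D)) -
    arc_value n s (U, insert (a, d) (insert (b, c) D))"
    unfolding L_def by (simp add: arc_value_def)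
  finally show ?thesis by (simp add: algebra_simps)
qed


section \<open>Polynomials acting on the spins of undotted arcs\<close>

definition weight :: "bool list \<Rightarrow> int" where
  "weight st = (\<Sum>x\<leftarrow>st. if x then 1 else - 1)"

lemma weight_simps [simp]:
  "weight [] = 0" "weight (x # st) = (if x then 1 else - 1) + weight st"
  "weight (st @ st') = weight st + weight st'"
  by (simp_all add: weight_def)

text \<open>The iterated coproduct of E, acting on functions of the spins: K to the left of the
  raised factor and its inverse to the right, where K is multiplication by
  \<open>hpow (weight st)\<close>.\<close>

definition raise_op :: "(bool list \<Rightarrow> laurent) \<Rightarrow> bool list \<Rightarrow> laurent" where
  "raise_op v st = (\<Sum>j<length st. if st ! j
     then hpow (weight (take j st) - weight (drop (Suc j) st)) * v (st[j := False]) else 0)"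

lemma raise_op_Nil [simp]: "raise_op v [] = 0"
  by (simp add: raise_op_def)

lemma raise_op_Cons:
  "raise_op v (x # st) = (if x then hpow (- weight st) * v (False # st) else 0)
     + hpow (if x then 1 else - 1) * raise_op (\<lambda>st. v (x # st)) st"
proof -
  have "(\<Sum>j<length st. if (x # st) ! Suc j then hpow (weight (take (Suc j) (x # st)) - weight (drop (Suc (Suc j)) (x # st)))
      * v ((x # st)[Suc j := False]) else 0) =
    (\<Sum>j<length st. hpow (if x then 1 else - 1) * (if st ! j then hpow (weight (take j st) - weight (drop (Suc j) st))
      * v (x # st[j := False]) else 0))"
    by (rule sum.cong) (auto simp: algebra_simps)
  then show ?thesis
    unfolding raise_op_def length_Cons sum.lessThan_Suc_shift sum_distrib_left by simp
qed

lemma raise_op_snoc: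
  "raise_op v (st @ [x]) = hpow (if x then - 1 else 1) * raise_op (\<lambda>st. v (st @ [x])) st
     + (if x then hpow (weight st) * v (st @ [False]) else 0)"
proof -
  have "(\<Sum>j<length st. if (st @ [x]) ! j then hpow (weight (take j (st @ [x])) - weight (drop (Suc j) (st @ [x])))
      * v ((st @ [x])[j := False]) else 0) =
    (\<Sum>j<length st. hpow (if x then - 1 else 1) * (if st ! j then hpow (weight (take j st) - weight (drop (Suc j) st))
      * v (st[j := False] @ [x]) else 0))"
    by (rule sum.cong) (auto simp: nth_append list_update_append algebra_simps)
  then show ?thesis
    unfolding raise_op_def by (simp add: sum_distrib_left nth_append list_update_append)
qed

lemma raise_op_zero [simp]: "raise_op (\<lambda>_. 0) st = 0"
  unfolding raise_op_def by (rule sum.neutral) simp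

lemma raise_op_scale: "raise_op (\<lambda>st. c * v st) st = c * raise_op v st"
  unfolding raise_op_def sum_distrib_left by (rule sum.cong) (auto simp: algebra_simps)

lemma raise_op_add: "raise_op (\<lambda>st. v st + w st) st = raise_op v st + raise_op w st"
  unfolding raise_op_def sum.distrib[symmetric] by (rule sum.cong) (auto simp: algebra_simps)

text \<open>The relation K E = q E K, since flipping one spin changes the weight by 2.\<close>

lemma raise_op_weight: "raise_op (\<lambda>st. hpow (weight st) * v st) st = hpow (weight st - 2) * raise_op v st"
proof (induction st arbitrary: v)
  case (Cons x st)
  have "raise_op (\<lambda>st. hpow (weight (x # st)) * v (x # st)) st
      = hpow (if x then 1 else - 1) * raise_op (\<lambda>st. hpow (weight st) * v (x # st)) st"
    unfolding raise_op_scale[symmetric] by (simp add: algebra_simps)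
  then show ?case by (simp add: raise_op_Cons Cons.IH algebra_simps)
qed simp

text \<open>The operator E K with K moved to the outside: by \<open>raise_op_weight\<close> it is
  \<open>raise_op\<close> applied to \<open>hpow (weight st) * v st\<close>.\<close>

definition step_op :: "(bool list \<Rightarrow> laurent) \<Rightarrow> bool list \<Rightarrow> laurent" where
  "step_op v st = hpow (weight st - 2) * raise_op v st"

lemma step_op_Nil [simp]: "step_op v [] = 0"
  by (simp add: step_op_def)

lemma step_op_False: "step_op v (False # st) = hpow (-2) * step_op (\<lambda>st. v (False # st)) st"
  by (simp add: step_op_def raise_op_Cons algebra_simps)

lemma step_op_True: "step_op v (True # st) = hpow (-1) * v (False # st) + hpow 2 * step_op (\<lambda>st. v (True # st)) st"
  by (simp add: step_op_def raise_op_Cons algebra_simps)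

lemma step_op_zero [simp]: "step_op (\<lambda>_. 0) = (\<lambda>_. 0)"
  by (rule ext) (simp add: step_op_def)

lemma step_op_scale: "step_op (\<lambda>st. c * v st) st = c * step_op v st"
  by (simp add: step_op_def raise_op_scale algebra_simps)

lemma step_op_add: "step_op (\<lambda>st. v st + w st) st = step_op v st + step_op w st"
  by (simp add: step_op_def raise_op_add algebra_simps)

lemma step_op_weight: "step_op (\<lambda>st. hpow (weight st) * v st) st = hpow (weight st) * (hpow (-2) * step_op v st)"
  unfolding step_op_def raise_op_weight by (simp add: algebra_simps)

section \<open>Evaluation of polynomials at E K\<close>

definition poly_op :: "laurent poly \<Rightarrow> (bool list \<Rightarrow> laurent) \<Rightarrow> bool list \<Rightarrow> laurent" where
  "poly_op p v = fold_coeffs (\<lambda>a w st. a * v st + step_op w st) p (\<lambda>_. 0)"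

lemma poly_op_0 [simp]: "poly_op 0 v = (\<lambda>_. 0)"
  by (simp add: poly_op_def)

lemma poly_op_pCons: "poly_op (pCons a p) v = (\<lambda>st. a * v st + step_op (poly_op p v) st)"
  by (cases "a = 0 \<and> p = 0") (auto simp: poly_op_def)

lemma poly_op_1 [simp]: "poly_op 1 v = v"
  by (simp add: one_pCons poly_op_pCons)

lemma poly_op_add: "poly_op (p + r) v = (\<lambda>st. poly_op p v st + poly_op r v st)"
proof (induction p arbitrary: r)
  case (pCons a p)
  obtain b r' where r: "r = pCons b r'" by (cases r)
  show ?case by (simp add: r poly_op_pCons pCons.IH step_op_add algebra_simps)
qed simp

lemma poly_op_const_mult: "poly_op ([:c:] * p) v = (\<lambda>st. c * poly_op p v st)"
proof (induction p)
  case (pCons a p)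
  have "[:c:] * pCons a p = pCons (c * a) ([:c:] * p)" by simp
  then show ?case by (simp only: poly_op_pCons pCons.IH step_op_scale) (simp add: algebra_simps)
qed simp

lemma poly_op_var_mult: "poly_op (var * p) v = step_op (poly_op p v)"
proof -
  have "var * p = pCons 0 p" by simp
  then show ?thesis by (simp add: poly_op_pCons)
qed

lemma poly_op_zero [simp]: "poly_op p (\<lambda>_. 0) = (\<lambda>_. 0)"
  by (induction p) (simp_all add: poly_op_pCons)

lemma poly_op_mult: "poly_op (p * r) v = poly_op p (poly_op r v)"
proof (induction p)
  case (pCons a p)
  have "pCons a p * r = [:a:] * r + var * (p * r)" by simp
  then show ?case by (simp only: poly_op_add poly_op_const_mult poly_op_var_mult pCons.IH poly_op_pCons)
qed simp

lemma poly_op_scale: "poly_op p (\<lambda>st. c * v st) = (\<lambda>st. c * poly_op p v st)"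
  by (induction p) (simp_all add: poly_op_pCons step_op_scale algebra_simps)

lemma poly_op_Nil: "poly_op p v [] = coeff p 0 * v []"
  by (cases p) (simp add: poly_op_pCons)

lemma poly_op_weight:
  "poly_op p (\<lambda>st. hpow (weight st) * v st) = (\<lambda>st. hpow (weight st) * poly_op (dilate (-2) p) v st)"
proof (induction p)
  case (pCons a p)
  show ?case
    unfolding poly_op_pCons pCons.IH dilate_pCons mult.assoc poly_op_add poly_op_const_mult poly_op_var_mult step_op_weight
    by (simp add: poly_op_pCons algebra_simps flip: one_pCons)
qed simp

lemma poly_op_False: "poly_op p v (False # st) = poly_op (dilate (-2) p) (\<lambda>st. v (False # st)) st"
proof (induction p arbitrary: st)
  case (pCons a p)
  have "(\<lambda>st. poly_op p v (False # st)) = poly_op (dilate (-2) p) (\<lambda>st. v (False # st))"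
    using pCons.IH by blast
  then show ?case
    unfolding poly_op_pCons dilate_pCons mult.assoc poly_op_add poly_op_const_mult poly_op_var_mult step_op_False
    by (simp add: poly_op_pCons algebra_simps flip: one_pCons)
qed simp

text \<open>The coproduct of a polynomial in E K on the first tensor factor. That spin is either
  never raised, which dilates the variable by q, or raised exactly once, because E squared vanishes
  on one spin; the latter gives the q-derivative.\<close>

lemma poly_op_True:
  "poly_op p v (True # st) = poly_op (dilate 2 p) (\<lambda>st. v (True # st)) st + poly_op (divdiff p) (\<lambda>st. v (False # st)) st"
proof (induction p arbitrary: st)
  case 0
  have "divdiff 0 = 0" using divdiff_const_mult[of 0 0] by simp
  then show ?case by simp
next
  case (pCons a p)
  have "(\<lambda>st. poly_op p v (True # st)) = (\<lambda>st. poly_op (dilate 2 p) (\<lambda>st. v (True # st)) st + poly_op (divdiff p) (\<lambda>st. v (False # st)) st)"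
    using pCons.IH by blast
  then show ?case
    unfolding poly_op_pCons dilate_pCons divdiff_pCons mult.assoc poly_op_add poly_op_const_mult poly_op_var_mult step_op_True
      poly_op_False
    by (simp add: poly_op_pCons step_op_add algebra_simps flip: one_pCons)
qed

lemma raise_op_cong:
  "(\<And>st'. length st' = length st \<Longrightarrow> v st' = w st') \<Longrightarrow> raise_op v st = raise_op w st"
  unfolding raise_op_def by (rule sum.cong) auto


section \<open>Scanning a dotted diagram\<close>

text \<open>The effect of one endpoint on functions of the spins of the open undotted arcs alone.
  The left end of a dotted arc has to be up, as the other end of its strand is a projector point
  with spin down.\<close>

definition scan_step :: "arc set \<Rightarrow> arc set \<Rightarrow> config \<Rightarrow> nat \<Rightarrow> (bool list \<Rightarrow> laurent) \<Rightarrow> bool list \<Rightarrow> laurent" where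
  "scan_step U D s p v st =
    (if p \<in> fst ` D then (if s p then hpow (weight st) * v st else 0)
     else if p \<in> snd ` D then (if s p then hpow (- weight st) * v st else - gap * raise_op v st)
     else if p \<in> fst ` U then (case st of [] \<Rightarrow> 0 | y # st' \<Rightarrow> cup_weight (s p) y * v st')
     else v (s p # st))"

definition scan_range :: "arc set \<Rightarrow> arc set \<Rightarrow> config \<Rightarrow> nat \<Rightarrow> nat \<Rightarrow> (bool list \<Rightarrow> laurent) \<Rightarrow> bool list \<Rightarrow> laurent" where
  "scan_range U D s l r v = fold (scan_step U D s) [l..<r] v"

lemma scan_range_empty [simp]: "\<not> l < r \<Longrightarrow> scan_range U D s l r v = v"
  by (simp add: scan_range_def)

lemma scan_range_split: "l \<le> m \<Longrightarrow> m \<le> r \<Longrightarrow> scan_range U D s l r v = scan_range U D s m r (scan_range U D s l m v)"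
  unfolding scan_range_def using upt_add_eq_append[of l m "r - m"] by simp

lemma scan_range_single: "scan_range U D s l (Suc l) v = scan_step U D s l v"
  by (simp add: scan_range_def)

text \<open>A dotted arc acts by K at its left end and by the inverse of K or by E at its right end;
  moving K across the polynomial of the inside dilates it, which is \<open>node\<close>. For
  undotted arcs the entries of \<open>node\<close> are those of \<open>poly_op_True\<close> and
  \<open>poly_op_False\<close>. Neighbouring blocks may be reordered, being polynomials in one
  operator.\<close>

lemma scan_range_eq_poly_op:
  assumes nc: "noncrossing (U \<union> D)" and disj: "U \<inter> D = {}" and cov: "covered (U \<union> D) l r"
  shows "scan_range U D s l r v = poly_op (arc_poly U D s l r) v"
  using nc cov
proof (induction arbitrary: v rule: interval_induct)
  case (empty l r)
  then show ?case by simp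
next
  case (arc l m r)
  let ?Q = "arc_poly U D s (Suc l) m"
  have "scan_range U D s l r v = scan_range U D s (Suc m) r (scan_step U D s m (scan_range U D s (Suc l) m (scan_step U D s l v)))"
    using arc(2,3) scan_range_split[of l "Suc l" r U D s v] scan_range_split[of "Suc l" m r U D s]
      scan_range_split[of m "Suc m" r U D s] by (simp add: scan_range_single)
  also have "\<dots> = poly_op (arc_poly U D s (Suc m) r) (scan_step U D s m (poly_op ?Q (scan_step U D s l v)))"
    by (simp only: arc.IH)
  also have "scan_step U D s m (poly_op ?Q (scan_step U D s l v)) = poly_op (node ((l, m) \<in> D) (s l) (s m) ?Q) v"
  proof (cases "(l, m) \<in> D")
    case True
    then have l: "l \<in> fst ` D" and m: "m \<in> snd ` D" by force+
    have "m \<notin> fst ` D"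
    proof
      assume "m \<in> fst ` D"
      then obtain z where "(m, z) \<in> D" by auto
      then show False using noncrossing_distinct[OF nc arc(1), of m z] arc(2) by auto
    qed
    with l m have st: "scan_step U D s l w = (\<lambda>st. if s l then hpow (weight st) * w st else 0)"
      "scan_step U D s m w = (\<lambda>st. if s m then hpow (- weight st) * w st else - gap * raise_op w st)" for w
      by (auto simp: scan_step_def fun_eq_iff)
    show ?thesis
    proof (cases "s l")
      case sl: True
      have 1: "- [:gap:] * var * P = [:- gap:] * (var * P)" for P by simp
      show ?thesis
        unfolding st if_P[OF sl] poly_op_weight node_def if_P[OF True] raise_op_weight
        by (cases "s m") (simp_all only: 1 if_True if_False poly_op_const_mult poly_op_var_mult step_op_def,
           simp_all add: mult.assoc algebra_simps)
    next
      case False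
      show ?thesis unfolding st node_def if_not_P[OF False] poly_op_zero raise_op_zero using True by (simp add: fun_eq_iff)
    qed
  next
    case False
    then have lm: "(l, m) \<in> U" using arc(1) by simp
    have out: "l \<notin> fst ` D" "l \<notin> snd ` D" "m \<notin> fst ` D" "m \<notin> snd ` D" "m \<notin> fst ` U"
    proof -
      have "(x, y) \<notin> D" if "x \<in> {l, m} \<or> y \<in> {l, m}" for x y
        using noncrossing_distinct[OF nc arc(1), of x y] that False disj lm by blast
      then show "l \<notin> fst ` D" "l \<notin> snd ` D" "m \<notin> fst ` D" "m \<notin> snd ` D" by force+
      show "m \<notin> fst ` U"
      proof
        assume "m \<in> fst ` U"
        then obtain z where "(m, z) \<in> U" by auto
        then show False using noncrossing_distinct[OF nc arc(1), of m z] arc(2) by auto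
      qed
    qed
    moreover have "l \<in> fst ` U" using lm by force
    ultimately have st: "scan_step U D s l w = (\<lambda>st. case st of [] \<Rightarrow> 0 | y # st' \<Rightarrow> cup_weight (s l) y * w st')"
      "scan_step U D s m w = (\<lambda>st. w (s m # st))" for w
      by (auto simp: scan_step_def fun_eq_iff)
    have 1: "- hconst 2 * P = [:- hpow 2:] * P" for P by simp
    show ?thesis
      unfolding st node_def if_not_P[OF False]
      by (cases "s l"; cases "s m") (simp_all only: poly_op_True poly_op_False if_True if_False list.case cup_weight_def 1 poly_op_const_mult poly_op_scale, simp_all)
  qed
  also have "poly_op (arc_poly U D s (Suc m) r) (poly_op (node ((l, m) \<in> D) (s l) (s m) ?Q) v)
    = poly_op (arc_poly U D s l r) v"
    unfolding poly_op_mult[symmetric] arc_poly_arc[OF nc arc(1) arc(3)] by (simp only: mult.commute)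
  finally show ?case .
qed


section \<open>Crossing the pending strands\<close>

text \<open>The R-matrix, obtained from the smoothings. It is triangular: only one of the two
  patterns of unlike spins has a second term, in which the two strands exchange their spins.\<close>

lemma act_over:
  assumes "length u = c"
  shows "act (OverNE, c) f (append_config (u @ True # True # v) z) = hpow 1 * f (append_config (u @ True # True # v) z)"
    "act (OverNE, c) f (append_config (u @ False # False # v) z) = hpow 1 * f (append_config (u @ False # False # v) z)"
    "act (OverNE, c) f (append_config (u @ False # True # v) z) = hpow (-1) * f (append_config (u @ True # False # v) z)"
    "act (OverNE, c) f (append_config (u @ True # False # v) z) =
       (hpow 1 - hpow (-3)) * f (append_config (u @ True # False # v) z) + hpow (-1) * f (append_config (u @ False # True # v) z)"
proof -
  have at: "append_config (u @ x # y # v) z c = x" "append_config (u @ x # y # v) z (Suc c) = y" for x y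
    using assms by (auto simp: append_config_def nth_append)
  have r: "insert_two c x' y' (remove_two c (append_config (u @ x # y # v) z)) = append_config (u @ x' # y' # v) z" for x y x' y'
  proof
    fix j
    consider "j < c" | "j = c" | "j = Suc c" | "Suc (Suc c) \<le> j" by linarith
    then show "insert_two c x' y' (remove_two c (append_config (u @ x # y # v) z)) j = append_config (u @ x' # y' # v) z j"
      using assms by cases (auto simp: insert_two_def remove_two_def append_config_def nth_append)
  qed
  show "act (OverNE, c) f (append_config (u @ True # True # v) z) = hpow 1 * f (append_config (u @ True # True # v) z)"
    "act (OverNE, c) f (append_config (u @ False # False # v) z) = hpow 1 * f (append_config (u @ False # False # v) z)"
    "act (OverNE, c) f (append_config (u @ False # True # v) z) = hpow (-1) * f (append_config (u @ True # False # v) z)"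
    "act (OverNE, c) f (append_config (u @ True # False # v) z) =
       (hpow 1 - hpow (-3)) * f (append_config (u @ True # False # v) z) + hpow (-1) * f (append_config (u @ False # True # v) z)"
    by (simp_all add: cup_op_def cap_op_def at cup_weight_def r algebra_simps)
qed

lemma push_op_Suc: "push_op (Suc c) x V = act (OverNE, c) (push_op c x V)"
  by (simp add: push_op_def)

text \<open>The exchange term of each crossing would leave a crossed strand down, where
  \<open>V\<close> vanishes. Hence the moving leg keeps its spin and picks up q^(1/2) or q^(-1/2) at
  each crossing.\<close>

lemma push_op_through_up:
  assumes "\<And>ls. length ls = N \<Longrightarrow> False \<in> set ls \<Longrightarrow> V (append_config ls z) = 0"
    and "length ls + length ls' = N" "length ls = c"
  shows "push_op c x V (append_config (ls @ y # ls') z)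
    = hpow (if y then int c else - int c) * cup_weight x y * V (append_config (ls @ ls') z)"
  using assms(2,3)
proof (induction c arbitrary: ls ls' y)
  case 0
  then show ?case using append_config_append[of "[y]" ls' z] by simp
next
  case (Suc c)
  then obtain u l where ls: "ls = u @ [l]" "length u = c" by (metis length_Suc_conv_rev)
  have zero: "V (append_config (u @ False # ls') z) = 0"
    using assms(1)[of "u @ False # ls'"] Suc.prems ls by simp
  have IH: "push_op c x V (append_config (u @ y # y' # ls') z)
    = hpow (if y then int c else - int c) * cup_weight x y * V (append_config (u @ y' # ls') z)" for y y'
    using Suc.IH[of u "y' # ls'" y] ls Suc.prems by simp
  show ?case
    unfolding push_op_Suc ls append.assoc append.simps
    by (cases l; cases y) (simp_all only: act_over[OF ls(2)] IH zero, simp_all add: algebra_simps)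
qed

lemma push_op_up:
  assumes "length st = c"
  shows "push_op c x V (append_config (st @ [True]) z) = hpow (weight st) * cup_weight x True * V (append_config st z)"
  using assms
proof (induction c arbitrary: st z)
  case 0
  then show ?case by simp
next
  case (Suc c)
  then obtain u l where st: "st = u @ [l]" "length u = c" by (metis length_Suc_conv_rev)
  have IH: "push_op c x V (append_config (u @ [True, y']) z)
    = hpow (weight u) * cup_weight x True * V (append_config (u @ [y']) z)" for y'
    using Suc.IH[of u "cons_config y' z"] st append_config_append[of "u @ [True]" "[y']" z]
      append_config_append[of u "[y']" z] by simp
  show ?case
    unfolding push_op_Suc st append.assoc append.simps
    by (cases l) (simp_all only: act_over[OF st(2)] IH, simp_all add: algebra_simps)
qed

text \<open>Read downwards from its end, a leg that starts down may exchange its spin with one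
  crossed up strand; below that crossing it is up and \<open>push_op_up\<close> applies. The sum
  over this crossing is \<open>raise_op\<close>. With \<open>x\<close> up the exchange terms carry a
  cup weight 0.\<close>

lemma push_op_down:
  assumes "length st = c"
  shows "push_op c x V (append_config (st @ [False]) z) =
    (if x then hpow (- weight st) * V (append_config st z) else - gap * raise_op (\<lambda>st. V (append_config st z)) st)"
  using assms
proof (induction c arbitrary: st z)
  case 0
  then show ?case by (simp add: cup_weight_def)
next
  case (Suc c)
  then obtain u l where st: "st = u @ [l]" "length u = c" by (metis length_Suc_conv_rev)
  have IH: "push_op c x V (append_config (u @ [False, y']) z)
    = (if x then hpow (- weight u) * V (append_config (u @ [y']) z) else - gap * raise_op (\<lambda>st. V (append_config (st @ [y']) z)) u)" for y'
    using Suc.IH[of u "cons_config y' z"] st append_config_append[of "u @ [False]" "[y']" z]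
    by (simp add: append_config_append)
  have up: "push_op c x V (append_config (u @ [True, y']) z)
    = hpow (weight u) * cup_weight x True * V (append_config (u @ [y']) z)" for y'
    using push_op_up[of u c x V "cons_config y' z"] st append_config_append[of "u @ [True]" "[y']" z]
      append_config_append[of u "[y']" z] by simp
  show ?case
    unfolding push_op_Suc st append.assoc append.simps
    by (cases l) (simp_all only: act_over[OF st(2)] IH up raise_op_snoc,
      (cases x; simp add: cup_weight_def gap_def algebra_simps)+)
qed


section \<open>The drawing of a dotted diagram\<close>

lemma sorted_keys:
  fixes f :: "'a \<Rightarrow> nat"
  assumes "inj_on f A" "finite A"
  shows "set (sorted_key_list_of_set f A) = A" "length (sorted_key_list_of_set f A) = card A"
    "sorted_wrt (<) (map f (sorted_key_list_of_set f A))"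
proof -
  interpret folding_insort_key "(\<le>)" "(<)" A f by unfold_locales (rule assms(1))
  show "set (sorted_key_list_of_set f A) = A" "length (sorted_key_list_of_set f A) = card A"
    "sorted_wrt (<) (map f (sorted_key_list_of_set f A))"
    unfolding linorder_class.sorted_key_list_of_set_dict
    by (rule set_sorted_key_list_of_set[OF subset_refl assms(2)] length_sorted_key_list_of_set[OF subset_refl]
      strict_sorted_key_list_of_set[OF subset_refl])+
qed

lemma map_enumerate_over:
  assumes "\<forall>(e, s, g)\<in>set xs. g < h"
  shows "map (\<lambda>(t, (e, s, g)). (if g < h then OverNE else OverNW, t)) (List.enumerate m xs)
    = map (\<lambda>t. (OverNE, t)) [m..<m + length xs]"
  using assms
proof (induction xs arbitrary: m)
  case (Cons x xs)
  have "[m..<m + length (x # xs)] = m # [Suc m..<m + length (x # xs)]" by (rule upt_conv_Cons) simp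
  then have "[m..<m + length (x # xs)] = m # [Suc m..<Suc m + length xs]" by simp
  then show ?case using Cons by (cases x) simp
qed simp

text \<open>The strands are drawn in the order of their left ends, so the drawing can be read
  endpoint by endpoint: a left end is a \<open>Push\<close> across the strands it meets, any other
  endpoint a \<open>Pop\<close>. By \<open>over\<close> the moving leg is always the upper
  one.\<close>

lemma draw_eq_tangle_of:
  assumes fin: "finite A" and inj: "inj_on fst A" and injs: "inj_on (\<lambda>(e, s, g). s) A"
    and N: "\<And>x. x \<in> A \<Longrightarrow> fst x < N"
    and over: "\<And>i j h e s g. (i, j, h) \<in> A \<Longrightarrow> (e, s, g) \<in> A \<Longrightarrow> e < i \<Longrightarrow> i < s \<Longrightarrow> s < j \<Longrightarrow> g < h"
    and push: "\<And>i j h. (i, j, h) \<in> A \<Longrightarrow> ev i = Push (card {(e, s, g) \<in> A. e < i \<and> i < s \<and> s < j})"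
    and pop: "\<And>i. i < N \<Longrightarrow> i \<notin> fst ` A \<Longrightarrow> ev i = Pop"
  shows "draw A = tangle_of 0 (map ev [0..<N])"
proof -
  have strand: "draw_strand A (i, j, h) @ w = (Cup, i) # map (\<lambda>t. (OverNE, t)) [Suc i..<Suc i + c] @ w"
    if x: "(i, j, h) \<in> A" and c: "ev i = Push c" for i j h c w
  proof -
    let ?S = "{(e, s, g) \<in> A. e < i \<and> i < s \<and> s < j}"
    have "inj_on (\<lambda>(e, s, g). s) ?S" using injs by (rule inj_on_subset) auto
    moreover have "finite ?S" using fin by (rule finite_subset[rotated]) auto
    ultimately have "set (crossed_strands A i j) = ?S" "length (crossed_strands A i j) = card ?S"
      unfolding crossed_strands_def by (rule sorted_keys)+
    note cs = this
    have "\<forall>(e, s, g)\<in>set (crossed_strands A i j). g < h"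
      unfolding cs(1) using over[OF x] by blast
    note m = map_enumerate_over[OF this, of "i + 1"]
    have "Push c = Push (card ?S)" by (rule trans[OF c[symmetric] push[OF x]])
    then have "length (crossed_strands A i j) = c" using cs(2) by simp
    then show ?thesis unfolding draw_strand_def prod.case m by simp
  qed
  have "concat (map (draw_strand A) xs) = tangle_of j (map ev [j..<N])"
    if "set xs \<subseteq> A" "sorted_wrt (<) (map fst xs)" "fst ` A \<inter> {j..} = fst ` set xs" "j \<le> N" for j xs
    using that
  proof (induction "N - j" arbitrary: j xs)
    case 0
    then have "j = N" by simp
    have "fst ` A \<inter> {N..} = {}" using N by (auto dest!: N)
    then have "fst ` set xs = {}" using "0.prems"(3) \<open>j = N\<close> by simp
    then show ?case using \<open>j = N\<close> by simp
  next
    case (Suc m)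
    then have jN: "j < N" by simp
    then have upt: "[j..<N] = j # [Suc j..<N]" by (simp add: upt_conv_Cons)
    show ?case
    proof (cases "j \<in> fst ` A")
      case False
      then have "j \<le> i \<longleftrightarrow> Suc j \<le> i" if "i \<in> fst ` A" for i
        using that by (cases "i = j") auto
      then have "fst ` A \<inter> {j..} = fst ` A \<inter> {Suc j..}" by blast
      then show ?thesis using Suc.hyps(1)[of "Suc j" xs] Suc.hyps(2) Suc.prems jN pop[OF jN False] upt by simp
    next
      case True
      then have "j \<in> fst ` set xs" using Suc.prems(3) by auto
      then obtain x xs' where xs: "xs = x # xs'" by (cases xs) auto
      have "fst x \<le> j" using \<open>j \<in> fst ` set xs\<close> Suc.prems(2) xs by fastforce
      moreover have "j \<le> fst x" using Suc.prems(3) xs by fastforce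
      ultimately have xj: "fst x = j" by simp
      then obtain s h where x: "x = (j, s, h)" by (cases x) auto
      then have xA: "(j, s, h) \<in> A" using Suc.prems(1) xs by auto
      have "fst ` A \<inter> {Suc j..} = fst ` set xs'"
      proof (intro subset_antisym subsetI)
        fix i assume i: "i \<in> fst ` A \<inter> {Suc j..}"
        then have "i \<in> fst ` A \<inter> {j..}" by simp
        then have "i \<in> insert j (fst ` set xs')" using Suc.prems(3) xs xj by simp
        then show "i \<in> fst ` set xs'" using i by auto
      next
        fix i assume "i \<in> fst ` set xs'"
        then show "i \<in> fst ` A \<inter> {Suc j..}" using Suc.prems(1,2) xs xj by auto
      qed
      then have "concat (map (draw_strand A) xs') = tangle_of (Suc j) (map ev [Suc j..<N])"
        using Suc.hyps(1)[of "Suc j" xs'] Suc.hyps(2) Suc.prems jN xs by simp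
      moreover obtain c where "ev j = Push c" using push[OF xA] by blast
      ultimately show ?thesis using strand[OF xA] xs x upt by simp
    qed
  qed
  from this[of "sorted_key_list_of_set fst A" 0] show ?thesis
    using sorted_keys[OF inj fin] by (simp add: draw_def)
qed

section \<open>Counting pending strands, and ranks of endpoints\<close>

fun height_run :: "nat \<Rightarrow> event list \<Rightarrow> nat option" where
  "height_run h [] = Some h"
| "height_run h (Push c # es) = (if c \<le> h then height_run (Suc h) es else None)"
| "height_run (Suc h) (Pop # es) = height_run h es"
| "height_run 0 (Pop # es) = None"

lemma height_run_append: "height_run h (es @ es') = Option.bind (height_run h es) (\<lambda>h. height_run h es')"
  by (induction h es rule: height_run.induct) auto

lemma from_to_overs: "b + 1 \<le> m \<Longrightarrow> from_to m (map (\<lambda>t. (OverNE, t)) [a..<b]) m"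
proof (induction "b - a" arbitrary: a)
  case (Suc c)
  then have "[a..<b] = a # [Suc a..<b]" by (simp add: upt_conv_Cons)
  then show ?case using Suc.hyps(1)[of "Suc a"] Suc.hyps(2) Suc.prems by (simp add: Suc_Suc_diff_2)
qed simp

lemma from_to_tangle_of:
  "height_run h es = Some h' \<Longrightarrow> from_to (j + h) (tangle_of j es) (j + length es + h')"
proof (induction h es arbitrary: j rule: height_run.induct)
  case (2 h c es)
  then have "c \<le> h" "from_to (Suc j + Suc h) (tangle_of (Suc j) es) (Suc j + length es + h')"
    using "2.IH"[of "Suc j"] by (auto split: if_splits)
  moreover have "from_to (j + h + 2) (map (\<lambda>t. (OverNE, t)) [Suc j..<Suc j + c]) (j + h + 2)"
    using \<open>c \<le> h\<close> by (intro from_to_overs) simp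
  ultimately show ?case by (auto simp: from_to_append simp del: upt_Suc)
next
  case (3 h es)
  then have "from_to (Suc j + h) (tangle_of (Suc j) es) (Suc j + length es + h')"
    using "3.IH"[of "Suc j"] by simp
  then show ?case by simp
qed auto

definition rank :: "nat set \<Rightarrow> nat \<Rightarrow> nat" where
  "rank X p = card {x \<in> X. x \<le> p}"

lemma rank_less: "finite X \<Longrightarrow> p < p' \<Longrightarrow> p' \<in> X \<Longrightarrow> rank X p < rank X p'"
proof -
  assume "finite X" "p < p'" "p' \<in> X"
  then have "{x \<in> X. x \<le> p} \<subseteq> {x \<in> X. x \<le> p'}" "p' \<in> {x \<in> X. x \<le> p'}" "p' \<notin> {x \<in> X. x \<le> p}"
    by auto
  then have "{x \<in> X. x \<le> p} \<subset> {x \<in> X. x \<le> p'}" by blast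
  then show ?thesis unfolding rank_def using \<open>finite X\<close> by (intro psubset_card_mono) auto
qed

lemma rank_bounds: "finite X \<Longrightarrow> p \<in> X \<Longrightarrow> 1 \<le> rank X p \<and> rank X p \<le> card X"
  unfolding rank_def using card_gt_0_iff[of "{x \<in> X. x \<le> p}"] card_mono[of X "{x \<in> X. x \<le> p}"] by fastforce

lemma rank_inj: "finite X \<Longrightarrow> inj_on (rank X) X"
  by (rule inj_onI) (metis linorder_neqE_nat rank_less less_irrefl)

lemma rank_surj: "finite X \<Longrightarrow> rank X ` X = {1..card X}"
proof -
  assume X: "finite X"
  have "rank X ` X \<subseteq> {1..card X}" using rank_bounds[OF X] by auto
  moreover have "card (rank X ` X) = card X" by (rule card_image[OF rank_inj[OF X]])
  ultimately show ?thesis by (intro card_subset_eq) auto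
qed


section \<open>Pending left rays and undotted arcs\<close>

text \<open>
  A pattern \<open>\<tau>\<close> lists the pending strands: \<open>True\<close> for a left strand of a dotted arc (a ray) and
  \<open>False\<close> for an undotted arc.
\<close>

fun undotted_spins :: "bool list \<Rightarrow> bool list \<Rightarrow> bool list" where
  "undotted_spins (True # \<tau>) (x # st) = undotted_spins \<tau> st"
| "undotted_spins (False # \<tau>) (x # st) = x # undotted_spins \<tau> st"
| "undotted_spins _ _ = []"

text \<open>The amplitude carried by the pending rays. Each must be up, and it has crossed exactly
  those open undotted arcs that end to its right, each with a factor q^(1/2) or q^(-1/2) according
  to its spin.\<close>

fun ray_weight :: "bool list \<Rightarrow> bool list \<Rightarrow> laurent" where
  "ray_weight (True # \<tau>) (x # st) = (if x then hpow (weight (undotted_spins \<tau> st)) * ray_weight \<tau> st else 0)"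
| "ray_weight (False # \<tau>) (x # st) = ray_weight \<tau> st"
| "ray_weight _ _ = 1"

abbreviation rays :: "bool list \<Rightarrow> nat" where
  "rays \<tau> \<equiv> length (filter (\<lambda>b. b) \<tau>)"

lemma ray_weight_weight:
  "length \<tau> = length st \<Longrightarrow> ray_weight \<tau> st \<noteq> 0 \<Longrightarrow> weight st = weight (undotted_spins \<tau> st) + int (rays \<tau>)"
  by (induction \<tau> st rule: ray_weight.induct) (auto split: if_splits)

lemma ray_weight_mult_hpow:
  assumes "length \<tau> = length st"
  shows "ray_weight \<tau> st * hpow (- weight st) = hpow (- int (rays \<tau>)) * ray_weight \<tau> st * hpow (- weight (undotted_spins \<tau> st))"
proof (cases "ray_weight \<tau> st = 0")
  case False
  have "hpow (- weight st) = hpow (- int (rays \<tau>)) * hpow (- weight (undotted_spins \<tau> st))"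
    unfolding hpow_mult ray_weight_weight[OF assms False] by (rule arg_cong[of _ _ hpow]) simp
  then show ?thesis by (simp only: mult_ac)
qed simp

text \<open>Turning a ray down gives weight 0, so only undotted arcs are raised. A ray to the right
  of the raised arc contributes q^(-1/2); a ray to its left contributes q^(1/2), but its weight
  drops by a factor q. So every ray costs q^(-1/2).\<close>

lemma raise_op_ray_weight:
  "length \<tau> = length st \<Longrightarrow> raise_op (\<lambda>st. ray_weight \<tau> st * v (undotted_spins \<tau> st)) st
    = hpow (- int (rays \<tau>)) * ray_weight \<tau> st * raise_op v (undotted_spins \<tau> st)"
proof (induction \<tau> st arbitrary: v rule: ray_weight.induct)
  case (1 \<tau> x st)
  show ?case
  proof (cases x)
    case True
    have "(\<lambda>st. ray_weight (True # \<tau>) (True # st) * v (undotted_spins (True # \<tau>) (True # st)))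
      = (\<lambda>st. ray_weight \<tau> st * (hpow (weight (undotted_spins \<tau> st)) * v (undotted_spins \<tau> st)))"
      by (simp add: algebra_simps)
    then have "raise_op (\<lambda>st. ray_weight (True # \<tau>) (True # st) * v (undotted_spins (True # \<tau>) (True # st))) st
      = hpow (- int (rays \<tau>)) * ray_weight \<tau> st * (hpow (weight (undotted_spins \<tau> st) - 2) * raise_op v (undotted_spins \<tau> st))"
      using True 1(1)[of "\<lambda>st. hpow (weight st) * v st"] 1(2) by (simp only: raise_op_weight) simp
    then show ?thesis
      using True by (simp add: raise_op_Cons algebra_simps)
  next
    case False
    then show ?thesis by (simp add: raise_op_Cons)
  qed
next
  case (2 \<tau> x st)
  then have IH: "raise_op (\<lambda>st. ray_weight \<tau> st * v (x # undotted_spins \<tau> st)) st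
    = hpow (- int (rays \<tau>)) * ray_weight \<tau> st * raise_op (\<lambda>st. v (x # st)) (undotted_spins \<tau> st)"
    using "2.IH"[of "\<lambda>st. v (x # st)"] by simp
  have "hpow (- weight st) * (ray_weight \<tau> st * v (False # undotted_spins \<tau> st))
    = (ray_weight \<tau> st * hpow (- weight st)) * v (False # undotted_spins \<tau> st)" by (simp only: mult_ac)
  also have "\<dots> = hpow (- int (rays \<tau>)) * ray_weight \<tau> st * hpow (- weight (undotted_spins \<tau> st)) * v (False # undotted_spins \<tau> st)"
    using 2 by (subst ray_weight_mult_hpow) auto
  finally have 1: "hpow (- weight st) * (ray_weight \<tau> st * v (False # undotted_spins \<tau> st))
    = hpow (- int (rays \<tau>)) * ray_weight \<tau> st * hpow (- weight (undotted_spins \<tau> st)) * v (False # undotted_spins \<tau> st)" .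
  have 2: "raise_op (\<lambda>st. ray_weight (False # \<tau>) st * v (undotted_spins (False # \<tau>) st)) (x # st)
    = (if x then hpow (- weight st) * (ray_weight \<tau> st * v (False # undotted_spins \<tau> st)) else 0)
      + hpow (if x then 1 else - 1) * raise_op (\<lambda>st. ray_weight \<tau> st * v (x # undotted_spins \<tau> st)) st"
    by (simp add: raise_op_Cons)
  show ?case
    unfolding 2 1 IH by (simp add: raise_op_Cons distrib_left mult_ac)
qed auto

lemma ray_weight_insert:
  "length ls = c \<Longrightarrow> length \<tau> = length st \<Longrightarrow>
   ray_weight (replicate c True @ False # \<tau>) (ls @ y # st)
   = hpow (if y then int c else - int c) * ray_weight (replicate c True @ \<tau>) (ls @ st)"
  and undotted_spins_insert:
  "length ls = c \<Longrightarrow> length \<tau> = length st \<Longrightarrow>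
   undotted_spins (replicate c True @ False # \<tau>) (ls @ y # st) = y # undotted_spins (replicate c True @ \<tau>) (ls @ st)"
proof (induction c arbitrary: ls)
  case (Suc c)
  case 1
  then obtain l ls' where "ls = l # ls'" "length ls' = c" by (cases ls) auto
  then show ?case using Suc 1 by (cases y) (auto simp: algebra_simps)
next
  case (Suc c)
  case 2
  then obtain l ls' where "ls = l # ls'" "length ls' = c" by (cases ls) auto
  then show ?case using Suc 2 by auto
qed auto

lemma ray_weight_rays_only:
  "length st = c \<Longrightarrow> undotted_spins (replicate c True) st = [] \<and>
     ray_weight (replicate c True) st = (if st = replicate c True then 1 else 0)"
proof (induction c arbitrary: st)
  case (Suc c)
  then obtain x st' where "st = x # st'" "length st' = c" by (cases st) auto
  then show ?case using Suc by auto
qed simp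

lemma ray_weight_False_prefix:
  "length ls = c \<Longrightarrow> False \<in> set ls \<Longrightarrow> ray_weight (replicate c True @ \<tau>) (ls @ st) = 0"
proof (induction c arbitrary: ls)
  case (Suc c)
  then obtain x ls' where "ls = x # ls'" "length ls' = c" by (cases ls) auto
  then show ?case using Suc by auto
qed simp

locale dotted_diagram =
  fixes n k :: nat and U D :: "arc set"
  assumes diagram: "(U, D) \<in> dotted_diagrams n k"
begin

abbreviation lefts :: "nat set" where "lefts \<equiv> fst ` D"
abbreviation rights :: "nat set" where "rights \<equiv> snd ` D"

lemma disjoint: "U \<inter> D = {}" and crossingless: "crossingless_matching n (U \<union> D)" and card_D: "card D = k"
  using diagram by (auto simp: dotted_diagrams_def)

lemma nc: "noncrossing (U \<union> D)"
  by (rule crossingless_noncrossing[OF crossingless])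

lemma finite_arcs: "finite U" "finite D"
  using crossingless_finite[OF crossingless] by auto

lemma bounds: "(a, b) \<in> U \<union> D \<Longrightarrow> 1 \<le> a \<and> a < b \<and> b \<le> 2 * n"
  by (rule crossingless_bounds[OF crossingless])

lemma distinct_ends:
  "(a, b) \<in> U \<union> D \<Longrightarrow> (c, d) \<in> U \<union> D \<Longrightarrow> (a, b) \<noteq> (c, d) \<Longrightarrow> a \<noteq> c \<and> a \<noteq> d \<and> b \<noteq> c \<and> b \<noteq> d"
  by (rule noncrossing_distinct[OF nc])

lemma left_iff: "p \<in> lefts \<longleftrightarrow> (\<exists>r. (p, r) \<in> D)" and right_iff: "r \<in> rights \<longleftrightarrow> (\<exists>p. (p, r) \<in> D)"
  by force+

lemma kinds_disjoint:
  "p \<in> lefts \<Longrightarrow> p \<notin> rights" "p \<in> lefts \<Longrightarrow> (p, e) \<notin> U" "p \<in> lefts \<Longrightarrow> (e, p) \<notin> U"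
  "p \<in> rights \<Longrightarrow> (p, e) \<notin> U" "p \<in> rights \<Longrightarrow> (e, p) \<notin> U" "(p, e) \<in> U \<Longrightarrow> (f, p) \<notin> U"
proof -
  show "p \<notin> rights" if "p \<in> lefts"
  proof
    assume "p \<in> rights"
    then obtain a b where ab: "(p, a) \<in> D" "(b, p) \<in> D" using \<open>p \<in> lefts\<close> by auto
    then have "(p, a) \<noteq> (b, p)" using bounds[of p a] by auto
    then show False using distinct_ends[of p a b p] ab by blast
  qed
  have X: "a \<noteq> c \<and> a \<noteq> d \<and> b \<noteq> c \<and> b \<noteq> d" if "(a, b) \<in> D" "(c, d) \<in> U" for a b c d
    using that distinct_ends[of a b c d] disjoint by blast
  show "(p, e) \<notin> U" if "p \<in> lefts" using that X unfolding left_iff by blast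
  show "(e, p) \<notin> U" if "p \<in> lefts" using that X unfolding left_iff by blast
  show "(p, e) \<notin> U" if "p \<in> rights" using that X unfolding right_iff by blast
  show "(e, p) \<notin> U" if "p \<in> rights" using that X unfolding right_iff by blast
  show "(f, p) \<notin> U" if "(p, e) \<in> U"
    using that distinct_ends[of p e f p] bounds[of p e] by auto
qed

lemma inj_fst_D: "inj_on fst D" and inj_snd_D: "inj_on snd D"
proof -
  show "inj_on fst D"
    by (rule inj_onI) (metis UnI2 distinct_ends prod.collapse)
  show "inj_on snd D"
    by (rule inj_onI) (metis UnI2 distinct_ends prod.collapse)
qed

lemma card_lefts: "card lefts = k" and card_rights: "card rights = k"
  using card_image[OF inj_fst_D] card_image[OF inj_snd_D] card_D by auto

lemma finite_ends: "finite lefts" "finite rights"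
  using finite_arcs by auto

lemma end_bounds: "p \<in> lefts \<Longrightarrow> 1 \<le> p \<and> p \<le> 2 * n" "p \<in> rights \<Longrightarrow> 1 \<le> p \<and> p \<le> 2 * n"
proof -
  show "1 \<le> p \<and> p \<le> 2 * n" if p: "p \<in> lefts"
  proof -
    obtain r where "(p, r) \<in> U \<union> D" using p unfolding left_iff by blast
    from bounds[OF this] show ?thesis by simp
  qed
  show "1 \<le> p \<and> p \<le> 2 * n" if p: "p \<in> rights"
  proof -
    obtain a where "(a, p) \<in> U \<union> D" using p unfolding right_iff by blast
    from bounds[OF this] show ?thesis by simp
  qed
qed

lemma rank_lefts: "p \<in> lefts \<Longrightarrow> 1 \<le> rank lefts p \<and> rank lefts p \<le> k"
  and rank_rights: "p \<in> rights \<Longrightarrow> 1 \<le> rank rights p \<and> rank rights p \<le> k"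
  using rank_bounds finite_ends card_lefts card_rights by metis+

section \<open>Strands of the drawing and their order\<close>

abbreviation "A \<equiv> psi_strands n k (U, D)"

lemma strand_cases:
  assumes "(i, j, h) \<in> A"
  obtains (undotted) a b where "(a, b) \<in> U" "i = k + a - 1" "j = k + b - 1" "h = 1"
    | (left) p where "p \<in> lefts" "i = k - rank lefts p" "j = k + p - 1" "h = 0"
    | (right) r where "r \<in> rights" "i = k + r - 1" "j = 2 * n + 2 * k - rank rights r" "h = 2"
proof -
  have "(\<exists>a b. (a, b) \<in> U \<and> i = k + a - 1 \<and> j = k + b - 1 \<and> h = 1)
    \<or> (\<exists>p. p \<in> lefts \<and> i = k - rank lefts p \<and> j = k + p - 1 \<and> h = 0)
    \<or> (\<exists>r. r \<in> rights \<and> i = k + r - 1 \<and> j = 2 * n + 2 * k - rank rights r \<and> h = 2)"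
    using assms unfolding psi_strands_def rank_def by blast
  then show ?thesis using undotted left right by blast
qed

lemma strand_intros:
  "(a, b) \<in> U \<Longrightarrow> (k + a - 1, k + b - 1, 1) \<in> A"
  "p \<in> lefts \<Longrightarrow> (k - rank lefts p, k + p - 1, 0) \<in> A"
  "r \<in> rights \<Longrightarrow> (k + r - 1, 2 * n + 2 * k - rank rights r, 2) \<in> A"
  unfolding psi_strands_def rank_def by auto

lemma finite_strands: "finite A"
proof -
  have "A = (\<lambda>(a, b). (k + a - 1, k + b - 1, 1)) ` U \<union> (\<lambda>p. (k - rank lefts p, k + p - 1, 0)) ` lefts
    \<union> (\<lambda>r. (k + r - 1, 2 * n + 2 * k - rank rights r, 2)) ` rights"
    unfolding psi_strands_def rank_def by auto
  then show ?thesis using finite_arcs by simp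
qed

lemma inj_strand_left: "inj_on fst A"
proof (rule inj_onI)
  fix x y assume "x \<in> A" "y \<in> A" "fst x = fst y"
  then obtain i j h j' h' where x: "x = (i, j, h)" "(i, j, h) \<in> A" and y: "y = (i, j', h')" "(i, j', h') \<in> A"
    by (metis prod.collapse)
  have "j = j' \<and> h = h'"
    using x(2)
  proof (cases rule: strand_cases)
    case (undotted a b)
    note u = this
    have a: "1 \<le> a" using bounds u by blast
    show ?thesis using y(2)
    proof (cases rule: strand_cases)
      case (undotted a' b')
      have "1 \<le> a'" using bounds[of a' b'] undotted(1) by auto
      then have "a = a'" using u(2) undotted(2) a by linarith
      then have "(a, b) = (a', b')" using distinct_ends[of a b a' b'] u(1) undotted(1) by blast
      then show ?thesis using u(3,4) undotted(3,4) by simp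
    next
      case (left p)
      then have "k - rank lefts p < k" using rank_lefts[of p] by simp
      then show ?thesis using u(2) left(2) a by linarith
    next
      case (right r)
      then have "a = r" using u(2) right(2) a end_bounds(2)[OF right(1)] by linarith
      then show ?thesis using u right kinds_disjoint(4) by blast
    qed
  next
    case (left p)
    note u = this
    have lt: "i < k" using u rank_lefts[of p] by simp
    show ?thesis using y(2)
    proof (cases rule: strand_cases)
      case (undotted a' b')
      then have "1 \<le> a'" using bounds[of a' b'] by auto
      then show ?thesis using lt undotted(2) by linarith
    next
      case (left p')
      then have "rank lefts p = rank lefts p'" using u(2) left(2) rank_lefts[OF u(1)] rank_lefts[OF left(1)] by linarith
      then have "p = p'" using inj_onD[OF rank_inj[OF finite_ends(1)]] u left by blast
      then show ?thesis using u(3,4) left(3,4) by simp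
    next
      case (right r)
      then show ?thesis using lt end_bounds(2)[of r] by linarith
    qed
  next
    case (right r)
    note u = this
    have a: "1 \<le> r" using end_bounds(2) u by blast
    show ?thesis using y(2)
    proof (cases rule: strand_cases)
      case (undotted a' b')
      have "1 \<le> a'" using bounds[of a' b'] undotted(1) by auto
      then have "a' = r" using u(2) undotted(2) a by linarith
      then show ?thesis using u undotted kinds_disjoint(4) by blast
    next
      case (left p)
      then have "k - rank lefts p < k" using rank_lefts[of p] by simp
      then show ?thesis using u(2) left(2) a by linarith
    next
      case (right r')
      then have "r = r'" using u(2) right(2) a end_bounds(2)[OF right(1)] by linarith
      then show ?thesis using u(3,4) right(3,4) by simp
    qed
  qed
  then show "x = y" using x y by simp
qed

lemma inj_strand_right: "inj_on (\<lambda>(e, s, g). s) A"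
proof (rule inj_onI)
  fix x y assume xy: "x \<in> A" "y \<in> A" "(\<lambda>(e, s, g). s) x = (\<lambda>(e, s, g). s) y"
  obtain i j h where x1: "x = (i, j, h)" by (cases x)
  obtain i' j' h' where y1: "y = (i', j', h')" by (cases y)
  have "j' = j" using xy(3) x1 y1 by simp
  then have x: "x = (i, j, h)" "(i, j, h) \<in> A" and y: "y = (i', j, h')" "(i', j, h') \<in> A"
    using xy(1,2) x1 y1 by simp_all
  have "i = i' \<and> h = h'"
    using x(2)
  proof (cases rule: strand_cases)
    case (undotted a b)
    note u = this
    have b: "1 \<le> b" "b \<le> 2 * n" using bounds[of a b] u by auto
    show ?thesis using y(2)
    proof (cases rule: strand_cases)
      case (undotted a' b')
      have "1 \<le> b'" using bounds[of a' b'] undotted(1) by auto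
      then have "b = b'" using u(3) undotted(3) b by linarith
      then have "(a, b) = (a', b')" using distinct_ends[of a b a' b'] u(1) undotted(1) by blast
      then show ?thesis using u(2,4) undotted(2,4) by simp
    next
      case (left p)
      then have "p = b" using u(3) left(3) b end_bounds(1)[OF left(1)] by linarith
      then show ?thesis using u left kinds_disjoint(3) by blast
    next
      case (right r)
      then show ?thesis using u(3) b rank_rights[of r] by linarith
    qed
  next
    case (left p)
    note u = this
    have p: "1 \<le> p" "p \<le> 2 * n" using end_bounds(1) u by blast+
    show ?thesis using y(2)
    proof (cases rule: strand_cases)
      case (undotted a' b')
      have "1 \<le> b'" using bounds[of a' b'] undotted(1) by auto
      then have "b' = p" using u(3) undotted(3) p by linarith
      then show ?thesis using u undotted kinds_disjoint(3) by blast
    next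
      case (left p')
      then have "p = p'" using u(3) left(3) p end_bounds(1)[OF left(1)] by linarith
      then show ?thesis using u(2,4) left(2,4) by simp
    next
      case (right r)
      then show ?thesis using u(3) p rank_rights[of r] by linarith
    qed
  next
    case (right r)
    note u = this
    show ?thesis using y(2)
    proof (cases rule: strand_cases)
      case (undotted a' b')
      then have "b' \<le> 2 * n" "1 \<le> b'" using bounds[of a' b'] by auto
      then show ?thesis using u(3) undotted(3) rank_rights[OF u(1)] by linarith
    next
      case (left p)
      then show ?thesis using u(3) rank_rights[OF u(1)] end_bounds(1)[of p] by linarith
    next
      case (right r')
      then have "rank rights r = rank rights r'" using u(3) right(3) rank_rights[OF u(1)] rank_rights[OF right(1)] by linarith
      then have "r = r'" using inj_onD[OF rank_inj[OF finite_ends(2)]] u right by blast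
      then show ?thesis using u(2,4) right(2,4) by simp
    qed
  qed
  then show "x = y" using x y by simp
qed

text \<open>The right ends, at or after \<open>p\<close>, of the left rays and of the undotted arcs open at \<open>p\<close>.\<close>

definition pending :: "nat \<Rightarrow> nat list" where
  "pending p = filter (\<lambda>j. j \<in> lefts \<or> (\<exists>e<p. (e, j) \<in> U)) [p..<Suc (2 * n)]"

text \<open>Earlier right strands end further right in the projector, so a new right strand crosses
  all of \<open>pending\<close> and none of them. A new undotted arc crosses just the rays that end
  under it.\<close>

definition middle_event :: "nat \<Rightarrow> event" where
  "middle_event p = (if p \<in> lefts then Pop else if p \<in> rights then Push (length (pending p))
     else if p \<in> fst ` U then Push (card {x \<in> lefts. p < x \<and> (\<exists>e. (p, e) \<in> U \<and> x < e)}) else Pop)"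

text \<open>The first k endpoints begin the rays, which are nested in one another and hence start
  without crossings; in the right projector only right strands end.\<close>

definition event_at :: "nat \<Rightarrow> event" where
  "event_at i = (if i < k then Push 0 else if i < k + 2 * n then middle_event (Suc (i - k)) else Pop)"

lemma event_at_middle: "1 \<le> p \<Longrightarrow> p \<le> 2 * n \<Longrightarrow> event_at (k + p - 1) = middle_event p"
proof -
  assume "1 \<le> p" "p \<le> 2 * n"
  then have "\<not> k + p - 1 < k" "k + p - 1 < k + 2 * n" "Suc (k + p - 1 - k) = p" by linarith+
  then show ?thesis by (simp only: event_at_def if_True if_False)
qed

lemma set_pending: "set (pending p) = {j. p \<le> j \<and> (j \<in> lefts \<or> (\<exists>e<p. (e, j) \<in> U))}"
proof (rule set_eqI)
  fix j
  have "j < Suc (2 * n)" if "j \<in> lefts"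
    using end_bounds(1)[OF that] by simp
  moreover have "j < Suc (2 * n)" if "(e, j) \<in> U" for e
    using bounds[of e j] that by simp
  moreover have "j \<in> set (pending p) \<longleftrightarrow> p \<le> j \<and> j < Suc (2 * n) \<and> (j \<in> lefts \<or> (\<exists>e<p. (e, j) \<in> U))"
    unfolding pending_def set_filter set_upt mem_Collect_eq atLeastLessThan_iff by blast
  ultimately show "j \<in> set (pending p) \<longleftrightarrow> j \<in> {j. p \<le> j \<and> (j \<in> lefts \<or> (\<exists>e<p. (e, j) \<in> U))}"
    by blast
qed

lemma card_crossing:
  assumes "X \<subseteq> {1..}"
    and "\<And>e s g. (e, s, g) \<in> A \<Longrightarrow> e < i \<Longrightarrow> i < s \<Longrightarrow> s < j \<Longrightarrow> \<exists>x\<in>X. s = k + x - 1"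
    and "\<And>x. x \<in> X \<Longrightarrow> \<exists>e g. (e, k + x - 1, g) \<in> A \<and> e < i \<and> i < k + x - 1 \<and> k + x - 1 < j"
  shows "card {(e, s, g) \<in> A. e < i \<and> i < s \<and> s < j} = card X"
proof -
  let ?S = "{(e, s, g) \<in> A. e < i \<and> i < s \<and> s < j}"
  have "inj_on (\<lambda>(e, s, g). s) ?S" using inj_strand_right by (rule inj_on_subset) auto
  then have "card ?S = card ((\<lambda>(e, s, g). s) ` ?S)" by (simp add: card_image)
  also have "(\<lambda>(e, s, g). s) ` ?S = (\<lambda>x. k + x - 1) ` X"
  proof (intro subset_antisym subsetI)
    fix s assume "s \<in> (\<lambda>(e, s, g). s) ` ?S"
    then obtain e g where "(e, s, g) \<in> A" "e < i" "i < s" "s < j" by (auto simp only:)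
    from assms(2)[OF this] show "s \<in> (\<lambda>x. k + x - 1) ` X" by (rule bexE) (rule image_eqI)
  next
    fix s assume "s \<in> (\<lambda>x. k + x - 1) ` X"
    then obtain x where x: "x \<in> X" "s = k + x - 1" by auto
    from assms(3)[OF x(1)] obtain e g where "(e, s, g) \<in> ?S" unfolding x(2) by blast
    then show "s \<in> (\<lambda>(e, s, g). s) ` ?S" by (intro image_eqI[of _ _ "(e, s, g)"]) auto
  qed
  also have "card \<dots> = card X"
  proof (rule card_image, rule inj_onI)
    fix x y assume xy: "x \<in> X" "y \<in> X" "k + x - 1 = k + y - 1"
    then have "1 \<le> x" "1 \<le> y" using assms(1) by auto
    then show "x = y" using xy(3) by linarith
  qed
  finally show ?thesis .
qed

lemma event_at_strand:
  assumes "(i, j, h) \<in> A"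
  shows "event_at i = Push (card {(e, s, g) \<in> A. e < i \<and> i < s \<and> s < j})"
  using assms
proof (cases rule: strand_cases)
  case (undotted a b)
  note o = undotted
  have ab: "1 \<le> a" "a < b" "b \<le> 2 * n" using bounds[of a b] undotted by auto
  have "a \<notin> lefts" "a \<notin> rights" "a \<in> fst ` U"
    using undotted kinds_disjoint(2,4) by (blast, blast, force)
  then have "event_at i = Push (card {x \<in> lefts. a < x \<and> (\<exists>e. (a, e) \<in> U \<and> x < e)})"
    using undotted(2) event_at_middle[of a] ab by (simp add: middle_event_def)
  also have "{x \<in> lefts. a < x \<and> (\<exists>e. (a, e) \<in> U \<and> x < e)} = {x \<in> lefts. a < x \<and> x < b}"
    using undotted distinct_ends[of a b a] by blast
  also have "card \<dots> = card {(e, s, g) \<in> A. e < i \<and> i < s \<and> s < j}"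
  proof (rule card_crossing[symmetric])
    show "{x \<in> lefts. a < x \<and> x < b} \<subseteq> {1..}" using ab by auto
  next
    fix e s g assume A: "(e, s, g) \<in> A" and *: "e < i" "i < s" "s < j"
    show "\<exists>x\<in>{x \<in> lefts. a < x \<and> x < b}. s = k + x - 1"
      using A
    proof (cases rule: strand_cases)
      case (undotted a' b')
      note u = this
      have ab': "1 \<le> a'" "a' < b'" "b' \<le> 2 * n" using bounds[of a' b'] u by auto
      have "a' < a" "a < b'" "b' < b" using * u(2,3) o(2,3) ab ab' by linarith+
      moreover have "(a', b') \<in> U \<union> D" "(a, b) \<in> U \<union> D" using u(1) o(1) by auto
      ultimately have "b < b'" using noncrossing_no_cross[OF nc] by blast
      then show ?thesis using \<open>b' < b\<close> by simp
    next
      case (left p)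
      have "a < p" "p < b" using * o(2,3) left(3) ab end_bounds(1)[OF left(1)] by linarith+
      then show ?thesis using left by (intro bexI[of _ p]) auto
    next
      case (right r)
      have False using * o(3) right(3) ab rank_rights[OF right(1)] by linarith
      then show ?thesis ..
    qed
  next
    fix x assume x: "x \<in> {x \<in> lefts. a < x \<and> x < b}"
    then have "(k - rank lefts x, k + x - 1, 0) \<in> A" by (intro strand_intros) auto
    moreover have "k - rank lefts x < k" using rank_lefts[of x] x by auto
    ultimately show "\<exists>e g. (e, k + x - 1, g) \<in> A \<and> e < i \<and> i < k + x - 1 \<and> k + x - 1 < j"
      using o(2,3) ab x by (intro exI[of _ "k - rank lefts x"] exI[of _ 0]) auto
  qed
  finally show ?thesis .
next
  case (left p)
  note u = this
  have lt: "i < k" using u rank_lefts[of p] by simp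
  then have "event_at i = Push (card ({} :: nat set))" by (simp add: event_at_def)
  also have "card ({} :: nat set) = card {(e, s, g) \<in> A. e < i \<and> i < s \<and> s < j}"
  proof (rule card_crossing[symmetric])
    fix e s g assume A: "(e, s, g) \<in> A" and *: "e < i" "i < s" "s < j"
    show "\<exists>x\<in>({} :: nat set). s = k + x - 1"
      using A
    proof (cases rule: strand_cases)
      case (undotted a' b')
      then have "1 \<le> a'" using bounds[of a' b'] by auto
      then have False using undotted(2) lt * by linarith
      then show ?thesis ..
    next
      case (left p')
      then have "rank lefts p < rank lefts p'"
        using u(2) left(2) * rank_lefts[OF u(1)] rank_lefts[OF left(1)] by linarith
      then have "\<not> p' < p" using rank_less[OF finite_ends(1), of p' p] u by auto
      then have False using left(3) * u(3) end_bounds(1)[of p] end_bounds(1)[of p'] by linarith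
      then show ?thesis ..
    next
      case (right r)
      then have False using end_bounds(2)[OF right(1)] lt * by linarith
      then show ?thesis ..
    qed
  qed auto
  finally show ?thesis .
next
  case (right r)
  note o = right
  have r: "1 \<le> r" "r \<le> 2 * n" using end_bounds(2) right by blast+
  have "r \<notin> lefts" using right kinds_disjoint(1) by blast
  then have "event_at i = Push (length (pending r))"
    using right(1,2) event_at_middle[OF r] by (simp add: middle_event_def)
  also have "length (pending r) = card (set (pending r))"
    by (rule distinct_card[symmetric]) (simp add: pending_def)
  also have "card (set (pending r)) = card {(e, s, g) \<in> A. e < i \<and> i < s \<and> s < j}"
  proof (rule card_crossing[symmetric])
    show "set (pending r) \<subseteq> {1..}" using r by (auto simp: set_pending)
  next
    fix e s g assume A: "(e, s, g) \<in> A" and *: "e < i" "i < s" "s < j"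
    show "\<exists>x\<in>set (pending r). s = k + x - 1"
      using A
    proof (cases rule: strand_cases)
      case (undotted a b)
      then have "1 \<le> a" "1 \<le> b" using bounds[of a b] by auto
      then have "a < r" "r < b" using undotted(2,3) * o(2) r by linarith+
      then show ?thesis using undotted(1,3)
        by (intro bexI[of _ b]) (auto simp: set_pending)
    next
      case (left p)
      have "r < p" using left(3) * o(2) r end_bounds(1)[OF left(1)] by linarith
      then show ?thesis using left(1,3) by (intro bexI[of _ p]) (auto simp: set_pending)
    next
      case (right r')
      note u = this
      have "r' < r" using u(2) * o(2) r end_bounds(2)[OF u(1)] by linarith
      then have "rank rights r' < rank rights r" using rank_less[OF finite_ends(2)] o(1) by blast
      then have False using u(3) * o(3) rank_rights[OF o(1)] rank_rights[OF u(1)] by linarith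
      then show ?thesis ..
    qed
  next
    fix x assume x: "x \<in> set (pending r)"
    have j: "2 * n + k \<le> j" using right rank_rights[of r] by linarith
    have "x \<noteq> r" using x \<open>r \<notin> lefts\<close> right kinds_disjoint(5) by (auto simp: set_pending)
    then have "r < x" using x by (auto simp: set_pending)
    show "\<exists>e g. (e, k + x - 1, g) \<in> A \<and> e < i \<and> i < k + x - 1 \<and> k + x - 1 < j"
    proof (cases "x \<in> lefts")
      case True
      then show ?thesis
        using strand_intros(2)[OF True] rank_lefts[OF True] end_bounds(1)[OF True] o(2) r j \<open>r < x\<close>
        by (intro exI[of _ "k - rank lefts x"] exI[of _ 0]) (simp, linarith)
    next
      case False
      then obtain e where e: "e < r" "(e, x) \<in> U" using x by (auto simp: set_pending)
      moreover have "1 \<le> e \<and> e < x \<and> x \<le> 2 * n" using e(2) by (intro bounds) simp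
      ultimately show ?thesis
        using strand_intros(1)[OF e(2)] o(2) r j \<open>r < x\<close>
        by (intro exI[of _ "k + e - 1"] exI[of _ 1]) (simp, linarith)
    qed
  qed
  finally show ?thesis .
qed

lemma draw_strands: "draw A = tangle_of 0 (map event_at [0..<2 * (n + k)])"
proof (rule draw_eq_tangle_of[OF finite_strands inj_strand_left inj_strand_right])
  show "fst x < 2 * (n + k)" if "x \<in> A" for x
  proof -
    obtain i j h where x: "x = (i, j, h)" by (cases x)
    have "(i, j, h) \<in> A" using that x by simp
    then have "i < 2 * (n + k)"
    proof (cases rule: strand_cases)
      case (undotted a b)
      then have "1 \<le> a \<and> a < b \<and> b \<le> 2 * n" by (intro bounds) simp
      then show ?thesis using undotted(2) by arith
    next
      case (left p)
      then show ?thesis using left(2) rank_lefts[OF left(1)] by arith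
    next
      case (right r)
      then show ?thesis using right(2) end_bounds(2)[OF right(1)] by arith
    qed
    then show ?thesis using x by simp
  qed
  show "g < h" if ij: "(i, j, h) \<in> A" and es: "(e, s, g) \<in> A" and *: "e < i" "i < s" "s < j" for i j h e s g
    using ij
  proof (cases rule: strand_cases)
    case (undotted a b)
    note u = this
    have ab: "1 \<le> a" "a < b" "b \<le> 2 * n" using bounds[of a b] u by auto
    show ?thesis using es
    proof (cases rule: strand_cases)
      case (undotted a' b')
      have ab': "1 \<le> a'" "a' < b'" "b' \<le> 2 * n" using bounds[of a' b'] undotted by auto
      have "a' < a" "a < b'" "b' < b" using * u(2,3) undotted(2,3) ab ab' by linarith+
      moreover have "(a', b') \<in> U \<union> D" "(a, b) \<in> U \<union> D" using u(1) undotted(1) by auto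
      ultimately have "b < b'" using noncrossing_no_cross[OF nc] by blast
      then show ?thesis using \<open>b' < b\<close> by simp
    next
      case (left p)
      then show ?thesis using u by simp
    next
      case (right r)
      have False using u(3) ab * right(3) rank_rights[OF right(1)] by linarith
      then show ?thesis ..
    qed
  next
    case (left p)
    \<comment> \<open>A ray meets no strand drawn before it: its event is \<open>Push 0\<close>, so
      the crossing assumed here does not exist.\<close>
    then have "Push (card {(e, s, g) \<in> A. e < i \<and> i < s \<and> s < j}) = Push 0"
      using event_at_strand[OF ij] rank_lefts[of p] by (simp add: event_at_def)
    moreover have "finite {(e, s, g) \<in> A. e < i \<and> i < s \<and> s < j}"
      using finite_strands by (rule finite_subset[rotated]) auto
    ultimately show ?thesis using es * by auto
  next
    case (right r)
    note u = this
    show ?thesis using es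
    proof (cases rule: strand_cases)
      case (undotted a b)
      then show ?thesis using u by simp
    next
      case (left p)
      then show ?thesis using u by simp
    next
      case (right r')
      have r: "1 \<le> r" "1 \<le> r'" using end_bounds(2) right u by blast+
      have "r' < r" using right(2) * u(2) r by linarith
      then have "rank rights r' < rank rights r" using rank_less[OF finite_ends(2)] u(1) by blast
      then have False using u(3) right(3) * rank_rights[OF u(1)] rank_rights[OF right(1)] by linarith
      then show ?thesis ..
    qed
  qed
  show "event_at i = Push (card {(e, s, g) \<in> A. e < i \<and> i < s \<and> s < j})" if "(i, j, h) \<in> A" for i j h
    by (rule event_at_strand[OF that])
  show "event_at i = Pop" if i: "i < 2 * (n + k)" and out: "i \<notin> fst ` A" for i
  proof (cases "i < k")
    case True
    then have "k - i \<in> rank lefts ` lefts" unfolding rank_surj[OF finite_ends(1)] card_lefts by auto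
    then obtain p where p: "p \<in> lefts" "rank lefts p = k - i" by (metis imageE)
    have "(k - rank lefts p, k + p - 1, 0) \<in> A" by (rule strand_intros(2)[OF p(1)])
    then have "i \<in> fst ` A" using p(2) True by (auto intro: image_eqI[rotated])
    then show ?thesis using out by simp
  next
    case ik: False
    show ?thesis
    proof (cases "i < k + 2 * n")
      case True
      define p where "p = Suc (i - k)"
      then have ip: "i = k + p - 1" using ik by simp
      have out': "(k + p - 1, j, h) \<notin> A" for j h
        using out ip image_eqI[of i fst "(i, j, h)" A] by auto
      have "p \<notin> rights"
        using strand_intros(3)[of p] out' by blast
      moreover have "p \<notin> fst ` U"
      proof
        assume "p \<in> fst ` U"
        then obtain e where "(p, e) \<in> U" by auto
        from strand_intros(1)[OF this] show False using out' by blast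
      qed
      ultimately show ?thesis using ik True by (simp add: event_at_def middle_event_def p_def[symmetric])
    next
      case False
      then show ?thesis using ik by (simp add: event_at_def)
    qed
  qed
qed

end

text \<open>The weight of the k cups that begin the rays. Each has its left leg down and its right
  leg up, so the constant is \<open>(- hpow 2)\<close> to the power k, the same for all
  diagrams.\<close>

definition ray_const :: "nat \<Rightarrow> laurent" where
  "ray_const k = (SOME c. scan (events_of (replicate k True)) (replicate k False) (\<lambda>_. 1) = starts_with (replicate k True) c)"

lemma ray_const:
  "scan (events_of (replicate k True)) (replicate k False) (\<lambda>_. 1) = starts_with (replicate k True) (ray_const k)"
proof -
  have "follow (replicate j True) (replicate j False) stk = Some (replicate j True @ stk)" for j stk
    by (induction j arbitrary: stk) (simp_all add: replicate_app_Cons_same)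
  then have "follow (replicate k True) (replicate k False) [] = Some (replicate k True)" by simp
  moreover have st1: "starts_with [] 1 = (\<lambda>_. 1)" by (simp add: fun_eq_iff starts_with_def)
  ultimately have "\<exists>c. scan (events_of (replicate k True)) (replicate k False) (\<lambda>_. 1) = starts_with (replicate k True) c"
    using scan_follow_Some[of "replicate k True" "replicate k False" "[]" "replicate k True" 1] unfolding st1 by auto
  then show ?thesis unfolding ray_const_def by (rule someI_ex)
qed

context dotted_diagram
begin

lemma event_at_upt:
  "map event_at [0..<k] = events_of (replicate k True)"
  "map event_at [k + 2 * n..<2 * (n + k)] = replicate k Pop"
proof -
  show "map event_at [0..<k] = events_of (replicate k True)"
    by (rule nth_equalityI) (auto simp: event_at_def events_of_def)
  show "map event_at [k + 2 * n..<2 * (n + k)] = replicate k Pop"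
    by (rule nth_equalityI) (auto simp: event_at_def)
qed

lemma pending_tail:
  assumes "\<And>j. (p, j) \<notin> U"
  shows "filter (\<lambda>j. j \<in> lefts \<or> (\<exists>e<p. (e, j) \<in> U)) [Suc p..<Suc (2 * n)] = pending (Suc p)"
  unfolding pending_def using assms by (intro filter_cong) (auto simp: less_Suc_eq simp del: upt_Suc)

lemma pending_unfold:
  assumes "p \<le> 2 * n"
  shows "pending p = (if p \<in> lefts \<or> (\<exists>e<p. (e, p) \<in> U) then [p] else [])
    @ filter (\<lambda>j. j \<in> lefts \<or> (\<exists>e<p. (e, j) \<in> U)) [Suc p..<Suc (2 * n)]"
proof -
  have "[p..<Suc (2 * n)] = p # [Suc p..<Suc (2 * n)]" using assms by (intro upt_conv_Cons) simp
  then show ?thesis unfolding pending_def by (simp del: upt_Suc)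
qed

lemma pending_not_open:
  assumes "p \<le> 2 * n" "\<And>j. (p, j) \<notin> U"
  shows "pending p = (if p \<in> lefts \<or> (\<exists>e<p. (e, p) \<in> U) then [p] else []) @ pending (Suc p)"
  using pending_unfold[OF assms(1)] unfolding pending_tail[OF assms(2)] .

lemma pending_left: "p \<in> lefts \<Longrightarrow> pending p = p # pending (Suc p)"
  using pending_not_open[of p] end_bounds(1)[of p] kinds_disjoint(2)[of p] by simp

lemma pending_close: "(e, p) \<in> U \<Longrightarrow> pending p = p # pending (Suc p)"
proof -
  assume e: "(e, p) \<in> U"
  then have "e < p" "p \<le> 2 * n" using bounds[of e p] by auto
  moreover have "(p, j) \<notin> U" for j using kinds_disjoint(6) e by blast
  ultimately have "pending p = (if p \<in> lefts \<or> (\<exists>e<p. (e, p) \<in> U) then [p] else []) @ pending (Suc p)"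
    by (intro pending_not_open)
  moreover have "p \<in> lefts \<or> (\<exists>e<p. (e, p) \<in> U)" using e \<open>e < p\<close> by blast
  ultimately show ?thesis by simp
qed

lemma pending_right: "p \<in> rights \<Longrightarrow> pending (Suc p) = pending p"
proof -
  assume p: "p \<in> rights"
  then have "p \<le> 2 * n" "\<And>j. (p, j) \<notin> U" using end_bounds(2) kinds_disjoint(4) by blast+
  then have "pending p = (if p \<in> lefts \<or> (\<exists>e<p. (e, p) \<in> U) then [p] else []) @ pending (Suc p)"
    by (intro pending_not_open)
  moreover have "\<not> (p \<in> lefts \<or> (\<exists>e<p. (e, p) \<in> U))" using p kinds_disjoint(1,5) by blast
  ultimately show ?thesis by simp
qed

text \<open>The right end \<open>b\<close> of the new arc is inserted into the pending list.
  Everything before it is a ray, because an open undotted arc ending before \<open>b\<close> would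
  cross the new arc.\<close>

lemma pending_open:
  assumes "(p, b) \<in> U"
  obtains X Y where "pending p = X @ Y" "pending (Suc p) = X @ b # Y" "set X \<subseteq> lefts"
    "length X = card {x \<in> lefts. p < x \<and> (\<exists>e. (p, e) \<in> U \<and> x < e)}" "b \<notin> lefts"
proof -
  let ?P = "\<lambda>j. j \<in> lefts \<or> (\<exists>e<p. (e, j) \<in> U)"
  let ?P' = "\<lambda>j. j \<in> lefts \<or> (\<exists>e<Suc p. (e, j) \<in> U)"
  let ?X = "filter ?P [Suc p..<b]" and ?Y = "filter ?P [Suc b..<Suc (2 * n)]"
  have pb: "1 \<le> p" "p < b" "b \<le> 2 * n" using bounds[of p b] assms by auto
  have uniq: "(p, j) \<in> U \<longleftrightarrow> j = b" for j using assms distinct_ends[of p b p j] by auto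
  have split: "[Suc p..<Suc (2 * n)] = [Suc p..<b] @ b # [Suc b..<Suc (2 * n)]"
    using pb upt_add_eq_append[of "Suc p" b "Suc (2 * n) - b"] upt_conv_Cons[of b "Suc (2 * n)"] by simp
  have "p \<notin> lefts" using kinds_disjoint(2) assms by blast
  moreover have "(e, p) \<notin> U" for e using kinds_disjoint(6) assms by blast
  moreover have "\<not> ?P b"
  proof -
    have "b \<notin> lefts" using kinds_disjoint(3) assms by blast
    moreover have "(e, b) \<notin> U" if "e < p" for e
    proof
      assume "(e, b) \<in> U"
      moreover have "(e, b) \<noteq> (p, b)" using that by simp
      ultimately show False using distinct_ends[of e b p b] assms by blast
    qed
    ultimately show ?thesis by blast
  qed
  ultimately have 1: "pending p = ?X @ ?Y"
    using pending_unfold[of p] pb unfolding split by (simp del: upt_Suc)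
  have "filter ?P' [Suc p..<b] = ?X" "filter ?P' [Suc b..<Suc (2 * n)] = ?Y"
    using uniq by (auto intro!: filter_cong simp: less_Suc_eq simp del: upt_Suc)
  then have 2: "pending (Suc p) = ?X @ b # ?Y"
    unfolding pending_def split using assms by (auto simp del: upt_Suc)
  have 3: "set ?X \<subseteq> lefts"
  proof
    fix j assume "j \<in> set ?X"
    then have j: "p < j" "j < b" "?P j" by auto
    have "(e, j) \<notin> U" if "e < p" for e
    proof
      assume "(e, j) \<in> U"
      then have "b < j" using noncrossing_no_cross[OF nc, of e j p b] assms that j by blast
      then show False using j by simp
    qed
    then show "j \<in> lefts" using j by blast
  qed
  have "length ?X = card (set ?X)" by (rule distinct_card[symmetric]) simp
  also have "set ?X = {x \<in> lefts. p < x \<and> (\<exists>e. (p, e) \<in> U \<and> x < e)}"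
    using 3 uniq by auto
  finally have 4: "length ?X = card {x \<in> lefts. p < x \<and> (\<exists>e. (p, e) \<in> U \<and> x < e)}" .
  show ?thesis using that[OF 1 2 3 4] \<open>\<not> ?P b\<close> by blast
qed

lemma pending_first: "length (pending 1) = k" "set (pending 1) \<subseteq> lefts"
proof -
  have "(e, j) \<notin> U" if "e < 1" for e j using bounds[of e j] that by auto
  then have s: "set (pending 1) = lefts"
    unfolding set_pending using end_bounds(1) by auto
  then show "set (pending 1) \<subseteq> lefts" by simp
  have "length (pending 1) = card (set (pending 1))" by (rule distinct_card[symmetric]) (simp add: pending_def)
  then show "length (pending 1) = k" using s card_lefts by simp
qed

lemma pending_last: "pending (Suc (2 * n)) = []"
  by (simp add: pending_def)

lemma middle_cases:
  assumes "1 \<le> p" "p \<le> 2 * n"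
  obtains (left) "p \<in> lefts" | (right) "p \<in> rights" "p \<notin> lefts"
    | (begins) b where "(p, b) \<in> U" "p \<notin> lefts" "p \<notin> rights"
    | (ends) e where "(e, p) \<in> U" "p \<notin> lefts" "p \<notin> rights" "p \<notin> fst ` U"
proof -
  have "1 \<le> p" "p < Suc (2 * n)" using assms by simp_all
  then obtain x y where xy: "(x, y) \<in> U \<union> D" "p = x \<or> p = y" "1 \<le> x" "y < Suc (2 * n)"
    by (rule coveredE[OF crossingless_covered[OF crossingless]])
  consider "p \<in> lefts" | "p \<in> rights" "p \<notin> lefts" | "p \<notin> lefts" "p \<notin> rights" by blast
  then show ?thesis
  proof cases
    case 3
    then have "(x, y) \<in> U" using xy left_iff right_iff by blast
    then show ?thesis
      using xy(2) 3 begins ends kinds_disjoint(6) by (metis (no_types, lifting) imageE prod.collapse)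
  qed (use left right in blast)+
qed

section \<open>The scan of a dotted diagram, endpoint by endpoint\<close>

definition passed :: "nat \<Rightarrow> nat" where
  "passed p = card {r \<in> rights. r < p}"

definition crossed_rays :: "nat \<Rightarrow> nat" where
  "crossed_rays p = (\<Sum>r\<in>{r \<in> rights. r < p}. card {x \<in> lefts. r < x})"

lemma passed_Suc: "passed (Suc p) = (if p \<in> rights then Suc (passed p) else passed p)"
  and crossed_rays_Suc: "crossed_rays (Suc p) = (if p \<in> rights then card {x \<in> lefts. p < x} else 0) + crossed_rays p"
proof -
  have "{r \<in> rights. r < Suc p} = (if p \<in> rights then insert p {r \<in> rights. r < p} else {r \<in> rights. r < p})"
    by (auto simp: less_Suc_eq)
  moreover have "finite {r \<in> rights. r < p}" using finite_ends by simp
  ultimately show "passed (Suc p) = (if p \<in> rights then Suc (passed p) else passed p)"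
    "crossed_rays (Suc p) = (if p \<in> rights then card {x \<in> lefts. p < x} else 0) + crossed_rays p"
    by (simp_all add: passed_def crossed_rays_def)
qed

lemma passed_first: "passed 1 = 0" "crossed_rays 1 = 0"
proof -
  have "{r \<in> rights. r < 1} = {}" using end_bounds(2) by fastforce
  then show "passed 1 = 0" "crossed_rays 1 = 0"
    unfolding passed_def crossed_rays_def by (simp_all only: card.empty sum.empty)
qed

lemma passed_last: "passed (Suc (2 * n)) = k"
proof -
  have "{r \<in> rights. r < Suc (2 * n)} = rights" using end_bounds(2) by fastforce
  then show ?thesis by (simp add: passed_def card_rights)
qed

lemma height_middle:
  "p \<le> 2 * n \<Longrightarrow> height_run 0 (map event_at [0..<k + p]) = Some (length (pending (Suc p)) + passed (Suc p))"
proof (induction p)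
  case 0
  have "height_run j (map event_at [0..<i]) = Some (j + i)" if "i \<le> k" for i j
    using that
  proof (induction i)
    case (Suc i)
    then show ?case by (simp add: height_run_append event_at_def)
  qed simp
  then show ?case using pending_first passed_first by simp
next
  case (Suc p)
  let ?p = "Suc p"
  have p: "1 \<le> ?p" "?p \<le> 2 * n" using Suc by auto
  have ev: "event_at (k + p) = middle_event ?p" using event_at_middle[OF p] by simp
  have IH: "height_run 0 (map event_at [0..<k + Suc p]) = height_run (length (pending ?p) + passed ?p) [middle_event ?p]"
    using Suc ev by (simp add: height_run_append)
  show ?case
    using p
  proof (cases rule: middle_cases)
    case left
    then have "?p \<notin> rights" using kinds_disjoint(1) by blast
    then show ?thesis
      unfolding IH using left pending_left[OF left] passed_Suc[of ?p] by (simp add: middle_event_def)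
  next
    case right
    then show ?thesis
      unfolding IH using pending_right[OF right(1)] passed_Suc[of ?p] by (simp add: middle_event_def)
  next
    case (begins b)
    then have "?p \<in> fst ` U" by force
    obtain X Y where XY: "pending ?p = X @ Y" "pending (Suc ?p) = X @ b # Y" "set X \<subseteq> lefts"
      "length X = card {x \<in> lefts. ?p < x \<and> (\<exists>e. (?p, e) \<in> U \<and> x < e)}" "b \<notin> lefts"
      by (rule pending_open[OF begins(1)])
    have "middle_event ?p = Push (length X)"
      unfolding middle_event_def XY(4) using begins(2,3) \<open>?p \<in> fst ` U\<close> by (simp only: if_True if_False)
    then show ?thesis
      unfolding IH using XY(1,2) begins(3) passed_Suc[of ?p] by simp
  next
    case (ends e)
    then show ?thesis
      unfolding IH using pending_close[OF ends(1)] passed_Suc[of ?p] by (simp add: middle_event_def)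
  qed
qed

lemma events_split:
  "[0..<2 * (n + k)] = [0..<k + 2 * n] @ [k + 2 * n..<2 * (n + k)]"
  using upt_add_eq_append[of 0 "k + 2 * n" k] by (simp add: algebra_simps)

lemma draw_tangles: "draw A \<in> tangles n k"
proof -
  have "height_run (j + i) (replicate j Pop) = Some i" for i j
    by (induction j arbitrary: i) auto
  from this[of k 0] have "height_run 0 (map event_at [0..<2 * (n + k)]) = Some 0"
    unfolding events_split map_append height_run_append event_at_upt(2)
    using height_middle[of "2 * n"] pending_last passed_last by simp
  from from_to_tangle_of[OF this, of 0] show ?thesis
    unfolding draw_strands tangles_def by simp
qed

lemma scan_pops: "length xs = m \<Longrightarrow> scan (replicate m Pop) xs V st = V (append_config xs st)"
proof (induction m arbitrary: xs V)
  case (Suc m)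
  then obtain x xs' where "xs = x # xs'" "length xs' = m" by (cases xs) auto
  then show ?case using Suc.IH[of xs'] append_config_append[of "[x]" xs' st] by simp
qed simp

definition middle_spins :: "config \<Rightarrow> config" where
  "middle_spins s p = s (k + p - 1)"

definition partial_sum :: "config \<Rightarrow> nat \<Rightarrow> config \<Rightarrow> laurent" where
  "partial_sum s i = scan (map event_at [0..<i]) (map s [0..<i]) (\<lambda>_. 1)"

lemma partial_sum_Suc: "partial_sum s (Suc i) = scan [event_at i] [s i] (partial_sum s i)"
  unfolding partial_sum_def by (simp add: scan_append)

abbreviation ray_pattern :: "nat \<Rightarrow> bool list" where
  "ray_pattern p \<equiv> map (\<lambda>j. j \<in> lefts) (pending p)"

lemma rays_ray_pattern: "p \<notin> lefts \<Longrightarrow> rays (ray_pattern p) = card {x \<in> lefts. p < x}"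
proof -
  assume p: "p \<notin> lefts"
  have "rays (ray_pattern p) = length (filter (\<lambda>j. j \<in> lefts) (pending p))"
    by (simp add: filter_map o_def)
  also have "\<dots> = card (set (filter (\<lambda>j. j \<in> lefts) (pending p)))"
    by (rule distinct_card[symmetric]) (simp add: pending_def)
  also have "set (filter (\<lambda>j. j \<in> lefts) (pending p)) = {x \<in> lefts. p < x}"
  proof (rule set_eqI)
    fix x
    have "x \<in> lefts \<Longrightarrow> p \<le> x \<longleftrightarrow> p < x" using p by (cases "x = p") auto
    then show "x \<in> set (filter (\<lambda>j. j \<in> lefts) (pending p)) \<longleftrightarrow> x \<in> {x \<in> lefts. p < x}"
      unfolding set_filter set_pending by blast
  qed
  finally show ?thesis .
qed

text \<open>The invariant that compares the tangle with \<open>scan_range\<close>. An undotted arc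
  crosses its rays when it is opened, whereas \<open>scan_step\<close> accounts for them when the
  ray ends; \<open>ray_weight\<close> holds the difference. The power \<open>crossed_rays\<close>
  collects the crossings of right strands with rays, and the started right strands stand last, all
  with spin down.\<close>

lemma partial_sum_middle:
  assumes proj: "projected n k s" and "p \<le> 2 * n" "length st = length (pending (Suc p))"
  shows "partial_sum s (k + p) (append_config (st @ replicate (passed (Suc p)) False) z)
    = ray_const k * hpow (- int (crossed_rays (Suc p)))
      * (ray_weight (ray_pattern (Suc p)) st
         * scan_range U D (middle_spins s) 1 (Suc p) (\<lambda>_. 1) (undotted_spins (ray_pattern (Suc p)) st))"
  using assms(2,3)
proof (induction p arbitrary: st z)
  case 0
  have "map s [0..<k] = replicate k False"
    using proj by (intro replicate_eqI) (auto simp: projected_def)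
  then have 1: "partial_sum s k = starts_with (replicate k True) (ray_const k)"
    unfolding partial_sum_def event_at_upt(1) by (simp only: ray_const)
  have len: "length st = k" using 0 pending_first(1) by simp
  have "map (append_config st z) [0..<k] = st"
    using len by (intro nth_equalityI) (auto simp: append_config_def)
  then have 2: "partial_sum s k (append_config st z) = (if st = replicate k True then ray_const k else 0)"
    unfolding 1 starts_with_def by simp
  have "ray_pattern 1 = replicate k True"
    using pending_first by (intro replicate_eqI) auto
  then show ?case
    using 2 ray_weight_rays_only[OF len] passed_first by simp
next
  case (Suc p)
  let ?p = "Suc p"
  let ?v = "scan_range U D (middle_spins s) 1 ?p (\<lambda>_. 1)"
  let ?c = "ray_const k * hpow (- int (crossed_rays ?p))"
  let ?z = "append_config (replicate (passed ?p) False) z"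
  have p: "1 \<le> ?p" "?p \<le> 2 * n" using Suc.prems by auto
  have ev: "event_at (k + p) = middle_event ?p" using event_at_middle[OF p] by simp
  have sp: "s (k + p) = middle_spins s ?p" by (simp add: middle_spins_def)
  have next_sum: "partial_sum s (k + Suc p) = scan [middle_event ?p] [middle_spins s ?p] (partial_sum s (k + p))"
    using partial_sum_Suc[of s "k + p"] ev sp by simp
  have next_range: "scan_range U D (middle_spins s) 1 (Suc ?p) (\<lambda>_. 1) = scan_step U D (middle_spins s) ?p ?v"
    using scan_range_split[of 1 ?p "Suc ?p" U D "middle_spins s" "\<lambda>_. 1"] by (simp add: scan_range_single)
  have IH: "partial_sum s (k + p) (append_config st ?z) = ?c * (ray_weight (ray_pattern ?p) st * ?v (undotted_spins (ray_pattern ?p) st))"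
    if "length st = length (pending ?p)" for st
    using Suc.IH[OF _ that, of z] Suc.prems by (simp add: append_config_append)
  show ?case
    using p
  proof (cases rule: middle_cases)
    \<comment> \<open>When a ray ends, its factor leaves \<open>ray_weight\<close> and becomes the
      factor K of \<open>scan_step\<close>.\<close>
    case left
    then have nr: "?p \<notin> rights" using kinds_disjoint(1) by blast
    have cons: "cons_config x (append_config st ?z) = append_config (x # st) ?z" for x
      using append_config_append[of "[x]" st ?z] by simp
    have "partial_sum s (k + Suc p) (append_config st ?z)
      = ?c * (ray_weight (ray_pattern ?p) (middle_spins s ?p # st) * ?v (undotted_spins (ray_pattern ?p) (middle_spins s ?p # st)))"
    proof -
      have "middle_event ?p = Pop" using left by (simp add: middle_event_def)
      moreover have "length (middle_spins s ?p # st) = length (pending ?p)"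
        using Suc.prems(2) pending_left[OF left] by simp
      ultimately show ?thesis unfolding next_sum by (simp only: scan.simps cons IH)
    qed
    then show ?thesis
      unfolding next_range using left nr pending_left[OF left] passed_Suc[of ?p] crossed_rays_Suc[of ?p]
      by (simp add: append_config_append scan_step_def)
  next
    case (ends e)
    have cons: "cons_config x (append_config st ?z) = append_config (x # st) ?z" for x
      using append_config_append[of "[x]" st ?z] by simp
    have "partial_sum s (k + Suc p) (append_config st ?z)
      = ?c * (ray_weight (ray_pattern ?p) (middle_spins s ?p # st) * ?v (undotted_spins (ray_pattern ?p) (middle_spins s ?p # st)))"
    proof -
      have "middle_event ?p = Pop" using ends by (simp add: middle_event_def)
      moreover have "length (middle_spins s ?p # st) = length (pending ?p)"
        using Suc.prems(2) pending_close[OF ends(1)] by simp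
      ultimately show ?thesis unfolding next_sum by (simp only: scan.simps cons IH)
    qed
    then show ?thesis
      unfolding next_range using ends pending_close[OF ends(1)] passed_Suc[of ?p] crossed_rays_Suc[of ?p]
      by (simp add: append_config_append scan_step_def)
  next
    case right
    have len: "length st = length (pending ?p)" using Suc.prems(2) pending_right[OF right(1)] by simp
    have len': "length (ray_pattern ?p) = length st" using len by simp
    \<comment> \<open>The end of the new right strand joins the block of right strands: the extra
      \<open>False\<close> in front of \<open>?z\<close> is its spin in the projector.\<close>
    have cfg: "append_config (st @ replicate (passed (Suc ?p)) False) z = append_config (st @ [False]) ?z"
      using right passed_Suc[of ?p] append_config_append[of "st @ [False]" "replicate (passed ?p) False" z] by simp
    have ro: "raise_op (\<lambda>st. partial_sum s (k + p) (append_config st ?z)) st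
      = ?c * (hpow (- int (rays (ray_pattern ?p))) * ray_weight (ray_pattern ?p) st * raise_op ?v (undotted_spins (ray_pattern ?p) st))"
    proof -
      have "raise_op (\<lambda>st. partial_sum s (k + p) (append_config st ?z)) st
        = raise_op (\<lambda>st. ?c * (ray_weight (ray_pattern ?p) st * ?v (undotted_spins (ray_pattern ?p) st))) st"
        by (rule raise_op_cong) (use len IH in simp)
      also have "\<dots> = ?c * raise_op (\<lambda>st. ray_weight (ray_pattern ?p) st * ?v (undotted_spins (ray_pattern ?p) st)) st"
        by (rule raise_op_scale)
      finally show ?thesis unfolding raise_op_ray_weight[OF len'] .
    qed
    have "partial_sum s (k + Suc p) (append_config (st @ replicate (passed (Suc ?p)) False) z)
      = push_op (length (pending ?p)) (middle_spins s ?p) (partial_sum s (k + p)) (append_config (st @ [False]) ?z)"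
      unfolding next_sum cfg using right by (simp add: middle_event_def)
    also have "\<dots> = (if middle_spins s ?p then hpow (- weight st) * partial_sum s (k + p) (append_config st ?z)
      else - gap * raise_op (\<lambda>st. partial_sum s (k + p) (append_config st ?z)) st)"
      by (rule push_op_down[OF len])
    also have "\<dots> = ?c * hpow (- int (rays (ray_pattern ?p))) * (ray_weight (ray_pattern ?p) st
      * scan_step U D (middle_spins s) ?p ?v (undotted_spins (ray_pattern ?p) st))"
    proof (cases "middle_spins s ?p")
      case True
      have "hpow (- weight st) * partial_sum s (k + p) (append_config st ?z)
        = ?c * (ray_weight (ray_pattern ?p) st * hpow (- weight st)) * ?v (undotted_spins (ray_pattern ?p) st)"
        unfolding IH[OF len] by (simp only: mult_ac)
      moreover have "scan_step U D (middle_spins s) ?p ?v st' = hpow (- weight st') * ?v st'" for st'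
        using True right by (simp add: scan_step_def)
      ultimately show ?thesis
        unfolding ray_weight_mult_hpow[OF len'] if_P[OF True] by (simp only: mult_ac)
    next
      case False
      then show ?thesis unfolding ro using right by (simp add: scan_step_def mult_ac)
    qed
    finally have "partial_sum s (k + Suc p) (append_config (st @ replicate (passed (Suc ?p)) False) z)
      = ?c * hpow (- int (rays (ray_pattern ?p))) * (ray_weight (ray_pattern ?p) st
      * scan_step U D (middle_spins s) ?p ?v (undotted_spins (ray_pattern ?p) st))" .
    moreover have "hpow (- int (crossed_rays (Suc ?p))) = hpow (- int (crossed_rays ?p)) * hpow (- int (rays (ray_pattern ?p)))"
      unfolding crossed_rays_Suc rays_ray_pattern[OF right(2)] hpow_mult using right(1)
      by (intro arg_cong[of _ _ hpow]) simp
    ultimately show ?thesis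
      unfolding next_range pending_right[OF right(1)] by (simp only: mult_ac)
  next
    case (begins b)
    have opens: "?p \<in> fst ` U" using begins(1) by force
    obtain X Y where XY: "pending ?p = X @ Y" "pending (Suc ?p) = X @ b # Y" "set X \<subseteq> lefts"
      "length X = card {x \<in> lefts. ?p < x \<and> (\<exists>e. (?p, e) \<in> U \<and> x < e)}" "b \<notin> lefts"
      by (rule pending_open[OF begins(1)])
    have me: "middle_event ?p = Push (length X)"
      unfolding middle_event_def XY(4) using begins(2,3) opens by (simp only: if_True if_False)
    let ?x = "middle_spins s ?p"
    have pat: "map (\<lambda>j. j \<in> lefts) X = replicate (length X) True"
      using XY(3) by (intro replicate_eqI) auto
    let ?\<tau> = "map (\<lambda>j. j \<in> lefts) Y"
    have pats: "ray_pattern ?p = replicate (length X) True @ ?\<tau>"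
      "ray_pattern (Suc ?p) = replicate (length X) True @ False # ?\<tau>"
      unfolding XY(1,2) using pat XY(5) by simp_all
    have "length st = length X + Suc (length Y)" using Suc.prems(2) XY(2) by simp
    then have "st = take (length X) st @ st ! length X # drop (Suc (length X)) st"
      "length (take (length X) st) = length X" "length (drop (Suc (length X)) st) = length Y"
      by (simp_all add: id_take_nth_drop)
    then obtain ls y st' where st: "st = ls @ y # st'" "length ls = length X" "length st' = length Y"
      by blast
    \<comment> \<open>The rays ending under the new arc must be up, which is the support condition
      of \<open>push_op_through_up\<close>.\<close>
    have V0: "partial_sum s (k + p) (append_config ls'' (append_config st' ?z)) = 0"
      if "length ls'' = length X" "False \<in> set ls''" for ls''
    proof -
      have "partial_sum s (k + p) (append_config (ls'' @ st') ?z) = 0"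
        using IH[of "ls'' @ st'"] that st XY(1) ray_weight_False_prefix[OF that(1,2), of ?\<tau> st'] unfolding pats by simp
      then show ?thesis by (simp add: append_config_append)
    qed
    have "partial_sum s (k + Suc p) (append_config st ?z)
      = push_op (length X) ?x (partial_sum s (k + p)) (append_config (ls @ y # []) (append_config st' ?z))"
      unfolding next_sum me using append_config_append[of "ls @ [y]" st' ?z] st(1) by simp
    also have "\<dots> = hpow (if y then int (length X) else - int (length X)) * cup_weight ?x y
       * partial_sum s (k + p) (append_config (ls @ []) (append_config st' ?z))"
      by (rule push_op_through_up[of "length X"]) (use V0 st in auto)
    also have "partial_sum s (k + p) (append_config (ls @ []) (append_config st' ?z)) =
      ?c * (ray_weight (ray_pattern ?p) (ls @ st') * ?v (undotted_spins (ray_pattern ?p) (ls @ st')))"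
      using IH[of "ls @ st'"] st XY(1) by (simp add: append_config_append)
    finally have "partial_sum s (k + Suc p) (append_config st ?z)
      = ?c * (ray_weight (ray_pattern (Suc ?p)) st * (cup_weight ?x y * ?v (undotted_spins (ray_pattern ?p) (ls @ st'))))"
      unfolding pats st(1) using st by (simp add: ray_weight_insert mult_ac)
    moreover have "scan_step U D (middle_spins s) ?p ?v (undotted_spins (ray_pattern (Suc ?p)) st)
      = cup_weight ?x y * ?v (undotted_spins (ray_pattern ?p) (ls @ st'))"
      unfolding pats st(1) using st begins opens by (simp add: undotted_spins_insert scan_step_def)
    ultimately show ?thesis
      unfolding next_range using begins passed_Suc[of ?p] crossed_rays_Suc[of ?p]
      by (simp add: append_config_append)
  qed
qed

lemma spin_sum_draw:
  assumes proj: "projected n k s"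
  shows "spin_sum (draw A) s = ray_const k * hpow (- int (crossed_rays (Suc (2 * n)))) * arc_value n (middle_spins s) (U, D)"
proof -
  let ?z = "\<lambda>j. s (2 * (n + k) + j)"
  have "map s [k + 2 * n..<2 * (n + k)] = replicate k False"
    using proj by (intro replicate_eqI) (auto simp: projected_def)
  then have m: "map s [0..<2 * (n + k)] = map s [0..<k + 2 * n] @ replicate k False"
    by (simp only: events_split map_append)
  have e: "map event_at [0..<2 * (n + k)] = map event_at [0..<k + 2 * n] @ replicate k Pop"
    by (simp only: events_split map_append event_at_upt(2))
  have "spin_sum (draw A) s = partial_sum s (k + 2 * n) (append_config ([] @ replicate (passed (Suc (2 * n))) False) ?z)"
  proof -
    have l: "length (map event_at [0..<2 * (n + k)]) = 2 * (n + k)" by simp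
    show ?thesis
      unfolding draw_strands spin_sum_tangle_of l unfolding e m
      by (simp add: scan_append scan_pops partial_sum_def passed_last)
  qed
  also have "\<dots> = ray_const k * hpow (- int (crossed_rays (Suc (2 * n))))
      * (1 * scan_range U D (middle_spins s) 1 (Suc (2 * n)) (\<lambda>_. 1) [])"
    using partial_sum_middle[OF proj, of "2 * n" "[]" ?z] pending_last by simp
  \<comment> \<open>At the end no undotted arc is open, and on the empty spin list E K acts as
    0.\<close>
  also have "scan_range U D (middle_spins s) 1 (Suc (2 * n)) (\<lambda>_. 1) [] = arc_value n (middle_spins s) (U, D)"
    unfolding scan_range_eq_poly_op[OF nc disjoint crossingless_covered[OF crossingless]] poly_op_Nil
    by (simp add: arc_value_def)
  finally show ?thesis by simp
qed

lemma crossed_rays_last: "crossed_rays (Suc (2 * n)) = card {(y, z) \<in> D \<times> D. snd y < fst z}"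
proof -
  have "{r \<in> rights. r < Suc (2 * n)} = rights" using end_bounds(2) by fastforce
  then have "crossed_rays (Suc (2 * n)) = (\<Sum>y\<in>D. card {x \<in> lefts. snd y < x})"
    unfolding crossed_rays_def by (simp add: sum.reindex[OF inj_snd_D])
  also have "\<dots> = (\<Sum>y\<in>D. card {z \<in> D. snd y < fst z})"
  proof (rule sum.cong[OF refl])
    fix y assume "y \<in> D"
    have "{x \<in> lefts. snd y < x} = fst ` {z \<in> D. snd y < fst z}" by auto
    then show "card {x \<in> lefts. snd y < x} = card {z \<in> D. snd y < fst z}"
      using inj_on_subset[OF inj_fst_D] by (simp add: card_image)
  qed
  also have "\<dots> = card (SIGMA y:D. {z \<in> D. snd y < fst z})"
    using finite_arcs by simp
  also have "(SIGMA y:D. {z \<in> D. snd y < fst z}) = {(y, z) \<in> D \<times> D. snd y < fst z}" by auto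
  finally show ?thesis .
qed

text \<open>Two distinct arcs without crossing are nested or separated, so the ordered pairs split
  into both kinds and their swaps. Separated pairs contribute \<open>hpow (-1)\<close> each through
  the crossing of a right strand with a ray; the normalization gives the same factor to nested
  pairs, so the total depends on k alone.\<close>

lemma nested_or_separated:
  "2 * (nested_dotted_pairs (U, D) + crossed_rays (Suc (2 * n))) = k * k - k"
proof -
  let ?N = "{(y, z) \<in> D \<times> D. nested y z}" and ?S = "{(y, z) \<in> D \<times> D. snd y < fst z}"
  have fin: "finite ?N" "finite ?S"
    by (rule finite_subset[of _ "D \<times> D"], use finite_arcs in auto)+
  have swap: "card (prod.swap ` X) = card X" for X :: "(arc \<times> arc) set"
    by (rule card_image) simp
  have less: "fst y < snd y" if "y \<in> D" for y using bounds[of "fst y" "snd y"] that by simp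
  have "D \<times> D - Id_on D = (?N \<union> prod.swap ` ?N) \<union> (?S \<union> prod.swap ` ?S)"
  proof (intro subset_antisym subsetI)
    fix x assume "x \<in> D \<times> D - Id_on D"
    then obtain a b c d where x: "x = ((a, b), (c, d))" "(a, b) \<in> D" "(c, d) \<in> D" "(a, b) \<noteq> (c, d)" by auto
    have d: "a \<noteq> c" "a \<noteq> d" "b \<noteq> c" "b \<noteq> d" using distinct_ends[of a b c d] x by blast+
    have l: "a < b" "c < d" using less x by auto
    have cross: "a < c \<Longrightarrow> c < b \<Longrightarrow> d < b" "c < a \<Longrightarrow> a < d \<Longrightarrow> b < d"
      using noncrossing_no_cross[OF nc] x(2,3) by blast+
    consider "b < c" | "d < a" | "c < a" "b < d" | "a < c" "d < b"
      using d l cross by linarith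
    then show "x \<in> (?N \<union> prod.swap ` ?N) \<union> (?S \<union> prod.swap ` ?S)"
    proof cases
      case 1 then show ?thesis using x by auto
    next
      case 2 then have "((c, d), (a, b)) \<in> ?S" using x by auto
      then show ?thesis using x(1) by (auto intro!: image_eqI[of _ prod.swap "((c, d), (a, b))"])
    next
      case 3 then show ?thesis using x by (auto simp: nested_def)
    next
      case 4 then have "((c, d), (a, b)) \<in> ?N" using x by (auto simp: nested_def)
      then show ?thesis using x(1) by (auto intro!: image_eqI[of _ prod.swap "((c, d), (a, b))"])
    qed
  next
    fix x assume "x \<in> (?N \<union> prod.swap ` ?N) \<union> (?S \<union> prod.swap ` ?S)"
    then show "x \<in> D \<times> D - Id_on D" using less by (fastforce simp: nested_def)
  qed
  moreover have "?N \<inter> prod.swap ` ?N = {}" "?S \<inter> prod.swap ` ?S = {}"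
    "(?N \<union> prod.swap ` ?N) \<inter> (?S \<union> prod.swap ` ?S) = {}"
    by (auto simp: nested_def dest!: less)
  ultimately have "card (D \<times> D - Id_on D) = 2 * (card ?N + card ?S)"
    using fin by (simp add: card_Un_disjoint swap)
  moreover have "card (Id_on D) = k"
  proof -
    have "Id_on D = (\<lambda>y. (y, y)) ` D" by auto
    then show ?thesis using card_D by (simp add: card_image inj_on_def)
  qed
  moreover have "card (D \<times> D - Id_on D) = card (D \<times> D) - card (Id_on D)"
    by (rule card_Diff_subset) (auto intro: finite_subset[OF Id_on_subset_Times] simp: finite_arcs)
  ultimately show ?thesis
    unfolding crossed_rays_last nested_dotted_pairs_def using card_D by (simp add: card_cartesian_product)
qed

text \<open>The scalar in front is independent of the diagram, so a linear relation between the
  numbers \<open>arc_value\<close> is a relation between the values of the tangles.\<close>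

lemma spin_eval_psi:
  assumes "projected n k s"
  shows "spin_eval (psi_diagram n k (U, D)) s
    = ray_const k * hpow (- int ((k * k - k) div 2)) * arc_value n (middle_spins s) (U, D)"
proof -
  have "(k * k - k) div 2 = nested_dotted_pairs (U, D) + crossed_rays (Suc (2 * n))"
    using nested_or_separated by simp
  then show ?thesis
    unfolding psi_diagram_def spin_eval_smult spin_eval_basis spin_sum_draw[OF assms]
    by (simp add: mult_ac)
qed

lemma psi_diagram_free: "psi_diagram n k (U, D) \<in> free_on (tangles n k)"
  unfolding psi_diagram_def by (intro free.subspace_scale[OF subspace_free_on] basis_free_on draw_tangles)

end


section \<open>The Russell relations\<close>

lemma spin_eval_lin_ext_basis:
  assumes "x \<in> dotted_diagrams n k" "projected n k s"
  shows "spin_eval (lin_ext q_to_half (psi_diagram n k) (basis x)) s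
    = ray_const k * hpow (- int ((k * k - k) div 2)) * arc_value n (\<lambda>p. s (k + p - 1)) x"
proof -
  obtain U D where x: "x = (U, D)" by (cases x)
  interpret dotted_diagram n k U D by unfold_locales (use assms x in simp)
  have "middle_spins s = (\<lambda>p. s (k + p - 1))" by (simp add: fun_eq_iff middle_spins_def)
  then show ?thesis using spin_eval_psi[OF assms(2)] by (simp add: x lin_ext_basis laurent_hom_q_to_half)
qed

lemma psi_diagram_free_on:
  assumes "x \<in> dotted_diagrams n k"
  shows "psi_diagram n k x \<in> free_on (tangles n k)"
proof -
  obtain U D where x: "x = (U, D)" by (cases x)
  interpret dotted_diagram n k U D by unfold_locales (use assms x in simp)
  show ?thesis unfolding x by (rule psi_diagram_free)
qed

lemma psi_image_null:
  assumes keys: "r \<in> free_on (dotted_diagrams n k)"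
    and zero: "\<And>s. projected n k s \<Longrightarrow> spin_eval (lin_ext q_to_half (psi_diagram n k) r) s = 0"
  shows "lin_ext q_to_half (psi_diagram n k) r \<in> null_space \<kappa> n k"
proof (rule null_space_criterion)
  show "lin_ext q_to_half (psi_diagram n k) r \<in> free_on (tangles n k)"
  proof (rule lin_ext_mem[OF subspace_free_on])
    fix x assume "x \<in> Poly_Mapping.keys r"
    then show "psi_diagram n k x \<in> free_on (tangles n k)"
      using keys by (intro psi_diagram_free_on) (auto simp: free_on_def)
  qed
qed (rule zero)

lemma dotted_diagramsI:
  "U \<inter> D = {} \<Longrightarrow> crossingless_matching n (U \<union> D) \<Longrightarrow> card D = k \<Longrightarrow> (U, D) \<in> dotted_diagrams n k"
  by (simp add: dotted_diagrams_def)

lemmas spin_eval_linear = lin_ext_diff[OF laurent_hom_q_to_half] lin_ext_add[OF laurent_hom_q_to_half]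
  lin_ext_smult[OF laurent_hom_q_to_half] lin_ext_sum[OF laurent_hom_q_to_half]
  spin_eval_diff spin_eval_add spin_eval_smult spin_eval_sum q_to_half_qpow q_to_half_diff q_to_half_1

lemma type_I_null:
  assumes "r \<in> type_I n k"
  shows "lin_ext q_to_half (psi_diagram n k) r \<in> null_space \<kappa> n k"
proof -
  obtain a b c d U D where r: "r = basis (insert (a, d) U, insert (b, c) D)
      - (basis (insert (c, d) U, insert (a, b) D)
         + basis (insert (a, b) U, insert (c, d) D)
         + smult (qpow (-1)) (basis (insert (b, c) U, insert (a, d) D))
         + smult (1 - qpow (-2))
             (\<Sum>x\<in>enclosing U a d.
                smult (qpow (int (depth U a d x) - int (dots_between D a d x)))
                  (basis (insert (a, b) (insert (c, d) U) - {x}, insert x D))))"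
    and ord: "a < b" "b < c" "c < d"
    and x1: "(insert (a, d) U, insert (b, c) D) \<in> dotted_diagrams n k"
    and x2: "(insert (c, d) U, insert (a, b) D) \<in> dotted_diagrams n k"
    using assms unfolding type_I_def by blast
  have disj: "U \<inter> D = {}" using x1 by (auto simp: dotted_diagrams_def)
  have M1: "crossingless_matching n (insert (a, d) (insert (b, c) (U \<union> D)))"
    using x1 by (simp add: dotted_diagrams_def Un_insert_right Un_insert_left insert_commute)
  have M2: "crossingless_matching n (insert (a, b) (insert (c, d) (U \<union> D)))"
    using x2 by (simp add: dotted_diagrams_def Un_insert_right Un_insert_left insert_commute)
  have out: "(a, b) \<notin> U \<union> D" "(c, d) \<notin> U \<union> D" "(a, d) \<notin> U \<union> D" "(b, c) \<notin> U \<union> D"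
    using two_completions(6)[OF M1 M2 ord] by blast+
  have fin: "finite D" using crossingless_finite[OF M1] by simp
  have card: "Suc (card D) = k" using x1 fin out by (simp add: dotted_diagrams_def)
  have x3: "(insert (a, b) U, insert (c, d) D) \<in> dotted_diagrams n k"
    by (rule dotted_diagramsI) (use disj out M2 ord card fin in \<open>auto simp: insert_commute\<close>)
  have x4: "(insert (b, c) U, insert (a, d) D) \<in> dotted_diagrams n k"
    by (rule dotted_diagramsI) (use disj out M1 ord card fin in \<open>auto simp: insert_commute\<close>)
  have xs: "(insert (a, b) (insert (c, d) U) - {x}, insert x D) \<in> dotted_diagrams n k" if "x \<in> enclosing U a d" for x
  proof (rule dotted_diagramsI)
    have x: "x \<in> U" using that by (simp add: enclosing_def)
    then show "(insert (a, b) (insert (c, d) U) - {x}) \<inter> insert x D = {}" using disj out by auto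
    have "(insert (a, b) (insert (c, d) U) - {x}) \<union> insert x D = insert (a, b) (insert (c, d) (U \<union> D))" using x by auto
    then show "crossingless_matching n ((insert (a, b) (insert (c, d) U) - {x}) \<union> insert x D)" using M2 by simp
    have "x \<notin> D" using x disj by blast
    then show "card (insert x D) = k" using fin card by simp
  qed
  show ?thesis
  proof (rule psi_image_null)
    show "r \<in> free_on (dotted_diagrams n k)"
      unfolding r using x1 x2 x3 x4 xs
      by (intro free.subspace_diff[OF subspace_free_on] free.subspace_add[OF subspace_free_on]
          free.subspace_scale[OF subspace_free_on] free.subspace_sum[OF subspace_free_on] basis_free_on)
  next
    fix s assume s: "projected n k s"
    let ?K = "ray_const k * hpow (- int ((k * k - k) div 2))"
    let ?t = "\<lambda>p. s (k + p - 1)"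
    have ev: "spin_eval (lin_ext q_to_half (psi_diagram n k) (basis x)) s = ?K * arc_value n ?t x"
      if "x \<in> dotted_diagrams n k" for x
      using spin_eval_lin_ext_basis[OF that s] .
    have sum: "(\<Sum>x\<in>enclosing U a d. hpow (2 * (int (depth U a d x) - int (dots_between D a d x)))
        * spin_eval (lin_ext q_to_half (psi_diagram n k) (basis (insert (a, b) (insert (c, d) U) - {x}, insert x D))) s)
      = ?K * (\<Sum>x\<in>enclosing U a d. hpow (2 * (int (depth U a d x) - int (dots_between D a d x)))
        * arc_value n ?t (insert (a, b) (insert (c, d) U) - {x}, insert x D))"
      unfolding sum_distrib_left by (rule sum.cong[OF refl]) (simp only: ev[OF xs] mult_ac)
    show "spin_eval (lin_ext q_to_half (psi_diagram n k) r) s = 0"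
      unfolding r spin_eval_linear sum ev[OF x1] ev[OF x2] ev[OF x3] ev[OF x4] type_I_value[OF disj M1 M2 ord]
      by (simp add: algebra_simps)
  qed
qed

lemma type_II_null:
  assumes "r \<in> type_II n k"
  shows "lin_ext q_to_half (psi_diagram n k) r \<in> null_space \<kappa> n k"
proof -
  obtain a b c d U D where r: "r = basis (U, insert (a, b) (insert (c, d) D))
      - (basis (U, insert (a, d) (insert (b, c) D))
         + smult (1 - qpow (-2))
             (\<Sum>x\<in>enclosing U a d.
                smult (qpow (int (depth U a d x) - 1 - int (dots_between D a d x)))
                  (basis (insert (b, c) U - {x}, insert x (insert (a, d) D)))))"
    and ord: "a < b" "b < c" "c < d"
    and x1: "(U, insert (a, b) (insert (c, d) D)) \<in> dotted_diagrams n k"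
    and x2: "(U, insert (a, d) (insert (b, c) D)) \<in> dotted_diagrams n k"
    using assms unfolding type_II_def by blast
  have disj: "U \<inter> D = {}" using x1 by (auto simp: dotted_diagrams_def)
  have M1: "crossingless_matching n (insert (a, d) (insert (b, c) (U \<union> D)))"
    using x2 by (simp add: dotted_diagrams_def)
  have M2: "crossingless_matching n (insert (a, b) (insert (c, d) (U \<union> D)))"
    using x1 by (simp add: dotted_diagrams_def)
  have out: "(a, b) \<notin> U \<union> D" "(c, d) \<notin> U \<union> D" "(a, d) \<notin> U \<union> D" "(b, c) \<notin> U \<union> D"
    using two_completions(6)[OF M1 M2 ord] by blast+
  have fin: "finite D" using crossingless_finite[OF M1] by simp
  have card: "Suc (Suc (card D)) = k" using x2 fin out ord by (simp add: dotted_diagrams_def)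
  have xs: "(insert (b, c) U - {x}, insert x (insert (a, d) D)) \<in> dotted_diagrams n k" if "x \<in> enclosing U a d" for x
  proof (rule dotted_diagramsI)
    have x: "x \<in> U" "x \<noteq> (a, d)" using that by (auto simp: enclosing_def nested_def)
    then show "(insert (b, c) U - {x}) \<inter> insert x (insert (a, d) D) = {}" using disj out ord by auto
    have "x \<noteq> (b, c)" using x out by auto
    then have "(insert (b, c) U - {x}) \<union> insert x (insert (a, d) D) = insert (a, d) (insert (b, c) (U \<union> D))"
      using x by auto
    then show "crossingless_matching n ((insert (b, c) U - {x}) \<union> insert x (insert (a, d) D))" using M1 by simp
    have "x \<notin> insert (a, d) D" "(a, d) \<notin> D" using x disj out by blast+
    then show "card (insert x (insert (a, d) D)) = k" using fin card by simp
  qed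
  show ?thesis
  proof (rule psi_image_null)
    show "r \<in> free_on (dotted_diagrams n k)"
      unfolding r using x1 x2 xs
      by (intro free.subspace_diff[OF subspace_free_on] free.subspace_add[OF subspace_free_on]
          free.subspace_scale[OF subspace_free_on] free.subspace_sum[OF subspace_free_on] basis_free_on)
  next
    fix s assume s: "projected n k s"
    let ?K = "ray_const k * hpow (- int ((k * k - k) div 2))"
    let ?t = "\<lambda>p. s (k + p - 1)"
    have ev: "spin_eval (lin_ext q_to_half (psi_diagram n k) (basis x)) s = ?K * arc_value n ?t x"
      if "x \<in> dotted_diagrams n k" for x
      using spin_eval_lin_ext_basis[OF that s] .
    have sum: "(\<Sum>x\<in>enclosing U a d. hpow (2 * (int (depth U a d x) - 1 - int (dots_between D a d x)))
        * spin_eval (lin_ext q_to_half (psi_diagram n k) (basis (insert (b, c) U - {x}, insert x (insert (a, d) D)))) s)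
      = ?K * (\<Sum>x\<in>enclosing U a d. hpow (2 * (int (depth U a d x) - 1 - int (dots_between D a d x)))
        * arc_value n ?t (insert (b, c) U - {x}, insert x (insert (a, d) D)))"
      unfolding sum_distrib_left by (rule sum.cong[OF refl]) (simp only: ev[OF xs] mult_ac)
    show "spin_eval (lin_ext q_to_half (psi_diagram n k) r) s = 0"
      unfolding r spin_eval_linear sum ev[OF x1] ev[OF x2] type_II_value[OF disj M1 M2 ord]
      by (simp add: algebra_simps)
  qed
qed

theorem theorem4p4p2:
  fixes n k :: nat and \<kappa> :: convention
  assumes "k \<le> n"
  shows "(\<exists>!\<psi>. \<psi> \<in> russell_space n k \<rightarrow>\<^sub>E KL_space \<kappa> n k \<and>
             (\<forall>f\<in>russell_free n k.
                \<psi> (russell_class n k f) = KL_proj \<kappa> n k (psi_tilde \<kappa> n k f)))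
       \<and> (\<forall>r\<in>type_I n k \<union> type_II n k.
             KL_proj \<kappa> n k (psi_tilde \<kappa> n k r) = KL_zero \<kappa> n k)"
  by (rule descends_to_quotients) (use psi_diagram_free_on type_I_null type_II_null in blast)+

end
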